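(* Let $\mathscr{X}$ be a countable (non-empty) set. Consider an upper expectation $\overline{E}_0$ on $\mathcal{L}(\mathscr{X})$ that is downward continuous and a sublinear Markov semigroup $(\overline{\mathrm{T}}_t)_{t\in\mathbb{R}_{\ge0}}$ with uniformly bounded rate. Then there is a sublinear expectation $\overline{E}$ on $\mathscr{M}$ such that (i) for all $f\in\mathcal{L}(\mathscr{X})$, $\overline{E}(f(X_0))=\overline{E}_0(f)$; (ii) for all $t_1,\dots,t_n,t\in\mathbb{R}_{\ge0}$ (with $n\in\mathbb{N}$) such that $t_1<\cdots<t_n<t$ and all $f\in\mathcal{L}(\mathscr{X}^{n+1})$, $$\overline{E}\big(f(X_{t_1},\dots,X_{t_n},X_t)\big)=\overline{E}\big(g(X_{t_1},\dots,X_{t_n})\big),$$ where $g\in\mathcal{L}(\mathscr{X}^n)$ maps $x=(x_1,\dots,x_n)\in\mathscr{X}^n$ to $g(x)\coloneqq\big[\overline{\mathrm{T}}_{t-t_n}f(x_1,\dots,x_n,\bullet)\big](x_n)$; (iii) $\overline{E}$ is downward continuous on $\mathscr{D}_{\delta,\mathrm{b}}$; and (iv) $\overline{E}$ is upward continuous on $\mathscr{M}_{\mathrm{b}}$. Moreover, the restriction of $\overline{E}$ to $\mathscr{M}_{\mathrm{b}}$ is the unique sublinear expectation (on $\mathscr{M}_{\mathrm{b}}$) that has these four properties.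
   Context: $\overline{\mathbb{R}}=\mathbb{R}\cup\{-\infty,+\infty\}$, with the standard conventions (including $0\cdot(\pm\infty)=0$); a sum of extended reals is meaningful if it does not lead to $(+\infty)+(-\infty)$. $\mathcal{L}(\mathcal{Y})$ is the set of bounded real-valued functions on a set $\mathcal{Y}$; $\mathbb{I}_x$ is the indicator of $\{x\}$. Order and limits of functions are pointwise; $(f_n)\searrow f$ (resp. $\nearrow f$) denotes a decreasing (resp. increasing) sequence with pointwise limit $f$. Let $\mathcal{G}$ be a set of extended real functions on a set, containing all constant real functions. A sublinear expectation on $\mathcal{G}$ is a map $\Phi\colon\mathcal{G}\to\overline{\mathbb{R}}$ that is isotone ($f\le g$ implies $\Phi(f)\le\Phi(g)$), constant preserving ($\Phi(\mu)=\mu$ for $\mu\in\mathbb{R}$), positively homogeneous ($\Phi(\mu f)=\mu\Phi(f)$ for real $\mu\ge0$ and $f\in\mathcal{G}$ with $\mu f\in\mathcal{G}$) and subadditive ($\Phi(f+g)\le\Phi(f)+\Phi(g)$ for all $f,g\in\mathcal{G}$ such that $f+g$ is meaningful and in $\mathcal{G}$ and $\Phi(f)+\Phi(g)$ is meaningful). An upper expectation is a sublinear expectation whose domain is a linear space of real functions. For $\mathcal{C}\subseteq\mathcal{G}$, $\Phi$ is downward (resp. upward) continuous on $\mathcal{C}$ if $\lim_n\Phi(f_n)=\Phi(f)$ whenever $f_n,f\in\mathcal{C}$ and $(f_n)\searrow f$ (resp. $(f_n)\nearrow f$); if $\mathcal{C}$ is not mentioned, $\mathcal{C}=\mathcal{G}$.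 $\Omega\subseteq\mathscr{X}^{\mathbb{R}_{\ge0}}$ is the set of càdlàg paths, i.e. maps $\omega\colon\mathbb{R}_{\ge0}\to\mathscr{X}$ that are right-continuous and have left-sided limits, with $\mathscr{X}$ carrying the discrete topology. For $t\in\mathbb{R}_{\ge0}$, $X_t\colon\Omega\to\mathscr{X}\colon\omega\mapsto\omega(t)$; $f(X_{t_1},\dots,X_{t_n})$ is the function $\omega\mapsto f(\omega(t_1),\dots,\omega(t_n))$ on $\Omega$. $\mathscr{U}$ is the set of non-empty finite subsets of $\mathbb{R}_{\ge0}$, $\pi_U\colon\Omega\to\mathscr{X}^U$ maps a path to its restriction to $U$, and $\mathscr{D}\coloneqq\{f\circ\pi_U\colon U\in\mathscr{U},\ f\in\mathcal{L}(\mathscr{X}^U)\}$. $\mathscr{D}_{\delta,\mathrm{b}}\coloneqq\{f\in\mathcal{L}(\Omega)\colon\exists(f_n)_{n\in\mathbb{N}}\in\mathscr{D}^{\mathbb{N}},\ (f_n)\searrow f\}$. $\sigma(\mathscr{D})$ is the smallest $\sigma$-algebra on $\Omega$ making all functions in $\mathscr{D}$ Borel measurable; $\mathscr{M}_{\mathrm{b}}$ (resp. $\mathscr{M}^{\mathrm{b}}$) is the set of $\sigma(\mathscr{D})/\mathcal{B}(\overline{\mathbb{R}})$-measurable functions $f\colon\Omega\to\overline{\mathbb{R}}$ with $\inf f>-\infty$ (resp. $\sup f<+\infty$), and $\mathscr{M}\coloneqq\mathscr{M}_{\mathrm{b}}\cup\mathscr{M}^{\mathrm{b}}$. An upper transition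 operator is a map $\overline{\mathrm{T}}\colon\mathcal{L}(\mathscr{X})\to\mathcal{L}(\mathscr{X})$ such that for every $x\in\mathscr{X}$, $f\mapsto[\overline{\mathrm{T}}f](x)$ is an upper expectation on $\mathcal{L}(\mathscr{X})$; it is downward continuous if each of these component functionals is. An upper transition semigroup is a family $(\overline{\mathrm{T}}_t)_{t\in\mathbb{R}_{\ge0}}$ of upper transition operators with $\overline{\mathrm{T}}_{s+t}=\overline{\mathrm{T}}_s\overline{\mathrm{T}}_t$ for all $s,t>0$ and $\overline{\mathrm{T}}_0=\mathrm{I}$, the identity operator. A sublinear Markov semigroup is an upper transition semigroup such that $\overline{\mathrm{T}}_t$ is downward continuous for all $t>0$. It has uniformly bounded rate if $$\limsup_{t\searrow0}\frac1t\sup\big\{[\overline{\mathrm{T}}_t(1-\mathbb{I}_x)](x)\colon x\in\mathscr{X}\big\}<+\infty.$$ $f(x_1,\dots,x_n,\bullet)$ denotes the function $y\mapsto f(x_1,\dots,x_n,y)$ on $\mathscr{X}$. *)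

theory Defs
  imports "HOL-Analysis.Analysis"
begin

(* All functions take values in ereal; real-valued functions are those that
   avoid the two infinities. A functional on a set G of functions is a total HOL function
   of which only the values on G matter. *)

(* In HOL, PInfty + MInfty has a value, so meaningfulness of sums must be stated. *)
definition meaningful_sum :: "ereal \<Rightarrow> ereal \<Rightarrow> bool" where
  "meaningful_sum a b \<longleftrightarrow> \<not> (a = \<infinity> \<and> b = -\<infinity>) \<and> \<not> (a = -\<infinity> \<and> b = \<infinity>)"

definition sublinear_expectation :: "('a \<Rightarrow> ereal) set \<Rightarrow> (('a \<Rightarrow> ereal) \<Rightarrow> ereal) \<Rightarrow> bool" where
  "sublinear_expectation G \<Phi> \<longleftrightarrow>
     (\<forall>\<mu>::real. (\<lambda>_. ereal \<mu>) \<in> G) \<and>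
     (\<forall>f\<in>G. \<forall>g\<in>G. f \<le> g \<longrightarrow> \<Phi> f \<le> \<Phi> g) \<and>
     (\<forall>\<mu>::real. \<Phi> (\<lambda>_. ereal \<mu>) = ereal \<mu>) \<and>
     (\<forall>\<mu>::real. \<forall>f\<in>G. 0 \<le> \<mu> \<and> (\<lambda>x. ereal \<mu> * f x) \<in> G \<longrightarrow>
        \<Phi> (\<lambda>x. ereal \<mu> * f x) = ereal \<mu> * \<Phi> f) \<and>
     (\<forall>f\<in>G. \<forall>g\<in>G.
        (\<forall>x. meaningful_sum (f x) (g x)) \<and> (\<lambda>x. f x + g x) \<in> G \<and> meaningful_sum (\<Phi> f) (\<Phi> g) \<longrightarrow>
        \<Phi> (\<lambda>x. f x + g x) \<le> \<Phi> f + \<Phi> g)"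

definition linear_space_of_real_funs :: "('a \<Rightarrow> ereal) set \<Rightarrow> bool" where
  "linear_space_of_real_funs G \<longleftrightarrow>
     (\<forall>f\<in>G. \<forall>x. \<bar>f x\<bar> \<noteq> \<infinity>) \<and>
     (\<lambda>_. 0) \<in> G \<and>
     (\<forall>f\<in>G. \<forall>g\<in>G. (\<lambda>x. f x + g x) \<in> G) \<and>
     (\<forall>a::real. \<forall>f\<in>G. (\<lambda>x. ereal a * f x) \<in> G)"

definition upper_expectation :: "('a \<Rightarrow> ereal) set \<Rightarrow> (('a \<Rightarrow> ereal) \<Rightarrow> ereal) \<Rightarrow> bool" where
  "upper_expectation G \<Phi> \<longleftrightarrow> linear_space_of_real_funs G \<and> sublinear_expectation G \<Phi>"

definition decreases_to :: "(nat \<Rightarrow> 'a \<Rightarrow> ereal) \<Rightarrow> ('a \<Rightarrow> ereal) \<Rightarrow> bool" where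
  "decreases_to F f \<longleftrightarrow> decseq F \<and> (\<forall>x. (\<lambda>n. F n x) \<longlonglongrightarrow> f x)"

definition increases_to :: "(nat \<Rightarrow> 'a \<Rightarrow> ereal) \<Rightarrow> ('a \<Rightarrow> ereal) \<Rightarrow> bool" where
  "increases_to F f \<longleftrightarrow> incseq F \<and> (\<forall>x. (\<lambda>n. F n x) \<longlonglongrightarrow> f x)"

definition downward_continuous_on :: "('a \<Rightarrow> ereal) set \<Rightarrow> (('a \<Rightarrow> ereal) \<Rightarrow> ereal) \<Rightarrow> bool" where
  "downward_continuous_on C \<Phi> \<longleftrightarrow>
     (\<forall>F f. (\<forall>n. F n \<in> C) \<and> f \<in> C \<and> decreases_to F f \<longrightarrow> (\<lambda>n. \<Phi> (F n)) \<longlonglongrightarrow> \<Phi> f)"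

definition upward_continuous_on :: "('a \<Rightarrow> ereal) set \<Rightarrow> (('a \<Rightarrow> ereal) \<Rightarrow> ereal) \<Rightarrow> bool" where
  "upward_continuous_on C \<Phi> \<longleftrightarrow>
     (\<forall>F f. (\<forall>n. F n \<in> C) \<and> f \<in> C \<and> increases_to F f \<longrightarrow> (\<lambda>n. \<Phi> (F n)) \<longlonglongrightarrow> \<Phi> f)"

(* Functions that are real-valued and bounded on Y; values outside Y are irrelevant. *)
definition bounded_funs :: "'a set \<Rightarrow> ('a \<Rightarrow> ereal) set" where
  "bounded_funs Y = {f. \<exists>c::real. \<forall>y\<in>Y. \<bar>f y\<bar> \<le> ereal c}"

definition upper_transition_operator :: "(('x \<Rightarrow> ereal) \<Rightarrow> 'x \<Rightarrow> ereal) \<Rightarrow> bool" where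
  "upper_transition_operator T \<longleftrightarrow>
     (\<forall>f\<in>bounded_funs UNIV. T f \<in> bounded_funs UNIV) \<and>
     (\<forall>x. upper_expectation (bounded_funs UNIV) (\<lambda>f. T f x))"

definition downward_continuous_operator :: "(('x \<Rightarrow> ereal) \<Rightarrow> 'x \<Rightarrow> ereal) \<Rightarrow> bool" where
  "downward_continuous_operator T \<longleftrightarrow>
     (\<forall>x. downward_continuous_on (bounded_funs UNIV) (\<lambda>f. T f x))"

definition upper_transition_semigroup :: "(real \<Rightarrow> ('x \<Rightarrow> ereal) \<Rightarrow> 'x \<Rightarrow> ereal) \<Rightarrow> bool" where
  "upper_transition_semigroup T \<longleftrightarrow>
     (\<forall>t\<ge>0. upper_transition_operator (T t)) \<and>
     (\<forall>s>0. \<forall>t>0. \<forall>f\<in>bounded_funs UNIV. T (s + t) f = T s (T t f)) \<and>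
     (\<forall>f\<in>bounded_funs UNIV. T 0 f = f)"

definition sublinear_markov_semigroup :: "(real \<Rightarrow> ('x \<Rightarrow> ereal) \<Rightarrow> 'x \<Rightarrow> ereal) \<Rightarrow> bool" where
  "sublinear_markov_semigroup T \<longleftrightarrow>
     upper_transition_semigroup T \<and> (\<forall>t>0. downward_continuous_operator (T t))"

definition uniformly_bounded_rate :: "(real \<Rightarrow> ('x \<Rightarrow> ereal) \<Rightarrow> 'x \<Rightarrow> ereal) \<Rightarrow> bool" where
  "uniformly_bounded_rate T \<longleftrightarrow>
     Limsup (at_right 0)
       (\<lambda>t. ereal (1 / t) * (SUP x. T t (\<lambda>y. 1 - indicator {x} y) x)) < \<infinity>"

(* Paths are indexed by the nonnegative reals; the values at negative times are fixed to
   undefined, so that equality of paths is equality on the nonnegative reals. *)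
definition cadlag_paths :: "(real \<Rightarrow> 'x) set" where
  "cadlag_paths = {\<omega> \<in> extensional {0..}.
     (\<forall>t\<ge>0. limitin (discrete_topology UNIV) \<omega> (\<omega> t) (at_right t)) \<and>
     (\<forall>t>0. \<exists>x. limitin (discrete_topology UNIV) \<omega> x (at_left t))}"

lemma const_in_cadlag_paths: "restrict (\<lambda>_. x) {0..} \<in> cadlag_paths"
proof -
  have "limitin (discrete_topology UNIV) (restrict (\<lambda>_. x) {0..}) x (at_right t)" if "t \<ge> 0" for t :: real
    using that
    by (auto simp: limitin_def eventually_at_filter intro!: always_eventually)
  moreover have "limitin (discrete_topology UNIV) (restrict (\<lambda>_. x) {0..}) x (at_left t)" if "t > 0" for t :: real
  proof -
    have "eventually (\<lambda>s. s \<in> {0<..<t}) (at_left t)"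
      by (rule eventually_at_leftI[of 0]) (use that in simp_all)
    then have "eventually (\<lambda>s. restrict (\<lambda>_. x) {0..} s = x) (at_left t)"
      by (rule eventually_mono) simp
    then show ?thesis
      unfolding limitin_def by (simp del: restrict_apply) (fastforce elim: eventually_mono simp del: restrict_apply)
  qed
  ultimately show ?thesis
    by (auto simp: cadlag_paths_def)
qed

typedef 'x cadlag_path = "cadlag_paths :: (real \<Rightarrow> 'x) set"
  morphisms path_fun Abs_cadlag_path
  by (intro exI) (rule const_in_cadlag_paths)

definition coord :: "real \<Rightarrow> 'x cadlag_path \<Rightarrow> 'x" where
  "coord t \<omega> = path_fun \<omega> t"

definition path_proj :: "real set \<Rightarrow> 'x cadlag_path \<Rightarrow> (real \<Rightarrow> 'x)" where
  "path_proj U \<omega> = restrict (path_fun \<omega>) U"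

definition fin_dim_funs :: "('x cadlag_path \<Rightarrow> ereal) set" where
  "fin_dim_funs = {f \<circ> path_proj U | f U.
     finite U \<and> U \<noteq> {} \<and> U \<subseteq> {0..} \<and> f \<in> bounded_funs (U \<rightarrow>\<^sub>E UNIV)}"

definition fin_dim_delta_b :: "('x cadlag_path \<Rightarrow> ereal) set" where
  "fin_dim_delta_b = {f \<in> bounded_funs UNIV. \<exists>F. (\<forall>n. F n \<in> fin_dim_funs) \<and> decreases_to F f}"

definition path_algebra :: "'x cadlag_path measure" where
  "path_algebra = sigma UNIV {f -` B | f B. f \<in> fin_dim_funs \<and> B \<in> sets borel}"

definition M_bdd_below :: "('x cadlag_path \<Rightarrow> ereal) set" where
  "M_bdd_below = {f \<in> borel_measurable path_algebra. (INF \<omega>. f \<omega>) > -\<infinity>}"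

definition M_bdd_above :: "('x cadlag_path \<Rightarrow> ereal) set" where
  "M_bdd_above = {f \<in> borel_measurable path_algebra. (SUP \<omega>. f \<omega>) < \<infinity>}"

definition M_all :: "('x cadlag_path \<Rightarrow> ereal) set" where
  "M_all = M_bdd_below \<union> M_bdd_above"

definition has_initial_expectation ::
  "(('x \<Rightarrow> ereal) \<Rightarrow> ereal) \<Rightarrow> (('x cadlag_path \<Rightarrow> ereal) \<Rightarrow> ereal) \<Rightarrow> bool" where
  "has_initial_expectation E0 E \<longleftrightarrow>
     (\<forall>f\<in>bounded_funs UNIV. E (\<lambda>\<omega>. f (coord 0 \<omega>)) = E0 f)"

(* The n-fold product of the state space is the set of lists of length n, and
   ts = [t_1, ..., t_n] with n at least 1. *)
definition has_transitions ::
  "(real \<Rightarrow> ('x \<Rightarrow> ereal) \<Rightarrow> 'x \<Rightarrow> ereal) \<Rightarrow> (('x cadlag_path \<Rightarrow> ereal) \<Rightarrow> ereal) \<Rightarrow> bool" where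
  "has_transitions T E \<longleftrightarrow>
     (\<forall>ts t f. ts \<noteq> [] \<and> set (ts @ [t]) \<subseteq> {0..} \<and> sorted_wrt (<) (ts @ [t]) \<and>
        f \<in> bounded_funs {xs. length xs = length ts + 1} \<longrightarrow>
        (let g = (\<lambda>xs. T (t - last ts) (\<lambda>y. f (xs @ [y])) (last xs))
         in E (\<lambda>\<omega>. f (map (\<lambda>s. coord s \<omega>) (ts @ [t]))) = E (\<lambda>\<omega>. g (map (\<lambda>s. coord s \<omega>) ts))))"

end

theory Submission
  imports Defs
begin

text \<open>Composing the initial expectation with the semigroup gives a sublinear functional on the bounded
  functions of finitely many coordinates. It is continuous along sequences of such functions that
  decrease to zero on the cadlag paths: the bounded rate controls the expected number of jumps on
  every finite set of times, and downward continuity confines each coordinate to a finite set, so a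
  diagonal argument produces a cadlag path on which the functions do not tend to zero whenever their
  expectations do not. By Hahn-Banach the functional is a maximum of linear functionals; each of
  them inherits the continuity and extends to a probability measure by Caratheodory's theorem. The
  supremum of the integrals is the required expectation: upward continuity is monotone convergence,
  and downward continuity is the fact that a single dominated linear functional can be chosen for a
  whole decreasing sequence.

  For uniqueness, the transition property determines an expectation on functions of finitely many
  coordinates, downward continuity on their decreasing limits, and Choquet's capacitability theorem
  shows that the value at a measurable function is approximated from below by the values at such
  limits.\<close>

section \<open>Dominated linear functionals\<close>

text \<open>The functions decrease to zero only on cadlag paths, not on all maps from times to
  states, so choosing a limit in a product of finite sets is not enough: the limit must also be the
  trace of a cadlag path. The rate bound enters twice for this. It bounds the number of jumps up to
  each time, and it makes jumps just after each of the countably many times considered unlikely.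
  Continuity of the sublinear functional is established only at zero, where for a linear functional
  it amounts to countable additivity. It does not carry over to other limits by subtraction, since a
  decreasing limit of cylinder functions need not be a cylinder function; hence the insistence on
  one linear functional for a whole sequence. For uniqueness, a competing expectation is known on
  measurable functions only, while Choquet's argument restricts an uncountable supremum and may
  leave the measurable functions; an outer functional bridges this gap. The Suslin operation is
  applied to functions with values in [0,1] instead of sets, so that its approximants are themselves
  decreasing limits of cylinder functions.\<close>

definition function_space :: "('a \<Rightarrow> real) set \<Rightarrow> bool" where
  "function_space S \<longleftrightarrow>
     (\<forall>c. (\<lambda>_. c) \<in> S) \<and> (\<forall>f\<in>S. \<forall>g\<in>S. (\<lambda>x. f x + g x) \<in> S) \<and> (\<forall>a. \<forall>f\<in>S. (\<lambda>x. a * f x) \<in> S)"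

lemma function_space_const: "function_space S \<Longrightarrow> (\<lambda>_. c) \<in> S"
  and function_space_add: "function_space S \<Longrightarrow> f \<in> S \<Longrightarrow> g \<in> S \<Longrightarrow> (\<lambda>x. f x + g x) \<in> S"
  and function_space_scale: "function_space S \<Longrightarrow> f \<in> S \<Longrightarrow> (\<lambda>x. a * f x) \<in> S"
  by (auto simp: function_space_def)

lemma function_space_uminus: "function_space S \<Longrightarrow> f \<in> S \<Longrightarrow> (\<lambda>x. - f x) \<in> S"
  using function_space_scale[of S f "-1"] by simp

lemma function_space_diff: "function_space S \<Longrightarrow> f \<in> S \<Longrightarrow> g \<in> S \<Longrightarrow> (\<lambda>x. f x - g x) \<in> S"
  using function_space_add[OF _ _ function_space_uminus, of S f g] by simp

lemma function_space_sum:
  assumes "function_space S" "\<And>i. i \<in> I \<Longrightarrow> f i \<in> S"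
  shows "(\<lambda>x. \<Sum>i\<in>I. f i x) \<in> S"
  using assms(2)
proof (induction I rule: infinite_finite_induct)
  case (insert i I)
  then show ?case
    using function_space_add[OF assms(1), of "f i" "\<lambda>x. \<Sum>i\<in>I. f i x"] by simp
qed (auto intro: function_space_const[OF assms(1)])

text \<open>The axioms are kept weak so that they are easy to check for infima. Applying the scaling
  inequality with \<open>a\<close> and with \<open>1/a\<close> gives equality, and writing
  \<open>f = g + (f - g)\<close> turns the condition on nonpositive functions into
  monotonicity.\<close>

definition positive_sublinear :: "('a \<Rightarrow> real) set \<Rightarrow> (('a \<Rightarrow> real) \<Rightarrow> real) \<Rightarrow> bool" where
  "positive_sublinear S p \<longleftrightarrow>
     (\<forall>f\<in>S. \<forall>g\<in>S. p (\<lambda>x. f x + g x) \<le> p f + p g) \<and>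
     (\<forall>a>0. \<forall>f\<in>S. p (\<lambda>x. a * f x) \<le> a * p f) \<and>
     (\<forall>f\<in>S. (\<forall>x. f x \<le> 0) \<longrightarrow> p f \<le> 0)"

lemma positive_sublinear_add:
    "positive_sublinear S p \<Longrightarrow> f \<in> S \<Longrightarrow> g \<in> S \<Longrightarrow> p (\<lambda>x. f x + g x) \<le> p f + p g"
  and positive_sublinear_nonpos:
    "positive_sublinear S p \<Longrightarrow> f \<in> S \<Longrightarrow> (\<And>x. f x \<le> 0) \<Longrightarrow> p f \<le> 0"
  by (auto simp: positive_sublinear_def)

lemma positive_sublinear_mono:
  assumes "function_space S" "positive_sublinear S p" "f \<in> S" "g \<in> S" "\<And>x. f x \<le> g x"
  shows "p f \<le> p g"
proof -
  have "p f \<le> p g + p (\<lambda>x. f x - g x)"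
    using positive_sublinear_add[OF assms(2,4) function_space_diff[OF assms(1,3,4)]] by simp
  also have "p (\<lambda>x. f x - g x) \<le> 0"
    using assms by (intro positive_sublinear_nonpos[OF assms(2)] function_space_diff) auto
  finally show ?thesis by simp
qed

lemma positive_sublinear_zero:
  assumes "function_space S" "positive_sublinear S p"
  shows "p (\<lambda>_. 0) = 0"
proof -
  have "0 \<le> p (\<lambda>_. 0)"
    using positive_sublinear_add[OF assms(2), of "\<lambda>_. 0" "\<lambda>_. 0"] function_space_const[OF assms(1), of 0]
    by simp
  moreover have "p (\<lambda>_. 0) \<le> 0"
    using assms by (intro positive_sublinear_nonpos[OF assms(2)] function_space_const) auto
  ultimately show ?thesis by simp
qed

lemma positive_sublinear_scale:
  assumes S: "function_space S" and p: "positive_sublinear S p" and f: "f \<in> S" and "a \<ge> 0"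
  shows "p (\<lambda>x. a * f x) = a * p f"
proof (cases "a = 0")
  case True
  then show ?thesis using positive_sublinear_zero[OF S p] by simp
next
  case False
  then have a: "a > 0" using assms by simp
  have le: "p (\<lambda>x. b * g x) \<le> b * p g" if "b > 0" "g \<in> S" for b g
    using p that unfolding positive_sublinear_def by blast
  have "p (\<lambda>x. (1/a) * (a * f x)) \<le> (1/a) * p (\<lambda>x. a * f x)"
    using a f S by (intro le function_space_scale) auto
  then have "a * p f \<le> p (\<lambda>x. a * f x)"
    using a by (simp add: field_simps)
  with le[OF a f] show ?thesis by simp
qed

lemma positive_sublinear_neg:
  assumes "function_space S" "positive_sublinear S p" "f \<in> S"
  shows "- p (\<lambda>x. - f x) \<le> p f"
  using positive_sublinear_add[OF assms(2,3) function_space_uminus[OF assms(1,3)]]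
    positive_sublinear_zero[OF assms(1,2)] by simp

text \<open>Common core of two infima: over tilts of one functional, and over a chain in Zorn's
  lemma. Each axiom is asked only up to a smaller element of the value set, which is what directed
  families provide.\<close>

lemma positive_sublinear_Inf:
  fixes N :: "('a \<Rightarrow> real) \<Rightarrow> real set"
  assumes ne: "\<And>f. f \<in> S \<Longrightarrow> N f \<noteq> {}" and bd: "\<And>f. f \<in> S \<Longrightarrow> bdd_below (N f)"
    and S: "function_space S"
    and add: "\<And>f g x y. f \<in> S \<Longrightarrow> g \<in> S \<Longrightarrow> x \<in> N f \<Longrightarrow> y \<in> N g \<Longrightarrow> \<exists>z\<in>N (\<lambda>x. f x + g x). z \<le> x + y"
    and scale: "\<And>f x a. f \<in> S \<Longrightarrow> x \<in> N f \<Longrightarrow> a > 0 \<Longrightarrow> \<exists>z\<in>N (\<lambda>x. a * f x). z \<le> a * x"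
    and nonpos: "\<And>f. f \<in> S \<Longrightarrow> (\<And>x. f x \<le> 0) \<Longrightarrow> \<exists>z\<in>N f. z \<le> 0"
    and q: "\<And>f. f \<in> S \<Longrightarrow> q f = Inf (N f)"
  shows "positive_sublinear S q"
  unfolding positive_sublinear_def
proof (intro conjI ballI allI impI)
  have low: "q f \<le> x" if "f \<in> S" "x \<in> N f" for f x
    using that by (simp add: q cInf_lower bd)
  have approx: "\<exists>x\<in>N f. x < q f + e" if "f \<in> S" "e > 0" for f e
    using cInf_lessD[OF ne[OF that(1)], of "q f + e"] that by (simp add: q)
  show "q (\<lambda>x. f x + g x) \<le> q f + q g" if fg: "f \<in> S" "g \<in> S" for f g
  proof (rule field_le_epsilon)
    fix e :: real assume e: "e > 0"
    obtain x where x: "x \<in> N f" "x < q f + e/2" using approx[OF fg(1), of "e/2"] e by auto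
    obtain y where y: "y \<in> N g" "y < q g + e/2" using approx[OF fg(2), of "e/2"] e by auto
    obtain z where z: "z \<in> N (\<lambda>x. f x + g x)" "z \<le> x + y"
      using add[OF fg x(1) y(1)] by auto
    have "q (\<lambda>x. f x + g x) \<le> z" using low[OF function_space_add[OF S fg] z(1)] .
    with x y z show "q (\<lambda>x. f x + g x) \<le> q f + q g + e" by simp
  qed
  show "q (\<lambda>x. a * f x) \<le> a * q f" if a: "a > 0" and f: "f \<in> S" for a f
  proof (rule field_le_epsilon)
    fix e :: real assume e: "e > 0"
    then have "e / a > 0" using a by simp
    then obtain x where x: "x \<in> N f" "x < q f + e/a" using approx[OF f, of "e/a"] by auto
    obtain z where z: "z \<in> N (\<lambda>x. a * f x)" "z \<le> a * x" using scale[OF f x(1) a] by auto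
    have "q (\<lambda>x. a * f x) \<le> z" using low[OF function_space_scale[OF S f] z(1)] .
    also have "z \<le> a * (q f + e/a)" using z x a by (smt (verit) mult_le_cancel_left_pos)
    finally show "q (\<lambda>x. a * f x) \<le> a * q f + e" using a by (simp add: distrib_left)
  qed
  show "q f \<le> 0" if "f \<in> S" "\<forall>x. f x \<le> 0" for f
    using nonpos[OF that(1)] that low by fastforce
qed

text \<open>The functional is \<open>q g = inf (p (g + a * f n) - a * c)\<close> over
  \<open>a >= 0\<close> and \<open>n\<close>. The infimum is finite because
  \<open>a * c <= p (a * f n)\<close>, which bounds every term below by \<open>- p (- g)\<close>.
  Taking \<open>a = 0\<close> gives \<open>q <= p\<close>; taking \<open>a = 1\<close> at
  \<open>g = - f n\<close> gives the last claim. Every linear functional below \<open>q\<close> is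
  thereby at least \<open>c\<close> at all \<open>f n\<close> simultaneously.\<close>

lemma positive_sublinear_tilt:
  assumes S: "function_space S" and p: "positive_sublinear S p"
    and f: "\<And>n. f n \<in> S" and dec: "\<And>m n x. m \<le> n \<Longrightarrow> f n x \<le> f m x" and c: "\<And>n::nat. c \<le> p (f n)"
  obtains q where "positive_sublinear S q" "\<And>g. g \<in> S \<Longrightarrow> q g \<le> p g" "\<And>n. q (\<lambda>x. - f n x) \<le> - c"
proof -
  define N where "N g = {p (\<lambda>x. g x + a * f n x) - a * c | a n. 0 \<le> a}" for g
  define q where "q g = Inf (N g)" for g
  have mem: "(\<lambda>x. g x + a * f n x) \<in> S" if "g \<in> S" for g a n
    using that S f by (intro function_space_add function_space_scale)
  have bd: "bdd_below (N g)" if g: "g \<in> S" for g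
  proof (rule bdd_belowI[of _ "- p (\<lambda>x. - g x)"], unfold N_def, clarify)
    fix a :: real and n assume a: "0 \<le> a"
    have "a * c \<le> a * p (f n)" using a c by (intro mult_left_mono)
    also have "\<dots> = p (\<lambda>x. (g x + a * f n x) + - g x)"
      using positive_sublinear_scale[OF S p f a] by simp
    also have "\<dots> \<le> p (\<lambda>x. g x + a * f n x) + p (\<lambda>x. - g x)"
      by (intro positive_sublinear_add[OF p] mem g function_space_uminus[OF S])
    finally show "- p (\<lambda>x. - g x) \<le> p (\<lambda>x. g x + a * f n x) - a * c" by simp
  qed
  have self: "p g \<in> N g" for g
    unfolding N_def by (rule CollectI, rule exI[of _ 0]) auto
  have sub: "positive_sublinear S q"
  proof (rule positive_sublinear_Inf[where N = N])
    fix g h x y assume gh: "g \<in> S" "h \<in> S" and "x \<in> N g" "y \<in> N h"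
    then obtain a n b m where x: "x = p (\<lambda>x. g x + a * f n x) - a * c" "0 \<le> a"
      and y: "y = p (\<lambda>x. h x + b * f m x) - b * c" "0 \<le> b" by (auto simp: N_def)
    \<comment> \<open>Subadditivity has to merge two tilts with different indices. The later
      function lies below both, so moving to the larger index only decreases the value.\<close>
    let ?k = "max n m"
    have "p (\<lambda>x. (g x + h x) + (a + b) * f ?k x) \<le> p (\<lambda>x. (g x + a * f n x) + (h x + b * f m x))"
    proof (intro positive_sublinear_mono[OF S p])
      fix u
      have "a * f ?k u \<le> a * f n u" "b * f ?k u \<le> b * f m u"
        using x y dec by (auto intro!: mult_left_mono)
      then show "(g u + h u) + (a + b) * f ?k u \<le> (g u + a * f n u) + (h u + b * f m u)"
        by (simp add: algebra_simps)
    qed (intro function_space_add[OF S] mem gh function_space_scale[OF S] f)+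
    also have "\<dots> \<le> p (\<lambda>x. g x + a * f n x) + p (\<lambda>x. h x + b * f m x)"
      by (intro positive_sublinear_add[OF p] mem gh)
    finally have "p (\<lambda>x. (g x + h x) + (a + b) * f ?k x) - (a + b) * c \<le> x + y"
      using x y by (simp add: algebra_simps)
    moreover have "p (\<lambda>x. (g x + h x) + (a + b) * f ?k x) - (a + b) * c \<in> N (\<lambda>x. g x + h x)"
      using x y unfolding N_def by (intro CollectI exI[of _ "a + b"] exI[of _ ?k]) auto
    ultimately show "\<exists>z\<in>N (\<lambda>x. g x + h x). z \<le> x + y" by blast
  next
    fix g x and b :: real assume g: "g \<in> S" and "x \<in> N g" and b: "b > 0"
    then obtain a n where x: "x = p (\<lambda>x. g x + a * f n x) - a * c" "0 \<le> a" by (auto simp: N_def)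
    have "p (\<lambda>x. b * g x + (b * a) * f n x) = b * p (\<lambda>x. g x + a * f n x)"
      using positive_sublinear_scale[OF S p mem[OF g], of b a n] b by (simp add: algebra_simps)
    moreover have "p (\<lambda>x. g x + a * f n x) = x + a * c" using x by simp
    ultimately have "p (\<lambda>x. b * g x + (b * a) * f n x) - (b * a) * c = b * x"
      by (simp add: distrib_left)
    moreover have "p (\<lambda>x. b * g x + (b * a) * f n x) - (b * a) * c \<in> N (\<lambda>x. b * g x)"
      using x b unfolding N_def by (intro CollectI exI[of _ "b * a"] exI[of _ n]) auto
    ultimately show "\<exists>z\<in>N (\<lambda>x. b * g x). z \<le> b * x" by (metis order_refl)
  next
    fix g assume "g \<in> S" "\<And>x. g x \<le> 0"
    then show "\<exists>z\<in>N g. z \<le> 0" using self positive_sublinear_nonpos[OF p] by blast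
  qed (use self bd S q_def in auto)
  have "q g \<le> p g" if "g \<in> S" for g
    unfolding q_def using self bd[OF that] by (intro cInf_lower)
  moreover have "q (\<lambda>x. - f n x) \<le> - c" for n
  proof -
    have "p (\<lambda>x. - f n x + 1 * f n x) - 1 * c \<in> N (\<lambda>x. - f n x)"
      unfolding N_def by (intro CollectI exI[of _ 1] exI[of _ n]) auto
    then show ?thesis
      unfolding q_def using cInf_lower[OF _ bd[OF function_space_uminus[OF S f]]]
        positive_sublinear_zero[OF S p] by fastforce
  qed
  ultimately show ?thesis using sub that by blast
qed

definition linear_functional :: "('a \<Rightarrow> real) set \<Rightarrow> (('a \<Rightarrow> real) \<Rightarrow> real) \<Rightarrow> bool" where
  "linear_functional S P \<longleftrightarrow>
     (\<forall>f\<in>S. \<forall>g\<in>S. P (\<lambda>x. f x + g x) = P f + P g) \<and> (\<forall>a. \<forall>f\<in>S. P (\<lambda>x. a * f x) = a * P f)"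

lemma linear_functional_add:
    "linear_functional S P \<Longrightarrow> f \<in> S \<Longrightarrow> g \<in> S \<Longrightarrow> P (\<lambda>x. f x + g x) = P f + P g"
  and linear_functional_scale:
    "linear_functional S P \<Longrightarrow> f \<in> S \<Longrightarrow> P (\<lambda>x. a * f x) = a * P f"
  by (simp_all add: linear_functional_def)

lemma linear_functional_sum:
  assumes S: "function_space S" and P: "linear_functional S P" and f: "\<And>i. i \<in> I \<Longrightarrow> f i \<in> S"
  shows "P (\<lambda>x. \<Sum>i\<in>I. f i x) = (\<Sum>i\<in>I. P (f i))"
proof -
  have add: "P (\<lambda>x. f x + g x) = P f + P g" if "f \<in> S" "g \<in> S" for f g
    using P that by (intro linear_functional_add linear_functional_scale)
  have zero: "P (\<lambda>_. 0) = 0" using add[of "\<lambda>_. 0" "\<lambda>_. 0"] function_space_const[OF S, of 0] by simp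
  show ?thesis
    using f
  proof (induction I rule: infinite_finite_induct)
    case (insert i I)
    then show ?case
      using add[of "f i" "\<lambda>x. \<Sum>i\<in>I. f i x"] function_space_sum[OF S, of I f] by simp
  qed (simp_all add: zero)
qed

text \<open>A minimal positive sublinear functional equals each of its tilts, which makes it odd and
  hence linear.\<close>

lemma dominated_linear_functional:
  assumes S: "function_space S" and p: "positive_sublinear S p"
  obtains P where "linear_functional S P" "\<And>g. g \<in> S \<Longrightarrow> P g \<le> p g"
proof -
  \<comment> \<open>Functionals are made zero outside \<open>S\<close>; otherwise two of them could
    agree on \<open>S\<close> without being equal, and minimality could not be turned into an
    equation.\<close>
  define A where "A = {q. positive_sublinear S q \<and> (\<forall>g\<in>S. q g \<le> p g) \<and> (\<forall>g. g \<notin> S \<longrightarrow> q g = 0)}"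
  \<comment> \<open>The order is reversed, so that the maximal element delivered by Zorn's lemma is
    a smallest functional.\<close>
  define R where "R q r \<longleftrightarrow> (\<forall>g. r g \<le> q g)" for q r :: "('a \<Rightarrow> real) \<Rightarrow> real"
  let ?res = "\<lambda>q g. if g \<in> S then q g else (0::real)"
  have res: "positive_sublinear S (?res q)" if "positive_sublinear S q" for q
    using that S unfolding positive_sublinear_def by (auto simp: function_space_add function_space_scale)
  have po: "partial_order_on A (relation_of R A)"
    by (rule partial_order_on_relation_ofI) (auto simp: R_def fun_eq_iff intro: order_trans order_antisym)
  have "\<exists>m\<in>A. \<forall>a\<in>A. R m a \<longrightarrow> a = m"
  proof (rule predicate_Zorn[OF po])
    fix C assume C: "C \<in> Chains (relation_of R A)"
    have CA: "C \<subseteq> A" using C by (auto simp: Chains_def relation_of_def)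
    have tot: "R q r \<or> R r q" if "q \<in> C" "r \<in> C" for q r
      using C that unfolding Chains_def relation_of_def by blast
    show "\<exists>u\<in>A. \<forall>a\<in>C. R a u"
    proof (cases "C = {}")
      case True
      have "?res p \<in> A" using res[OF p] by (auto simp: A_def)
      then show ?thesis using True by blast
    next
      case False
      define N where "N f = (\<lambda>q. q f) ` C" for f :: "'a \<Rightarrow> real"
      define u where "u f = (if f \<in> S then Inf (N f) else 0)" for f
      have bd: "bdd_below (N f)" if f: "f \<in> S" for f
      proof (rule bdd_belowI[of _ "- p (\<lambda>x. - f x)"], unfold N_def, clarify)
        fix q assume "q \<in> C"
        then have "positive_sublinear S q" "q (\<lambda>x. - f x) \<le> p (\<lambda>x. - f x)"
          using CA f S by (auto simp: A_def function_space_uminus)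
        with positive_sublinear_neg[OF S this(1) f] show "- p (\<lambda>x. - f x) \<le> q f" by simp
      qed
      have u: "positive_sublinear S u"
      proof (rule positive_sublinear_Inf[where N = N])
        fix f g x y assume fg: "f \<in> S" "g \<in> S" and "x \<in> N f" "y \<in> N g"
        then obtain q r where q: "q \<in> C" "x = q f" and r: "r \<in> C" "y = r g" by (auto simp: N_def)
        obtain s where s: "s \<in> C" "R q s" "R r s" using tot[OF q(1) r(1)] q r by (metis R_def order_refl)
        then have "s (\<lambda>x. f x + g x) \<le> s f + s g"
          using CA fg by (auto simp: A_def intro!: positive_sublinear_add)
        moreover have "s f \<le> x" "s g \<le> y" using s q r by (auto simp: R_def)
        ultimately show "\<exists>z\<in>N (\<lambda>x. f x + g x). z \<le> x + y"
          using s by (intro bexI[of _ "s (\<lambda>x. f x + g x)"]) (auto simp: N_def)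
      next
        fix f x and a :: real assume f: "f \<in> S" "x \<in> N f" "a > 0"
        then obtain q where "q \<in> C" "x = q f" by (auto simp: N_def)
        then show "\<exists>z\<in>N (\<lambda>x. a * f x). z \<le> a * x"
          using f CA unfolding N_def A_def positive_sublinear_def by blast
      next
        fix f assume f: "f \<in> S" "\<And>x. f x \<le> 0"
        obtain q where "q \<in> C" using False by auto
        then show "\<exists>z\<in>N f. z \<le> 0"
          using f CA unfolding N_def A_def positive_sublinear_def by blast
      qed (use bd S False in \<open>auto simp: N_def u_def\<close>)
      have le: "u g \<le> q g" if "q \<in> C" for q g
        using that CA bd by (auto simp: u_def N_def A_def intro!: cInf_lower)
      moreover have "u \<in> A"
      proof -
        obtain q where "q \<in> C" using False by auto
        then have "\<forall>g\<in>S. u g \<le> p g" using le CA unfolding A_def by (blast intro: order_trans)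
        then show ?thesis using u by (auto simp: A_def u_def)
      qed
      ultimately show ?thesis by (auto simp: R_def)
    qed
  qed
  then obtain m where m: "m \<in> A" and min: "\<And>a. a \<in> A \<Longrightarrow> R m a \<Longrightarrow> a = m" by blast
  then have sub: "positive_sublinear S m" by (simp add: A_def)
  have odd: "m (\<lambda>x. - f x) = - m f" if f: "f \<in> S" for f
  proof -
    \<comment> \<open>The tilt along the constant sequence \<open>f\<close> with the largest
      admissible constant \<open>m f\<close>.\<close>
    obtain q where q: "positive_sublinear S q" "\<And>g. g \<in> S \<Longrightarrow> q g \<le> m g" "q (\<lambda>x. - f x) \<le> - m f"
      using positive_sublinear_tilt[OF S sub, of "\<lambda>_. f" "m f"] f by auto
    have "?res q \<in> A" using res[OF q(1)] q(2) m by (force simp: A_def)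
    moreover have "R m (?res q)" using q(2) m by (auto simp: R_def A_def)
    ultimately have "?res q = m" using min by blast
    then have "m (\<lambda>x. - f x) = q (\<lambda>x. - f x)"
      using function_space_uminus[OF S f] by (auto dest: fun_cong[of _ _ "\<lambda>x. - f x"])
    then have "m (\<lambda>x. - f x) \<le> - m f" using q(3) by simp
    with positive_sublinear_neg[OF S sub f] show ?thesis by simp
  qed
  have add: "m (\<lambda>x. f x + g x) = m f + m g" if fg: "f \<in> S" "g \<in> S" for f g
  proof (rule antisym)
    show "m (\<lambda>x. f x + g x) \<le> m f + m g" using positive_sublinear_add[OF sub fg] .
    have "m (\<lambda>x. - f x + - g x) \<le> m (\<lambda>x. - f x) + m (\<lambda>x. - g x)"
      using fg S by (intro positive_sublinear_add[OF sub] function_space_uminus)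
    then show "m f + m g \<le> m (\<lambda>x. f x + g x)"
      using odd[OF function_space_add[OF S fg]] odd fg by simp
  qed
  have "m (\<lambda>x. a * f x) = a * m f" if f: "f \<in> S" for a f
  proof (cases "a \<ge> 0")
    case True
    then show ?thesis using positive_sublinear_scale[OF S sub f] by simp
  next
    case False
    then have "m (\<lambda>x. - a * f x) = - a * m f"
      using positive_sublinear_scale[OF S sub f, of "-a"] by simp
    then show ?thesis using odd[OF function_space_scale[OF S f, of a]] by simp
  qed
  then have "linear_functional S m" using add by (auto simp: linear_functional_def)
  then show ?thesis using that m by (auto simp: A_def)
qed

text \<open>Tilting before applying Hahn-Banach makes the lower bound hold for all \<open>n\<close>
  with one and the same \<open>P\<close>. For a constant sequence this says that the upper value is
  attained; for a decreasing one it is the source of downward continuity.\<close>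

lemma dominated_linear_functional_ge:
  assumes S: "function_space S" and p: "positive_sublinear S p"
    and f: "\<And>n. f n \<in> S" and dec: "\<And>m n x. m \<le> n \<Longrightarrow> f n x \<le> f m x" and c: "\<And>n::nat. c \<le> p (f n)"
  obtains P where "linear_functional S P" "\<And>g. g \<in> S \<Longrightarrow> P g \<le> p g" "\<And>n. c \<le> P (f n)"
proof -
  obtain q where q: "positive_sublinear S q" "\<And>g. g \<in> S \<Longrightarrow> q g \<le> p g" "\<And>n. q (\<lambda>x. - f n x) \<le> - c"
    by (rule positive_sublinear_tilt[of S p f c]) (use assms in auto)
  obtain P where P: "linear_functional S P" "\<And>g. g \<in> S \<Longrightarrow> P g \<le> q g"
    using dominated_linear_functional[OF S q(1)] by blast
  have "c \<le> P (f n)" for n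
  proof -
    have "P (\<lambda>x. (-1) * f n x) = (-1) * P (f n)" using P(1) f unfolding linear_functional_def by blast
    then show ?thesis using P(2)[OF function_space_uminus[OF S f[of n]]] q(3)[of n] by simp
  qed
  moreover have "P g \<le> p g" if "g \<in> S" for g using P(2) q(2) that order_trans by blast
  ultimately show ?thesis using that P(1) by blast
qed

section \<open>Finite-dimensional expectations\<close>

definition bounded_reals :: "('a \<Rightarrow> real) set" where
  "bounded_reals = {f. \<exists>c. \<forall>x. \<bar>f x\<bar> \<le> c}"

lemma bounded_realsI: "(\<And>x. \<bar>f x\<bar> \<le> c) \<Longrightarrow> f \<in> bounded_reals"
  by (auto simp: bounded_reals_def)

lemma bounded_realsE:
  assumes "f \<in> bounded_reals" obtains c where "c \<ge> 0" "\<And>x. \<bar>f x\<bar> \<le> c"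
proof -
  obtain c where c: "\<And>x. \<bar>f x\<bar> \<le> c" using assms by (auto simp: bounded_reals_def)
  then have "0 \<le> c" using abs_ge_zero order_trans by blast
  then show ?thesis using that c by blast
qed

lemma function_space_bounded_reals: "function_space bounded_reals"
  unfolding function_space_def
proof (intro conjI allI ballI)
  show "(\<lambda>_. c) \<in> bounded_reals" for c :: real
    by (rule bounded_realsI[of _ "\<bar>c\<bar>"]) simp
next
  fix f g :: "'a \<Rightarrow> real" assume "f \<in> bounded_reals" "g \<in> bounded_reals"
  then obtain c d where "\<And>x. \<bar>f x\<bar> \<le> c" "\<And>x. \<bar>g x\<bar> \<le> d" by (metis bounded_realsE)
  then show "(\<lambda>x. f x + g x) \<in> bounded_reals"
    by (intro bounded_realsI[of _ "c + d"]) (meson abs_triangle_ineq add_mono order_trans)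
next
  fix f :: "'a \<Rightarrow> real" and a assume "f \<in> bounded_reals"
  then obtain c where "\<And>x. \<bar>f x\<bar> \<le> c" by (metis bounded_realsE)
  then show "(\<lambda>x. a * f x) \<in> bounded_reals"
    by (intro bounded_realsI[of _ "\<bar>a\<bar> * c"]) (simp add: abs_mult mult_left_mono)
qed

lemma bounded_reals_comp: "f \<in> bounded_reals \<Longrightarrow> (\<lambda>x. f (g x)) \<in> bounded_reals"
  by (auto simp: bounded_reals_def)

lemma bounded_reals_of_bool: "(\<lambda>x. of_bool (Q x)) \<in> bounded_reals"
  by (rule bounded_realsI[of _ 1]) simp

definition real_upper_expectation :: "('a \<Rightarrow> real) set \<Rightarrow> (('a \<Rightarrow> real) \<Rightarrow> real) \<Rightarrow> bool" where
  "real_upper_expectation S p \<longleftrightarrow>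
     function_space S \<and> positive_sublinear S p \<and> (\<forall>c. p (\<lambda>_. c) = c)"

lemma real_upper_expectation_mono:
  assumes "real_upper_expectation S p" "f \<in> S" "g \<in> S" "\<And>x. f x \<le> g x"
  shows "p f \<le> p g"
  using assms positive_sublinear_mono unfolding real_upper_expectation_def by blast

lemma real_upper_expectation_add:
  assumes "real_upper_expectation S p" "f \<in> S" "g \<in> S"
  shows "p (\<lambda>x. f x + g x) \<le> p f + p g"
  using assms positive_sublinear_add unfolding real_upper_expectation_def by blast

lemma real_upper_expectation_scale:
  assumes "real_upper_expectation S p" "f \<in> S" "a \<ge> 0"
  shows "p (\<lambda>x. a * f x) = a * p f"
  using assms positive_sublinear_scale unfolding real_upper_expectation_def by blast

lemma real_upper_expectation_const: "real_upper_expectation S p \<Longrightarrow> p (\<lambda>_. c) = c"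
  unfolding real_upper_expectation_def by blast

lemma real_upper_expectation_bound:
  assumes p: "real_upper_expectation S p" and f: "f \<in> S" "\<And>x. \<bar>f x\<bar> \<le> c"
  shows "\<bar>p f\<bar> \<le> c"
proof -
  have S: "function_space S" using p by (simp add: real_upper_expectation_def)
  have "p f \<le> p (\<lambda>_. c)" "p (\<lambda>_. - c) \<le> p f"
    using f abs_le_D1 by (auto intro!: real_upper_expectation_mono[OF p] function_space_const[OF S] simp: abs_le_iff minus_le_iff)
  then show ?thesis using real_upper_expectation_const[OF p] by (simp add: abs_le_iff)
qed

lemma real_upper_expectation_family_bounded:
  assumes q: "\<And>y. real_upper_expectation bounded_reals (q y)" and f: "f \<in> bounded_reals"
  shows "(\<lambda>y. q y f) \<in> bounded_reals"
proof -
  obtain c where "\<And>x. \<bar>f x\<bar> \<le> c" using f by (metis bounded_realsE)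
  then show ?thesis using real_upper_expectation_bound[OF q f] by (intro bounded_realsI[of _ c]) blast
qed

text \<open>The law of iterated upper expectations: it builds the expectation at finitely many times
  from the one-step operators and the initial expectation.\<close>

lemma real_upper_expectation_comp:
  assumes p: "real_upper_expectation bounded_reals p"
    and q: "\<And>y. real_upper_expectation bounded_reals (q y)"
  shows "real_upper_expectation bounded_reals (\<lambda>f. p (\<lambda>y. q y f))"
  unfolding real_upper_expectation_def positive_sublinear_def
proof (intro conjI ballI allI impI)
  note bd = real_upper_expectation_family_bounded[of q, OF q]
  note S = function_space_bounded_reals
  fix f :: "'b \<Rightarrow> real" assume f: "f \<in> bounded_reals"
  show "p (\<lambda>y. q y (\<lambda>x. f x + g x)) \<le> p (\<lambda>y. q y f) + p (\<lambda>y. q y g)" if g: "g \<in> bounded_reals" for g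
  proof -
    have "p (\<lambda>y. q y (\<lambda>x. f x + g x)) \<le> p (\<lambda>y. q y f + q y g)"
      by (intro real_upper_expectation_mono[OF p] bd function_space_add[OF S] f g real_upper_expectation_add[OF q])
    also have "\<dots> \<le> p (\<lambda>y. q y f) + p (\<lambda>y. q y g)"
      by (intro real_upper_expectation_add[OF p] bd f g)
    finally show ?thesis .
  qed
  show "p (\<lambda>y. q y (\<lambda>x. a * f x)) \<le> a * p (\<lambda>y. q y f)" if "a > 0" for a
    using that real_upper_expectation_scale[OF q f, of a] real_upper_expectation_scale[OF p bd[OF f], of a] by simp
  show "p (\<lambda>y. q y f) \<le> 0" if "\<forall>x. f x \<le> 0"
  proof -
    have "q y f \<le> 0" for y
      using real_upper_expectation_mono[OF q f function_space_const[OF S, of 0]] that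
        real_upper_expectation_const[OF q] by metis
    then show ?thesis
      using real_upper_expectation_mono[OF p bd[OF f] function_space_const[OF S, of 0]]
        real_upper_expectation_const[OF p] by metis
  qed
qed (auto simp: function_space_bounded_reals real_upper_expectation_const[OF p] real_upper_expectation_const[OF q])

lemma bounded_funs_ereal: "f \<in> bounded_reals \<Longrightarrow> (\<lambda>x. ereal (f x)) \<in> bounded_funs UNIV"
  by (auto simp: bounded_reals_def bounded_funs_def)

lemma bounded_funs_UNIV_E:
  assumes "g \<in> bounded_funs UNIV"
  obtains f where "f \<in> bounded_reals" "g = (\<lambda>x. ereal (f x))"
proof -
  obtain c where c: "\<And>x. \<bar>g x\<bar> \<le> ereal c" using assms by (auto simp: bounded_funs_def)
  then have g: "g x = ereal (real_of_ereal (g x))" for x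
    using c[of x] by (cases "g x") auto
  then have "\<bar>real_of_ereal (g x)\<bar> \<le> c" for x using c[of x] by (metis abs_ereal.simps(1) ereal_less_eq(3))
  then have "(\<lambda>x. real_of_ereal (g x)) \<in> bounded_reals" by (rule bounded_realsI)
  then show ?thesis using that g by blast
qed

lemma sublinear_expectation_mem: "sublinear_expectation G \<Phi> \<Longrightarrow> (\<lambda>_. ereal c) \<in> G"
  and sublinear_expectation_mono:
    "sublinear_expectation G \<Phi> \<Longrightarrow> f \<in> G \<Longrightarrow> g \<in> G \<Longrightarrow> f \<le> g \<Longrightarrow> \<Phi> f \<le> \<Phi> g"
  and sublinear_expectation_const: "sublinear_expectation G \<Phi> \<Longrightarrow> \<Phi> (\<lambda>_. ereal c) = ereal c"
  and sublinear_expectation_scale: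
    "sublinear_expectation G \<Phi> \<Longrightarrow> f \<in> G \<Longrightarrow> 0 \<le> a \<Longrightarrow> (\<lambda>x. ereal a * f x) \<in> G \<Longrightarrow>
       \<Phi> (\<lambda>x. ereal a * f x) = ereal a * \<Phi> f"
  and sublinear_expectation_add:
    "sublinear_expectation G \<Phi> \<Longrightarrow> f \<in> G \<Longrightarrow> g \<in> G \<Longrightarrow> (\<And>x. meaningful_sum (f x) (g x)) \<Longrightarrow>
       (\<lambda>x. f x + g x) \<in> G \<Longrightarrow> meaningful_sum (\<Phi> f) (\<Phi> g) \<Longrightarrow> \<Phi> (\<lambda>x. f x + g x) \<le> \<Phi> f + \<Phi> g"
  by (simp_all add: sublinear_expectation_def)

text \<open>Allows real arithmetic instead of \<open>ereal\<close>. For bounded functions in the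
  domain of a sublinear expectation nothing is lost: isotonicity places the value between two real
  constants, so \<open>real_of_ereal\<close> is applied to a finite number.\<close>

definition real_version :: "(('a \<Rightarrow> ereal) \<Rightarrow> ereal) \<Rightarrow> ('a \<Rightarrow> real) \<Rightarrow> real" where
  "real_version \<Phi> f = real_of_ereal (\<Phi> (\<lambda>x. ereal (f x)))"

lemma ereal_real_version:
  assumes E: "sublinear_expectation G \<Phi>" and f: "f \<in> bounded_reals" "(\<lambda>x. ereal (f x)) \<in> G"
  shows "\<Phi> (\<lambda>x. ereal (f x)) = ereal (real_version \<Phi> f)"
proof -
  obtain c where c: "\<And>x. \<bar>f x\<bar> \<le> c" using f by (metis bounded_realsE)
  note cG = sublinear_expectation_mem[OF E] and const = sublinear_expectation_const[OF E]
  note mono = sublinear_expectation_mono[OF E]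
  have "ereal (- c) \<le> \<Phi> (\<lambda>x. ereal (f x))" "\<Phi> (\<lambda>x. ereal (f x)) \<le> ereal c"
    using mono[OF cG f(2), of "- c"] mono[OF f(2) cG, of c] c const
    by (auto simp: le_fun_def abs_le_iff minus_le_iff)
  then show ?thesis unfolding real_version_def by (cases "\<Phi> (\<lambda>x. ereal (f x))") auto
qed

lemma real_upper_expectation_real_version:
  assumes E: "sublinear_expectation G \<Phi>" and G: "\<And>f. f \<in> S \<Longrightarrow> (\<lambda>x. ereal (f x)) \<in> G"
    and S: "function_space S" "S \<subseteq> bounded_reals"
  shows "real_upper_expectation S (real_version \<Phi>)"
  unfolding real_upper_expectation_def positive_sublinear_def
proof (intro conjI ballI allI impI S)
  have eq: "\<Phi> (\<lambda>x. ereal (f x)) = ereal (real_version \<Phi> f)" if "f \<in> S" for f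
    using ereal_real_version[OF E _ G] that S by auto
  have const: "\<Phi> (\<lambda>_. ereal c) = ereal c" for c by (rule sublinear_expectation_const[OF E])
  then show "real_version \<Phi> (\<lambda>_. c) = c" for c by (simp add: real_version_def)
  fix f assume f: "f \<in> S"
  show "real_version \<Phi> (\<lambda>x. f x + g x) \<le> real_version \<Phi> f + real_version \<Phi> g" if g: "g \<in> S" for g
  proof -
    have "\<Phi> (\<lambda>x. ereal (f x) + ereal (g x)) \<le> \<Phi> (\<lambda>x. ereal (f x)) + \<Phi> (\<lambda>x. ereal (g x))"
      using G[OF function_space_add[OF S(1) f g]]
      by (intro sublinear_expectation_add[OF E] G f g) (auto simp: meaningful_sum_def eq f g)
    then show ?thesis using eq[OF f] eq[OF g] eq[OF function_space_add[OF S(1) f g]] by simp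
  qed
  show "real_version \<Phi> (\<lambda>x. a * f x) \<le> a * real_version \<Phi> f" if a: "a > 0" for a
  proof -
    have "\<Phi> (\<lambda>x. ereal a * ereal (f x)) = ereal a * \<Phi> (\<lambda>x. ereal (f x))"
      using G[OF function_space_scale[OF S(1) f, of a]] a
      by (intro sublinear_expectation_scale[OF E] G f) auto
    then show ?thesis using eq[OF f] eq[OF function_space_scale[OF S(1) f, of a]] by simp
  qed
  show "real_version \<Phi> f \<le> 0" if "\<forall>x. f x \<le> 0"
  proof -
    have "\<Phi> (\<lambda>x. ereal (f x)) \<le> \<Phi> (\<lambda>x. ereal 0)"
      using that by (intro sublinear_expectation_mono[OF E] G f sublinear_expectation_mem[OF E]) (auto simp: le_fun_def)
    then show ?thesis using const[of 0] eq[OF f] by simp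
  qed
qed

section \<open>Cadlag paths through prescribed states, and cylinder functions\<close>

lemma path_of_locally_constant:
  fixes w :: "real \<Rightarrow> 'x"
  assumes right: "\<And>t. t \<ge> 0 \<Longrightarrow> \<exists>d>0. \<forall>r. t < r \<and> r < t + d \<longrightarrow> w r = w t"
    and left: "\<And>t. t > 0 \<Longrightarrow> \<exists>d>0. \<exists>x. \<forall>r. t - d < r \<and> r < t \<longrightarrow> w r = x"
  obtains \<omega> where "\<And>t. t \<ge> 0 \<Longrightarrow> coord t \<omega> = w t"
proof -
  \<comment> \<open>In the discrete topology, right-continuity at \<open>t\<close> means being
    constant just after \<open>t\<close>, and a left limit at \<open>t\<close> means being constant
    just before \<open>t\<close>.\<close>
  have "limitin (discrete_topology UNIV) (restrict w {0..}) (w t) (at_right t)" if t: "t \<ge> 0" for t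
  proof -
    obtain d where "d > 0" "\<And>r. t < r \<Longrightarrow> r < t + d \<Longrightarrow> w r = w t" using right[OF t] by blast
    then have "eventually (\<lambda>r. restrict w {0..} r = w t) (at_right t)"
      unfolding eventually_at_right_field using t by (intro exI[of _ "t + d"]) auto
    then show ?thesis unfolding limitin_def by (auto elim: eventually_mono)
  qed
  moreover have "\<exists>x. limitin (discrete_topology UNIV) (restrict w {0..}) x (at_left t)" if t: "t > 0" for t
  proof -
    obtain d x where "d > 0" "\<And>r. t - d < r \<Longrightarrow> r < t \<Longrightarrow> w r = x" using left[OF t] by blast
    \<comment> \<open>The left endpoint is cut off at 0, because the restricted map is
      \<open>undefined\<close> at negative times.\<close>
    then have "eventually (\<lambda>r. restrict w {0..} r = x) (at_left t)"
      unfolding eventually_at_left_field using t by (intro exI[of _ "max 0 (t - d)"]) auto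
    then show ?thesis unfolding limitin_def by (intro exI[of _ x]) (auto elim: eventually_mono)
  qed
  ultimately have "restrict w {0..} \<in> cadlag_paths" by (auto simp: cadlag_paths_def)
  then show ?thesis
    using that[of "Abs_cadlag_path (restrict w {0..})"] by (simp add: coord_def Abs_cadlag_path_inverse)
qed

text \<open>Any assignment of states to finitely many times is realised by a step path. Consequently
  a function of these coordinates on paths is the same thing as a function on the full finite
  product of state spaces.\<close>

lemma path_through_finite:
  fixes w :: "real \<Rightarrow> 'x"
  assumes U: "finite U" "U \<subseteq> {0..}"
  obtains \<omega> where "\<And>t. t \<in> U \<Longrightarrow> coord t \<omega> = w t"
proof -
  \<comment> \<open>The path keeps the state of the last time of \<open>U\<close> so far. Inserting
    0 keeps the maximum well defined, and the path sits at \<open>w 0\<close> before the first time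
    of \<open>U\<close>.\<close>
  define v where "v t = w (Max (insert 0 {u\<in>U. u \<le> t}))" for t
  have gap: "\<exists>d>0. \<forall>u\<in>U. \<not> (t < u \<and> u < t + d) \<and> \<not> (t - d < u \<and> u < t)" for t
  proof -
    have "finite (U - {t})" using U by simp
    then obtain d where d: "d > 0" "\<forall>u\<in>U - {t}. u \<noteq> t \<longrightarrow> d \<le> dist t u"
      using finite_set_avoid[of "U - {t}" t] by auto
    then show ?thesis by (intro exI[of _ d]) (force simp: dist_real_def)
  qed
  have "\<exists>d>0. \<forall>r. t < r \<and> r < t + d \<longrightarrow> v r = v t" for t
  proof -
    obtain d where d: "d > 0" "\<forall>u\<in>U. \<not> (t < u \<and> u < t + d)" using gap by blast
    then have "{u\<in>U. u \<le> r} = {u\<in>U. u \<le> t}" if "t < r" "r < t + d" for r using that by force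
    then have "\<forall>r. t < r \<and> r < t + d \<longrightarrow> v r = v t" unfolding v_def by simp
    then show ?thesis using d(1) by blast
  qed
  moreover have "\<exists>d>0. \<exists>x. \<forall>r. t - d < r \<and> r < t \<longrightarrow> v r = x" for t
  proof -
    obtain d where d: "d > 0" "\<forall>u\<in>U. \<not> (t - d < u \<and> u < t)" using gap by blast
    then have "{u\<in>U. u \<le> r} = {u\<in>U. u < t}" if "t - d < r" "r < t" for r using that by force
    then have "\<forall>r. t - d < r \<and> r < t \<longrightarrow> v r = w (Max (insert 0 {u\<in>U. u < t}))" unfolding v_def by simp
    then show ?thesis using d(1) by blast
  qed
  ultimately obtain \<omega> where \<omega>: "\<And>t. t \<ge> 0 \<Longrightarrow> coord t \<omega> = v t"
    using path_of_locally_constant[of v] by blast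
  have "v t = w t" if "t \<in> U" for t
  proof -
    have "Max (insert 0 {u\<in>U. u \<le> t}) = t"
      using U that by (intro Max_eqI) auto
    then show ?thesis by (simp add: v_def)
  qed
  then have "coord t \<omega> = w t" if "t \<in> U" for t using \<omega>[of t] U that by auto
  then show ?thesis by (rule that)
qed

definition supported_on :: "real set \<Rightarrow> ('x cadlag_path \<Rightarrow> 'b) \<Rightarrow> bool" where
  "supported_on U f \<longleftrightarrow> (\<forall>\<omega> \<omega>'. (\<forall>t\<in>U. coord t \<omega> = coord t \<omega>') \<longrightarrow> f \<omega> = f \<omega>')"

lemma supported_on_mono: "supported_on U f \<Longrightarrow> U \<subseteq> W \<Longrightarrow> supported_on W f"
  unfolding supported_on_def by blast

text \<open>The real-valued counterpart of \<open>fin_dim_funs\<close>, phrased through dependence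
  on coordinates instead of a factorisation. The empty set of times is allowed here, which makes
  constants immediate.\<close>

definition cylinder_funs :: "('x cadlag_path \<Rightarrow> real) set" where
  "cylinder_funs = {f \<in> bounded_reals. \<exists>U. finite U \<and> U \<subseteq> {0..} \<and> supported_on U f}"

lemma cylinder_funsI:
  "f \<in> bounded_reals \<Longrightarrow> finite U \<Longrightarrow> U \<subseteq> {0..} \<Longrightarrow> supported_on U f \<Longrightarrow> f \<in> cylinder_funs"
  unfolding cylinder_funs_def by blast

lemma cylinder_funsE:
  assumes "f \<in> cylinder_funs"
  obtains U where "f \<in> bounded_reals" "finite U" "U \<subseteq> {0..}" "supported_on U f"
  using assms unfolding cylinder_funs_def by blast

lemma cylinder_funs_combine:
  assumes f: "f \<in> cylinder_funs" and g: "g \<in> cylinder_funs" and h: "(\<lambda>\<omega>. h (f \<omega>) (g \<omega>)) \<in> bounded_reals"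
  shows "(\<lambda>\<omega>. h (f \<omega>) (g \<omega>)) \<in> cylinder_funs"
proof -
  obtain U where U: "finite U" "U \<subseteq> {0..}" "supported_on U f" using f by (rule cylinder_funsE)
  obtain W where W: "finite W" "W \<subseteq> {0..}" "supported_on W g" using g by (rule cylinder_funsE)
  have "supported_on (U \<union> W) (\<lambda>\<omega>. h (f \<omega>) (g \<omega>))"
    unfolding supported_on_def
  proof (intro allI impI)
    fix \<omega> \<omega>' :: "'a cadlag_path" assume "\<forall>t\<in>U \<union> W. coord t \<omega> = coord t \<omega>'"
    then have "f \<omega> = f \<omega>'" "g \<omega> = g \<omega>'" using U(3) W(3) unfolding supported_on_def by blast+
    then show "h (f \<omega>) (g \<omega>) = h (f \<omega>') (g \<omega>')" by simp
  qed
  then show ?thesis using U W h by (intro cylinder_funsI[of _ "U \<union> W"]) auto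
qed

lemma cylinder_funs_bounded: "f \<in> cylinder_funs \<Longrightarrow> f \<in> bounded_reals"
  by (simp add: cylinder_funs_def)

lemma cylinder_funs_const: "(\<lambda>_. c) \<in> cylinder_funs"
  by (rule cylinder_funsI[of _ "{}"])
     (auto simp: supported_on_def intro: function_space_const[OF function_space_bounded_reals])

lemma function_space_cylinder_funs: "function_space cylinder_funs"
  unfolding function_space_def
proof (intro conjI allI ballI)
  show "(\<lambda>_. c) \<in> cylinder_funs" for c by (rule cylinder_funs_const)
next
  fix f g :: "'a cadlag_path \<Rightarrow> real" assume "f \<in> cylinder_funs" "g \<in> cylinder_funs"
  then show "(\<lambda>\<omega>. f \<omega> + g \<omega>) \<in> cylinder_funs"
    using cylinder_funs_combine[where h = "\<lambda>x y. x + y" and f = f and g = g]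
      function_space_add[OF function_space_bounded_reals cylinder_funs_bounded cylinder_funs_bounded, of f g]
    by simp
next
  fix f :: "'a cadlag_path \<Rightarrow> real" and a assume "f \<in> cylinder_funs"
  then show "(\<lambda>\<omega>. a * f \<omega>) \<in> cylinder_funs"
    using cylinder_funs_combine[where h = "\<lambda>x y. a * x" and f = f and g = f]
      function_space_scale[OF function_space_bounded_reals cylinder_funs_bounded, of f a] by simp
qed

text \<open>Extends a cylinder function from paths to arbitrary maps of times to states, where
  coordinates can be updated freely. A matching path exists by \<open>path_through_finite\<close>,
  and all matching paths give the same value if \<open>f\<close> is supported on
  \<open>U\<close>.\<close>

definition lift_to_functions :: "real set \<Rightarrow> ('x cadlag_path \<Rightarrow> real) \<Rightarrow> (real \<Rightarrow> 'x) \<Rightarrow> real" where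
  "lift_to_functions U f w = f (SOME \<omega>. \<forall>t\<in>U. coord t \<omega> = w t)"

lemma lift_to_functions_eq:
  assumes "supported_on U f" "\<And>t. t \<in> U \<Longrightarrow> coord t \<omega> = w t"
  shows "lift_to_functions U f w = f \<omega>"
proof -
  define \<omega>' where "\<omega>' = (SOME \<omega>. \<forall>t\<in>U. coord t \<omega> = w t)"
  have "\<forall>t\<in>U. coord t \<omega>' = w t"
    unfolding \<omega>'_def by (rule someI[of "\<lambda>\<omega>. \<forall>t\<in>U. coord t \<omega> = w t" \<omega>]) (use assms in auto)
  then have "f \<omega>' = f \<omega>"
    by (intro assms(1)[unfolded supported_on_def, rule_format]) (simp add: assms(2))
  then show ?thesis by (simp add: lift_to_functions_def \<omega>'_def)
qed

lemma lift_to_functions_bounded: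
  "f \<in> bounded_reals \<Longrightarrow> lift_to_functions U f \<in> bounded_reals"
  unfolding lift_to_functions_def[abs_def] by (rule bounded_reals_comp)

definition independent_of :: "real \<Rightarrow> ((real \<Rightarrow> 'x) \<Rightarrow> real) \<Rightarrow> bool" where
  "independent_of t F \<longleftrightarrow> (\<forall>w y. F (w(t := y)) = F w)"

lemma lift_to_functions_support:
  fixes f :: "'x cadlag_path \<Rightarrow> real"
  assumes U: "finite U" "U \<subseteq> {0..}" and W: "finite W" "W \<subseteq> {0..}"
    and f: "supported_on U f" "supported_on W f"
  shows "lift_to_functions U f = lift_to_functions W f"
proof
  fix w :: "real \<Rightarrow> 'x"
  obtain \<omega> where "\<And>t. t \<in> U \<union> W \<Longrightarrow> coord t \<omega> = w t"
    using path_through_finite[of "U \<union> W" w] U W by auto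
  then show "lift_to_functions U f w = lift_to_functions W f w"
    using lift_to_functions_eq[OF f(1), of \<omega> w] lift_to_functions_eq[OF f(2), of \<omega> w] by simp
qed

lemma independent_of_lift:
  fixes f :: "'x cadlag_path \<Rightarrow> real"
  assumes U: "finite U" "U \<subseteq> {0..}" "supported_on U f" and t: "t \<notin> U"
  shows "independent_of t (lift_to_functions U f)"
  unfolding independent_of_def
proof (intro allI)
  fix w :: "real \<Rightarrow> 'x" and y
  obtain \<omega> where "\<And>t. t \<in> U \<Longrightarrow> coord t \<omega> = w t"
    using path_through_finite[of U w] U by auto
  then show "lift_to_functions U f (w(t := y)) = lift_to_functions U f w"
    using lift_to_functions_eq[OF U(3), of \<omega> w] lift_to_functions_eq[OF U(3), of \<omega> "w(t := y)"] t
    by (metis fun_upd_other)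
qed

text \<open>Continuity is required only along sequences decreasing to zero, which is what tightness
  of the coordinates uses. The rate bound is stated as a linear bound for all times; it follows from
  the behaviour near zero because transition probabilities are at most 1.\<close>

locale real_markov_process =
  fixes e0 :: "('x::countable \<Rightarrow> real) \<Rightarrow> real"
    and T :: "real \<Rightarrow> ('x \<Rightarrow> real) \<Rightarrow> 'x \<Rightarrow> real"
    and rate :: real
  assumes e0: "real_upper_expectation bounded_reals e0"
    and T: "t \<ge> 0 \<Longrightarrow> real_upper_expectation bounded_reals (\<lambda>f. T t f x)"
    and T_add: "s \<ge> 0 \<Longrightarrow> t \<ge> 0 \<Longrightarrow> f \<in> bounded_reals \<Longrightarrow> T (s + t) f = T s (T t f)"
    and T_zero: "f \<in> bounded_reals \<Longrightarrow> T 0 f = f"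
    and e0_vanish: "(\<And>n. F n \<in> bounded_reals) \<Longrightarrow> decseq F \<Longrightarrow> (\<And>x. (\<lambda>n. F n x) \<longlonglongrightarrow> 0) \<Longrightarrow>
      (\<lambda>n. e0 (F n)) \<longlonglongrightarrow> 0"
    and T_vanish: "t \<ge> 0 \<Longrightarrow> (\<And>n. F n \<in> bounded_reals) \<Longrightarrow> decseq F \<Longrightarrow> (\<And>x. (\<lambda>n. F n x) \<longlonglongrightarrow> 0) \<Longrightarrow>
      (\<lambda>n. T t (F n) x) \<longlonglongrightarrow> 0"
    and T_rate: "t \<ge> 0 \<Longrightarrow> T t (\<lambda>y. of_bool (x \<noteq> y)) x \<le> rate * t"
    and rate: "rate > 0"
begin

text \<open>Here \<open>w\<close> records the states observed up to time \<open>t0\<close>, and the list holds the times still to be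
  observed.\<close>

primrec path_exp :: "real \<Rightarrow> (real \<Rightarrow> 'x) \<Rightarrow> real list \<Rightarrow> ((real \<Rightarrow> 'x) \<Rightarrow> real) \<Rightarrow> real" where
  "path_exp t0 w [] F = F w"
| "path_exp t0 w (t # ts) F = T (t - t0) (\<lambda>y. path_exp t (w(t := y)) ts F) (w t0)"

declare path_exp.simps [simp del]

lemma path_exp_Nil [simp]: "path_exp t0 w [] F = F w"
  and path_exp_Cons [simp]:
    "path_exp t0 w (t # ts) F = T (t - t0) (\<lambda>y. path_exp t (w(t := y)) ts F) (w t0)"
  by (simp_all only: path_exp.simps)

lemma real_upper_expectation_path_exp:
  "sorted (t0 # ts) \<Longrightarrow> real_upper_expectation bounded_reals (path_exp t0 w ts)"
proof (induction ts arbitrary: t0 w)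
  case Nil
  show ?case
    by (auto simp: real_upper_expectation_def positive_sublinear_def function_space_bounded_reals)
next
  case (Cons t ts)
  have "real_upper_expectation bounded_reals
      (\<lambda>F. (\<lambda>f. T (t - t0) f (w t0)) (\<lambda>y. path_exp t (w(t := y)) ts F))"
    by (rule real_upper_expectation_comp[where p = "\<lambda>f. T (t - t0) f (w t0)" and
          q = "\<lambda>y. path_exp t (w(t := y)) ts"]) (use Cons in \<open>auto intro!: T Cons.IH\<close>)
  then show ?case by simp
qed

lemma path_exp_bounded:
  "sorted (t0 # ts) \<Longrightarrow> F \<in> bounded_reals \<Longrightarrow> (\<lambda>y. path_exp t0 (w y) ts F) \<in> bounded_reals"
  by (rule real_upper_expectation_family_bounded[OF real_upper_expectation_path_exp])

text \<open>The recorded states are read in two places only: by \<open>F\<close> at the end, and at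
  the current time as the starting state of the next transition. Hence the condition
  \<open>t ~= t0\<close>. If \<open>t\<close> is observed later, the change is overwritten.\<close>

lemma path_exp_independent:
  assumes "independent_of t F" "t \<noteq> t0"
  shows "path_exp t0 (w(t := y)) ts F = path_exp t0 w ts F"
  using assms(2)
proof (induction ts arbitrary: t0 w)
  case Nil
  then show ?case using assms(1) unfolding independent_of_def path_exp_Nil by blast
next
  case (Cons s ts)
  have eq: "path_exp s (w(t := y, s := z)) ts F = path_exp s (w(s := z)) ts F" for z
  proof (cases "s = t")
    case False
    show ?thesis unfolding fun_upd_twist[OF False[symmetric]] by (rule Cons.IH[OF False[symmetric]])
  qed simp
  have w: "(w(t := y)) t0 = w t0" using Cons.prems by simp
  show ?case unfolding path_exp_Cons eq w ..
qed

text \<open>Kolmogorov consistency. An ignored time between two others disappears by the semigroup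
  property, and an ignored last time disappears because the operators preserve constants.\<close>

lemma path_exp_insort:
  assumes "sorted (t0 # ts)" "t0 \<le> t" "t \<notin> set ts" "independent_of t F" "F \<in> bounded_reals"
  shows "path_exp t0 w (insort t ts) F = path_exp t0 w ts F"
  using assms(1-3)
proof (induction ts arbitrary: t0 w)
  case Nil
  then have "path_exp t0 w [t] F = T (t - t0) (\<lambda>y. F w) (w t0)"
    using assms(4) by (simp add: independent_of_def)
  then show ?case using Nil real_upper_expectation_const[OF T, of "t - t0"] by simp
next
  case (Cons s ts)
  show ?case
  proof (cases "t \<le> s")
    case True
    then have ts: "t < s" using Cons by auto
    define h where "h z = path_exp s (w(s := z)) ts F" for z
    have h: "h \<in> bounded_reals"
      unfolding h_def using Cons assms(5) by (intro path_exp_bounded) auto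
    have "path_exp s (w(t := y, s := z)) ts F = h z" for y z
      using path_exp_independent[OF assms(4), of s "w(s := z)" y ts] ts
      by (simp add: h_def fun_upd_twist)
    then have "path_exp t0 w (insort t (s # ts)) F = T (t - t0) (T (s - t) h) (w t0)"
      using True by simp
    also have "\<dots> = T (s - t0) h (w t0)"
      using T_add[of "t - t0" "s - t" h] h Cons ts by simp
    finally show ?thesis by (simp add: h_def[abs_def])
  next
    case False
    then have "path_exp s (w(s := y)) (insort t ts) F = path_exp s (w(s := y)) ts F" for y
      using Cons by (intro Cons.IH) auto
    then show ?thesis using False by simp
  qed
qed

text \<open>The recursion peels off the earliest time, whereas the transition property speaks about
  the latest one.\<close>

lemma path_exp_append:
  assumes "ts \<noteq> []"
  shows "path_exp t0 w (ts @ [t]) F =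
    path_exp t0 w ts (\<lambda>w. T (t - last ts) (\<lambda>y. F (w(t := y))) (w (last ts)))"
  using assms
proof (induction ts arbitrary: t0 w)
  case (Cons s ts)
  then show ?case by (cases "ts = []") (simp_all add: fun_upd_def)
qed simp

text \<open>The initial record is a constant map only as a way of storing the initial state: the
  first transition reads its value at time 0, and observed times overwrite it.\<close>

definition times_exp :: "real list \<Rightarrow> ((real \<Rightarrow> 'x) \<Rightarrow> real) \<Rightarrow> real" where
  "times_exp ts F = e0 (\<lambda>x. path_exp 0 (\<lambda>_. x) ts F)"

lemma real_upper_expectation_times_exp:
  "sorted (0 # ts) \<Longrightarrow> real_upper_expectation bounded_reals (times_exp ts)"
  unfolding times_exp_def[abs_def]
  by (rule real_upper_expectation_comp[OF e0 real_upper_expectation_path_exp])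

lemma times_exp_superset:
  assumes U: "finite U" "U \<subseteq> {0..}" and W: "finite W" "W \<subseteq> {0..}"
    and F: "F \<in> bounded_reals" "\<And>t. t \<notin> U \<Longrightarrow> independent_of t F"
  shows "times_exp (sorted_list_of_set (U \<union> W)) F = times_exp (sorted_list_of_set U) F"
  using W
proof (induction W rule: finite_induct)
  case (insert t W)
  show ?case
  proof (cases "t \<in> U")
    case True
    then have "U \<union> insert t W = U \<union> W" by auto
    then show ?thesis using insert by simp
  next
    case False
    then have t: "t \<notin> U \<union> W" using insert by auto
    have fin: "finite (U \<union> W)" using U insert by simp
    have "sorted (0 # sorted_list_of_set (U \<union> W))" using U insert fin by auto
    then have "path_exp 0 w (insort t (sorted_list_of_set (U \<union> W))) F =
        path_exp 0 w (sorted_list_of_set (U \<union> W)) F" for w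
      using insert t fin by (intro path_exp_insort F) auto
    then show ?thesis using insert t fin by (simp add: times_exp_def)
  qed
qed simp

definition cylinder_exp :: "('x cadlag_path \<Rightarrow> real) \<Rightarrow> real" where
  "cylinder_exp f = (let U = (SOME U. finite U \<and> U \<subseteq> {0..} \<and> supported_on U f)
     in times_exp (sorted_list_of_set U) (lift_to_functions U f))"

text \<open>Two supports of the same function are compared through their union, to which consistency
  applies from both sides. This removes the arbitrary choice in the definition.\<close>

lemma cylinder_exp_eq:
  assumes f: "f \<in> bounded_reals" and U: "finite U" "U \<subseteq> {0..}" "supported_on U f"
  shows "cylinder_exp f = times_exp (sorted_list_of_set U) (lift_to_functions U f)"
proof -
  define W where "W = (SOME U. finite U \<and> U \<subseteq> {0..} \<and> supported_on U f)"
  have W: "finite W \<and> W \<subseteq> {0..} \<and> supported_on W f"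
    unfolding W_def by (rule someI[of _ U]) (use U in blast)
  then have eq: "lift_to_functions W f = lift_to_functions U f"
    by (intro lift_to_functions_support) (use U in auto)
  have "times_exp (sorted_list_of_set W) (lift_to_functions W f) =
      times_exp (sorted_list_of_set (W \<union> U)) (lift_to_functions W f)"
    by (rule times_exp_superset[symmetric]) (use U W f in \<open>auto intro: lift_to_functions_bounded independent_of_lift\<close>)
  also have "\<dots> = times_exp (sorted_list_of_set (U \<union> W)) (lift_to_functions U f)"
    by (simp add: eq Un_commute)
  also have "\<dots> = times_exp (sorted_list_of_set U) (lift_to_functions U f)"
    by (rule times_exp_superset) (use U W f in \<open>auto intro: lift_to_functions_bounded independent_of_lift\<close>)
  finally show ?thesis by (simp add: cylinder_exp_def W_def Let_def)
qed

lemma sorted_Cons_0_list_of_set: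
  "U \<subseteq> {0..} \<Longrightarrow> finite U \<Longrightarrow> sorted (0 # sorted_list_of_set (U :: real set))"
  by auto

lemma real_upper_expectation_cylinder_exp: "real_upper_expectation cylinder_funs cylinder_exp"
  unfolding real_upper_expectation_def positive_sublinear_def
proof (intro conjI ballI allI impI function_space_cylinder_funs)
  fix f :: "'x cadlag_path \<Rightarrow> real" assume f: "f \<in> cylinder_funs"
  then obtain U where U: "f \<in> bounded_reals" "finite U" "U \<subseteq> {0..}" "supported_on U f"
    by (rule cylinder_funsE)
  note u = real_upper_expectation_times_exp[OF sorted_Cons_0_list_of_set]
  show "cylinder_exp (\<lambda>x. f x + g x) \<le> cylinder_exp f + cylinder_exp g" if g: "g \<in> cylinder_funs" for g
  proof -
    obtain W where W: "g \<in> bounded_reals" "finite W" "W \<subseteq> {0..}" "supported_on W g"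
      using g by (rule cylinder_funsE)
    let ?U = "U \<union> W"
    have fin: "finite ?U" "?U \<subseteq> {0..}" using U W by auto
    have f': "supported_on ?U f" and g': "supported_on ?U g"
      using U W by (auto elim: supported_on_mono)
    have fg: "supported_on ?U (\<lambda>x. f x + g x)"
      using f' g' unfolding supported_on_def by (metis (no_types, lifting))
    have "cylinder_exp (\<lambda>x. f x + g x) =
        times_exp (sorted_list_of_set ?U) (\<lambda>w. lift_to_functions ?U f w + lift_to_functions ?U g w)"
      using cylinder_exp_eq[OF function_space_add[OF function_space_bounded_reals U(1) W(1)] fin fg]
      by (simp add: lift_to_functions_def[abs_def])
    also have "\<dots> \<le> cylinder_exp f + cylinder_exp g"
      using cylinder_exp_eq[OF U(1) fin f'] cylinder_exp_eq[OF W(1) fin g'] U W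
        real_upper_expectation_add[OF u[OF fin(2,1)] lift_to_functions_bounded lift_to_functions_bounded, of f g]
      by simp
    finally show ?thesis .
  qed
  show "cylinder_exp (\<lambda>x. a * f x) \<le> a * cylinder_exp f" if a: "a > 0" for a
  proof -
    have "supported_on U (\<lambda>x. a * f x)" using U(4) unfolding supported_on_def by metis
    then show ?thesis
      using cylinder_exp_eq[OF function_space_scale[OF function_space_bounded_reals U(1)] U(2,3), of a]
        cylinder_exp_eq[OF U] a
        real_upper_expectation_scale[OF u[OF U(3,2)] lift_to_functions_bounded[OF U(1)], of a U]
      by (simp add: lift_to_functions_def[abs_def])
  qed
  show "cylinder_exp f \<le> 0" if "\<forall>x. f x \<le> 0"
    using cylinder_exp_eq[OF U] that real_upper_expectation_mono[OF u[OF U(3,2)] lift_to_functions_bounded[OF U(1)], of "\<lambda>_. 0" U]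
      real_upper_expectation_const[OF u[OF U(3,2)], of 0]
    by (simp add: lift_to_functions_def function_space_const[OF function_space_bounded_reals])
next
  have "sorted_list_of_set {} = ([] :: real list)" by simp
  then show "cylinder_exp (\<lambda>_. c) = c" for c
    using cylinder_exp_eq[of "\<lambda>_. c" "{}"] function_space_const[OF function_space_bounded_reals, of c]
    by (simp add: supported_on_def times_exp_def lift_to_functions_def real_upper_expectation_const[OF e0])
qed

lemma cylinder_exp_list:
  assumes "sorted_wrt (<) ts" "set ts \<subseteq> {0..}" and h: "\<And>xs. length xs = length ts \<Longrightarrow> \<bar>h xs\<bar> \<le> c"
  shows "(\<lambda>\<omega>. h (map (\<lambda>s. coord s \<omega>) ts)) \<in> cylinder_funs"
    and "cylinder_exp (\<lambda>\<omega>. h (map (\<lambda>s. coord s \<omega>) ts)) = times_exp ts (\<lambda>w. h (map w ts))"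
proof -
  let ?f = "\<lambda>\<omega>. h (map (\<lambda>s. coord s \<omega>) ts)"
  have f: "?f \<in> bounded_reals" by (rule bounded_realsI[of _ c]) (simp add: h)
  have sup: "supported_on (set ts) ?f" unfolding supported_on_def by (metis (no_types, lifting) map_eq_conv)
  then show "?f \<in> cylinder_funs" using f assms by (intro cylinder_funsI) auto
  have "lift_to_functions (set ts) ?f = (\<lambda>w. h (map w ts))"
  proof
    fix w :: "real \<Rightarrow> 'x"
    obtain \<omega> where \<omega>: "\<And>t. t \<in> set ts \<Longrightarrow> coord t \<omega> = w t"
      using path_through_finite[of "set ts" w] assms(2) by auto
    then have eq: "map (\<lambda>s. coord s \<omega>) ts = map w ts" by simp
    show "lift_to_functions (set ts) ?f w = h (map w ts)"
      using lift_to_functions_eq[OF sup \<omega>] unfolding eq .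
  qed
  moreover have "sorted_list_of_set (set ts) = ts"
    using assms(1) by (simp add: strict_sorted_iff sorted_list_of_set.idem_if_sorted_distinct)
  ultimately show "cylinder_exp ?f = times_exp ts (\<lambda>w. h (map w ts))"
    using cylinder_exp_eq[OF f _ assms(2) sup] by simp
qed

lemma cylinder_exp_transition:
  assumes ts: "ts \<noteq> []" "sorted_wrt (<) (ts @ [t])" "set (ts @ [t]) \<subseteq> {0..}"
    and h: "\<And>xs. length xs = length ts + 1 \<Longrightarrow> \<bar>h xs\<bar> \<le> c"
  shows "cylinder_exp (\<lambda>\<omega>. h (map (\<lambda>s. coord s \<omega>) (ts @ [t]))) =
    cylinder_exp (\<lambda>\<omega>. T (t - last ts) (\<lambda>y. h (map (\<lambda>s. coord s \<omega>) ts @ [y])) (coord (last ts) \<omega>))"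
proof -
  define g where "g xs = T (t - last ts) (\<lambda>y. h (xs @ [y])) (last xs)" for xs
  have last: "last ts \<le> t" "t \<notin> set ts"
    using ts last_in_set[OF ts(1)] by (auto simp: sorted_wrt_append less_imp_le)
  have g: "\<bar>g xs\<bar> \<le> c" if "length xs = length ts" for xs
    unfolding g_def using last that h
    by (intro real_upper_expectation_bound[OF T] bounded_realsI[of _ c]) auto
  have "cylinder_exp (\<lambda>\<omega>. h (map (\<lambda>s. coord s \<omega>) (ts @ [t]))) = times_exp (ts @ [t]) (\<lambda>w. h (map w (ts @ [t])))"
    using ts h by (intro cylinder_exp_list(2)[where c = c]) auto
  also have "\<dots> = times_exp ts (\<lambda>w. T (t - last ts) (\<lambda>y. h (map w ts @ [y])) (w (last ts)))"
    unfolding times_exp_def path_exp_append[OF ts(1)] using last by (simp add: map_fun_upd)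
  also have "\<dots> = times_exp ts (\<lambda>w. g (map w ts))"
    using ts by (simp add: g_def last_map)
  also have "\<dots> = cylinder_exp (\<lambda>\<omega>. g (map (\<lambda>s. coord s \<omega>) ts))"
    using ts g by (intro cylinder_exp_list(2)[where c = c, symmetric]) (auto simp: sorted_wrt_append)
  finally show ?thesis using ts by (simp add: g_def last_map)
qed

lemma cylinder_exp_single:
  assumes "t \<ge> 0" "h \<in> bounded_reals"
  shows "(\<lambda>\<omega>. h (coord t \<omega>)) \<in> cylinder_funs"
    and "cylinder_exp (\<lambda>\<omega>. h (coord t \<omega>)) = e0 (T t h)"
proof -
  obtain c where c: "\<And>x. \<bar>h x\<bar> \<le> c" using assms(2) by (metis bounded_realsE)
  show "(\<lambda>\<omega>. h (coord t \<omega>)) \<in> cylinder_funs"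
    using cylinder_exp_list(1)[of "[t]" "\<lambda>xs. h (hd xs)" c] assms(1) c by simp
  show "cylinder_exp (\<lambda>\<omega>. h (coord t \<omega>)) = e0 (T t h)"
    using cylinder_exp_list(2)[of "[t]" "\<lambda>xs. h (hd xs)" c] assms(1) c by (simp add: times_exp_def)
qed

lemma cylinder_exp_initial:
  "h \<in> bounded_reals \<Longrightarrow> cylinder_exp (\<lambda>\<omega>. h (coord 0 \<omega>)) = e0 h"
  using cylinder_exp_single(2)[of 0 h] T_zero by simp

text \<open>The rate bound is uniform in the state at time \<open>s\<close>, so it is a constant
  bound that survives applying \<open>T s\<close> and then \<open>e0\<close>.\<close>

lemma cylinder_exp_jump:
  assumes "0 \<le> s" "s < t"
  shows "(\<lambda>\<omega> :: 'x cadlag_path. of_bool (coord s \<omega> \<noteq> coord t \<omega>) :: real) \<in> cylinder_funs"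
    and "cylinder_exp (\<lambda>\<omega> :: 'x cadlag_path. of_bool (coord s \<omega> \<noteq> coord t \<omega>) :: real) \<le> rate * (t - s)"
proof -
  let ?h = "\<lambda>xs. of_bool (xs ! 0 \<noteq> xs ! 1) :: real"
  show "(\<lambda>\<omega> :: 'x cadlag_path. of_bool (coord s \<omega> \<noteq> coord t \<omega>) :: real) \<in> cylinder_funs"
    using cylinder_exp_list(1)[of "[s, t]" ?h 1] assms by simp
  have "cylinder_exp (\<lambda>\<omega> :: 'x cadlag_path. of_bool (coord s \<omega> \<noteq> coord t \<omega>) :: real) =
      e0 (\<lambda>x. T s (\<lambda>y. T (t - s) (\<lambda>z. of_bool (y \<noteq> z)) y) x)"
    using cylinder_exp_list(2)[of "[s, t]" ?h 1] assms by (simp add: times_exp_def)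
  also have "\<dots> \<le> rate * (t - s)"
  proof -
    have 1: "T (t - s) (\<lambda>z. of_bool (y \<noteq> z)) y \<le> rate * (t - s)" for y using T_rate[of "t - s"] assms by simp
    have bd: "(\<lambda>y. T (t - s) (\<lambda>z. of_bool (y \<noteq> z)) y) \<in> bounded_reals"
      using assms by (intro bounded_realsI[of _ 1] real_upper_expectation_bound[OF T] bounded_reals_of_bool) auto
    note c = function_space_const[OF function_space_bounded_reals]
    have 2: "T s (\<lambda>y. T (t - s) (\<lambda>z. of_bool (y \<noteq> z)) y) x \<le> rate * (t - s)" for x
      using real_upper_expectation_mono[OF T[OF assms(1)] bd c 1]
        real_upper_expectation_const[OF T[OF assms(1)]] by simp
    show ?thesis
      using real_upper_expectation_mono[OF e0 real_upper_expectation_family_bounded[OF T[OF assms(1)] bd] c 2]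
        real_upper_expectation_const[OF e0] by simp
  qed
  finally show "cylinder_exp (\<lambda>\<omega> :: 'x cadlag_path. of_bool (coord s \<omega> \<noteq> coord t \<omega>) :: real) \<le> rate * (t - s)" .
qed

text \<open>A countable state space is exhausted by finite sets, and the indicators of their
  complements decrease to zero. Vanishing passes first through \<open>T t\<close> pointwise and then
  through \<open>e0\<close>.\<close>

lemma cylinder_exp_tight:
  assumes t: "t \<ge> 0" and e: "e > 0"
  obtains K where "finite K" "cylinder_exp (\<lambda>\<omega>. of_bool (coord t \<omega> \<notin> K)) < e"
proof -
  define K where "K n = {x :: 'x. to_nat x < n}" for n
  define F where "F n x = (of_bool (x \<notin> K n) :: real)" for n x
  have "finite (K n)" for n
    unfolding K_def by (rule finite_imageD[of to_nat]) (auto intro: finite_subset[of _ "{..<n}"])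
  have F: "F n \<in> bounded_reals" for n unfolding F_def by (rule bounded_reals_of_bool)
  have dec: "decseq F" by (intro decseq_SucI le_funI) (simp add: F_def K_def)
  have lim: "(\<lambda>n. F n x) \<longlonglongrightarrow> 0" for x
  proof (rule tendsto_eventually)
    show "\<forall>\<^sub>F n in sequentially. F n x = 0"
      using eventually_gt_at_top[of "to_nat x"] by eventually_elim (simp add: F_def K_def)
  qed
  have "(\<lambda>n. e0 (T t (F n))) \<longlonglongrightarrow> 0"
  proof (rule e0_vanish)
    show "T t (F n) \<in> bounded_reals" for n by (rule real_upper_expectation_family_bounded[OF T[OF t] F])
    show "decseq (\<lambda>n. T t (F n))"
      using decseq_SucD[OF dec] by (intro decseq_SucI le_funI real_upper_expectation_mono[OF T[OF t] F F]) (simp add: le_fun_def)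
    show "(\<lambda>n. T t (F n) x) \<longlonglongrightarrow> 0" for x by (rule T_vanish[OF t F dec lim])
  qed
  then have "\<forall>\<^sub>F n in sequentially. e0 (T t (F n)) < e" using e by (rule order_tendstoD)
  then obtain n where "e0 (T t (F n)) < e" by (auto dest: eventually_happens)
  then have "cylinder_exp (\<lambda>\<omega>. of_bool (coord t \<omega> \<notin> K n)) < e"
    using cylinder_exp_single(2)[OF t F, of n] by (simp add: F_def)
  then show ?thesis using that \<open>finite (K n)\<close> by blast
qed

end

section \<open>Continuity on cadlag paths\<close>

lemma real_upper_expectation_sum:
  assumes p: "real_upper_expectation S p" and f: "\<And>i. i \<in> I \<Longrightarrow> f i \<in> S"
  shows "p (\<lambda>x. \<Sum>i\<in>I. f i x) \<le> (\<Sum>i\<in>I. p (f i))"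
  using f
proof (induction I rule: infinite_finite_induct)
  case (insert i I)
  have S: "function_space S" using p by (simp add: real_upper_expectation_def)
  have "p (\<lambda>x. f i x + (\<Sum>i\<in>I. f i x)) \<le> p (f i) + p (\<lambda>x. \<Sum>i\<in>I. f i x)"
    using insert.prems by (intro real_upper_expectation_add[OF p] function_space_sum[OF S]) auto
  then show ?case using insert by fastforce
qed (simp_all add: real_upper_expectation_const[OF p])

text \<open>Koenig's argument: the pigeonhole principle fixes one more entry on ever smaller
  infinite sets of indices. It is used both for limits of paths and for limits of branches in the
  capacitability proof.\<close>

lemma infinitely_often_agreeing:
  assumes fin: "\<And>i. finite (K i)" and x: "\<And>i m. i \<le> m \<Longrightarrow> x m i \<in> K i"
  obtains y where "\<And>j. infinite {m :: nat. \<forall>i<j. x m i = y i}"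
proof -
  define Q where "Q j A B \<longleftrightarrow> B \<subseteq> A \<and> (\<exists>c. \<forall>m\<in>B. x m j = c)" for j and A B :: "nat set"
  have "\<exists>A. \<forall>j. infinite (A j) \<and> Q j (A j) (A (Suc j))"
  proof (rule dependent_nat_choice)
    show "\<exists>A :: nat set. infinite A" using infinite_UNIV_nat by blast
    fix A :: "nat set" and j assume A: "infinite A"
    \<comment> \<open>Entry \<open>j\<close> is confined to the finite set \<open>K j\<close> only
      from index \<open>j\<close> on, so the finitely many earlier indices are discarded
      first.\<close>
    have "A = (A \<inter> {..<j}) \<union> (A \<inter> {j..})" by auto
    then have inf: "infinite (A \<inter> {j..})" using A by (metis finite_Int finite_UnI finite_lessThan)
    have "finite ((\<lambda>m. x m j) ` (A \<inter> {j..}))"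
      by (rule finite_subset[OF _ fin[of j]]) (auto simp: x)
    then obtain a where "infinite {m \<in> A \<inter> {j..}. x m j = x a j}"
      using pigeonhole_infinite[OF inf] by blast
    then show "\<exists>B. infinite B \<and> Q j A B" unfolding Q_def
      by (intro exI[of _ "{m \<in> A \<inter> {j..}. x m j = x a j}"]) auto
  qed
  then obtain A where inf: "\<And>j. infinite (A j)" and Q: "\<And>j. Q j (A j) (A (Suc j))" by blast
  have "\<forall>j. \<exists>c. \<forall>m\<in>A (Suc j). x m j = c" using Q unfolding Q_def by blast
  then obtain y where y: "\<And>j m. m \<in> A (Suc j) \<Longrightarrow> x m j = y j" by metis
  have dec: "A k \<subseteq> A j" if "j \<le> k" for j k
    using that by (induction rule: dec_induct) (use Q Q_def in blast)+
  have "A j \<subseteq> {m. \<forall>i<j. x m i = y i}" for j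
    using y dec[of "Suc _" j] by (auto simp: Suc_le_eq)
  then have "infinite {m. \<forall>i<j. x m i = y i}" for j using inf infinite_super by blast
  then show ?thesis by (rule that)
qed

section \<open>Counting jumps along finite sets of times\<close>

fun jumps :: "(real \<Rightarrow> 'x) \<Rightarrow> real list \<Rightarrow> nat" where
  "jumps w [] = 0"
| "jumps w [t] = 0"
| "jumps w (s # t # ts) = of_bool (w s \<noteq> w t) + jumps w (t # ts)"

lemma jumps_Cons_ge: "jumps w ts \<le> jumps w (t # ts)"
  by (cases ts) auto

lemma jumps_append_ge: "jumps w ts + jumps w us \<le> jumps w (ts @ us)"
proof (induction ts rule: induct_list012)
  case (2 t)
  then show ?case using jumps_Cons_ge by simp
qed auto

text \<open>A triangle inequality: if the states at two neighbouring times differ, the inserted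
  state differs from at least one of them. The induction carries the preceding time along, since a
  jump involves two neighbours.\<close>

lemma jumps_insort_ge: "jumps w ts \<le> jumps w (insort t ts)"
proof -
  have "jumps w (a # ts) \<le> jumps w (a # insort t ts)" for a
  proof (induction ts arbitrary: a)
    case (Cons s ts)
    then show ?case by auto
  qed simp
  then show ?thesis by (cases ts) (auto simp: jumps_Cons_ge)
qed

lemma jumps_mono:
  assumes "finite G" "F \<subseteq> G"
  shows "jumps w (sorted_list_of_set F) \<le> jumps w (sorted_list_of_set G)"
proof -
  have fin: "finite F" using assms finite_subset by blast
  have "jumps w (sorted_list_of_set F) \<le> jumps w (sorted_list_of_set (F \<union> H))" if "finite H" for H
    using that
  proof (induction H rule: finite_induct)
    case (insert t H)
    show ?case
    proof (cases "t \<in> F")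
      case True
      then show ?thesis using insert by (simp add: insert_absorb)
    next
      case False
      then have "sorted_list_of_set (F \<union> insert t H) = insort t (sorted_list_of_set (F \<union> H))"
        using fin insert by simp
      then show ?thesis using insert jumps_insort_ge order_trans by metis
    qed
  qed simp
  from this[OF assms(1)] show ?thesis using assms(2) by (simp add: Un_absorb1)
qed

lemma jumps_cong: "(\<And>t. t \<in> set ts \<Longrightarrow> w t = v t) \<Longrightarrow> jumps w ts = jumps v ts"
  by (induction w ts rule: jumps.induct) auto

text \<open>Pairs of times with different states are found ever closer to \<open>t\<close>. Each new
  pair is put in front of all times chosen so far and contributes a jump of its own.\<close>

lemma jumps_unbounded_right:
  assumes osc: "\<And>d. d > 0 \<Longrightarrow> \<exists>a b. a \<in> S \<and> b \<in> S \<and> t < a \<and> a < b \<and> b < t + d \<and> w a \<noteq> w b"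
  shows "\<exists>ts. sorted_wrt (<) ts \<and> set ts \<subseteq> S \<inter> {t<..<t + 1} \<and> n \<le> jumps w ts"
proof (induction n)
  case 0
  show ?case by (rule exI[of _ "[]"]) simp
next
  case (Suc n)
  then obtain ts where ts: "sorted_wrt (<) ts" "set ts \<subseteq> S \<inter> {t<..<t + 1}" "n \<le> jumps w ts" by blast
  \<comment> \<open>The distance from \<open>t\<close> to the nearest chosen time, so that the new
    pair precedes all of them. Inserting 1 covers the empty list and keeps the pair below
    \<open>t + 1\<close>.\<close>
  define d where "d = Min (insert 1 ((\<lambda>r. r - t) ` set ts))"
  have "d > 0" unfolding d_def using ts(2) by (subst Min_gr_iff) auto
  have "d \<le> 1" unfolding d_def by (rule Min_le) auto
  have le: "t + d \<le> r" if "r \<in> set ts" for r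
  proof -
    have "d \<le> r - t" unfolding d_def using that by (intro Min_le) auto
    then show ?thesis by simp
  qed
  obtain a b where ab: "a \<in> S" "b \<in> S" "t < a" "a < b" "b < t + d" "w a \<noteq> w b"
    using osc[OF \<open>d > 0\<close>] by blast
  have "jumps w [a, b] + jumps w ts \<le> jumps w ([a, b] @ ts)" by (rule jumps_append_ge)
  then have "Suc n \<le> jumps w (a # b # ts)" using ab ts by simp
  moreover have "sorted_wrt (<) (a # b # ts)" "set (a # b # ts) \<subseteq> S \<inter> {t<..<t + 1}"
    using ab ts \<open>d \<le> 1\<close> le by force+
  ultimately show ?case by blast
qed

text \<open>Mirror image of the previous argument: the pairs approach \<open>t\<close> from below
  and are appended at the end.\<close>

lemma jumps_unbounded_left:
  assumes osc: "\<And>d. d > 0 \<Longrightarrow> \<exists>a b. a \<in> S \<and> b \<in> S \<and> t - d < a \<and> a < b \<and> b < t \<and> w a \<noteq> w b"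
  shows "\<exists>ts. sorted_wrt (<) ts \<and> set ts \<subseteq> S \<inter> {t - 1<..<t} \<and> n \<le> jumps w ts"
proof (induction n)
  case 0
  show ?case by (rule exI[of _ "[]"]) simp
next
  case (Suc n)
  then obtain ts where ts: "sorted_wrt (<) ts" "set ts \<subseteq> S \<inter> {t - 1<..<t}" "n \<le> jumps w ts" by blast
  define d where "d = Min (insert 1 ((\<lambda>r. t - r) ` set ts))"
  have "d > 0" unfolding d_def using ts(2) by (subst Min_gr_iff) auto
  have "d \<le> 1" unfolding d_def by (rule Min_le) auto
  have le: "r \<le> t - d" if "r \<in> set ts" for r
  proof -
    have "d \<le> t - r" unfolding d_def using that by (intro Min_le) auto
    then show ?thesis by simp
  qed
  obtain a b where ab: "a \<in> S" "b \<in> S" "t - d < a" "a < b" "b < t" "w a \<noteq> w b"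
    using osc[OF \<open>d > 0\<close>] by blast
  have "jumps w ts + jumps w [a, b] \<le> jumps w (ts @ [a, b])" by (rule jumps_append_ge)
  then have "Suc n \<le> jumps w (ts @ [a, b])" using ab ts by simp
  moreover have "sorted_wrt (<) (ts @ [a, b])" "set (ts @ [a, b]) \<subseteq> S \<inter> {t - 1<..<t}"
    using ab ts \<open>d \<le> 1\<close> le by (force simp: sorted_wrt_append)+
  ultimately show ?case by blast
qed

text \<open>The path is the right limit of \<open>w\<close> along \<open>S\<close>. Without a right
  or left limit at some time, \<open>w\<close> would oscillate there and have arbitrarily many jumps
  in a bounded interval. On \<open>S\<close> the right limit is \<open>w\<close> itself by the last
  assumption.\<close>

lemma path_through_dense:
  fixes w :: "real \<Rightarrow> 'x"
  assumes S: "S \<subseteq> {0..}" and dense: "\<And>a b. 0 \<le> a \<Longrightarrow> a < b \<Longrightarrow> \<exists>r\<in>S. a < r \<and> r < b"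
    and jumps: "\<And>n F. finite F \<Longrightarrow> F \<subseteq> S \<inter> {0..real n} \<Longrightarrow> jumps w (sorted_list_of_set F) \<le> M n"
    and right: "\<And>t. t \<in> S \<Longrightarrow> \<exists>d>0. \<forall>r\<in>S. t < r \<and> r < t + d \<longrightarrow> w r = w t"
  obtains \<omega> where "\<And>t. t \<in> S \<Longrightarrow> coord t \<omega> = w t"
proof -
  \<comment> \<open>The state \<open>x\<close> is the right limit of \<open>w\<close> at
    \<open>t\<close> along \<open>S\<close>, in the discrete sense.\<close>
  define R where "R t x \<longleftrightarrow> (\<exists>d>0. \<forall>r\<in>S. t < r \<and> r < t + d \<longrightarrow> w r = x)" for t x
  have bound: "jumps w ts \<le> M n" if "sorted_wrt (<) ts" "set ts \<subseteq> S \<inter> {a<..<b}" "b \<le> real n" for ts n a b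
  proof -
    have "sorted_list_of_set (set ts) = ts"
      using that(1) by (simp add: strict_sorted_iff sorted_list_of_set.idem_if_sorted_distinct)
    moreover have "set ts \<subseteq> S \<inter> {0..real n}" using that S by force
    ultimately show ?thesis using jumps[of "set ts" n] by simp
  qed
  have nonosc: False if many: "\<forall>m. \<exists>ts. sorted_wrt (<) ts \<and> set ts \<subseteq> S \<inter> {a<..<b} \<and> m \<le> jumps w ts" for a b
  proof -
    obtain n where n: "b \<le> real n" using real_arch_simple by blast
    obtain ts where "sorted_wrt (<) ts" "set ts \<subseteq> S \<inter> {a<..<b}" "Suc (M n) \<le> jumps w ts"
      using many by blast
    with bound[OF this(1,2) n] show False by simp
  qed
  have "\<exists>x. R t x" for t
  proof (rule ccontr)
    assume no: "\<nexists>x. R t x"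
    have "\<exists>a b. a \<in> S \<and> b \<in> S \<and> t < a \<and> a < b \<and> b < t + d \<and> w a \<noteq> w b" if d: "d > 0" for d
    proof (rule ccontr)
      assume *: "\<not> ?thesis"
      have eq: "w a = w b" if "a \<in> S" "b \<in> S" "t < a" "a < t + d" "t < b" "b < t + d" for a b
      proof (cases a b rule: linorder_cases)
        case less
        then show ?thesis using * that by blast
      next
        case greater
        then have "w b = w a" using * that by blast
        then show ?thesis by simp
      qed simp
      have "\<forall>r\<in>S. t < r \<and> r < t + d \<longrightarrow> w r = w (SOME r. r \<in> S \<and> t < r \<and> r < t + d)"
      proof (intro ballI impI)
        fix r assume r: "r \<in> S" "t < r \<and> r < t + d"
        have "(SOME r. r \<in> S \<and> t < r \<and> r < t + d) \<in> S \<and> t < (SOME r. r \<in> S \<and> t < r \<and> r < t + d)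
          \<and> (SOME r. r \<in> S \<and> t < r \<and> r < t + d) < t + d"
          by (rule someI[of "\<lambda>r. r \<in> S \<and> t < r \<and> r < t + d" r]) (use r in blast)
        then show "w r = w (SOME r. r \<in> S \<and> t < r \<and> r < t + d)" using eq r by blast
      qed
      then show False using no d unfolding R_def by blast
    qed
    then show False using nonosc jumps_unbounded_right[of S t w] by blast
  qed
  define v where "v t = (SOME x. R t x)" for t
  have Rv: "R t (v t)" for t unfolding v_def by (rule someI_ex) fact
  have uniq: "v t = x" if t: "t \<ge> 0" and R: "R t x" for t x
  proof -
    obtain d where d: "d > 0" "\<forall>r\<in>S. t < r \<and> r < t + d \<longrightarrow> w r = x" using R unfolding R_def by blast
    obtain d' where d': "d' > 0" "\<forall>r\<in>S. t < r \<and> r < t + d' \<longrightarrow> w r = v t" using Rv[of t] unfolding R_def by blast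
    obtain r where r: "r \<in> S" "t < r" "r < t + min d d'"
      using dense[of t "t + min d d'"] d(1) d'(1) t by auto
    have "w r = x" using r by (intro d(2)[rule_format]) auto
    moreover have "w r = v t" using r by (intro d'(2)[rule_format]) auto
    ultimately show ?thesis by simp
  qed
  have v_right: "\<exists>d>0. \<forall>r. t < r \<and> r < t + d \<longrightarrow> v r = v t" if t: "t \<ge> 0" for t
  proof -
    obtain d where d: "d > 0" "\<forall>r\<in>S. t < r \<and> r < t + d \<longrightarrow> w r = v t" using Rv[of t] unfolding R_def by blast
    have "v r = v t" if r: "t < r" "r < t + d" for r
      using d r t by (intro uniq) (auto simp: R_def intro!: exI[of _ "t + d - r"])
    then show ?thesis using d by blast
  qed
  have v_left: "\<exists>d>0. \<exists>x. \<forall>r. t - d < r \<and> r < t \<longrightarrow> v r = x" if t: "t > 0" for t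
  proof (rule ccontr)
    assume no: "\<not> ?thesis"
    have "\<exists>a b. a \<in> S \<and> b \<in> S \<and> t - d < a \<and> a < b \<and> b < t \<and> w a \<noteq> w b" if "d > 0" for d
    proof (rule ccontr)
      assume *: "\<not> ?thesis"
      \<comment> \<open>The interval before \<open>t\<close> must stay within the nonnegative times,
        where \<open>S\<close> is dense.\<close>
      define e where "e = min d t"
      have e: "e > 0" "e \<le> d" "e \<le> t" using \<open>d > 0\<close> t by (auto simp: e_def)
      obtain a where a: "a \<in> S" "t - e < a" "a < t" using dense[of "t - e" t] e by auto
      have eq: "w b = w a" if "b \<in> S" "t - e < b" "b < t" for b
      proof (cases a b rule: linorder_cases)
        case less
        moreover have "t - d < a" using a e by simp
        ultimately show ?thesis using * that a by metis
      next
        case greater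
        moreover have "t - d < b" using that e by simp
        ultimately show ?thesis using * that a by metis
      qed simp
      have "v r = w a" if r: "t - e < r" "r < t" for r
        using e r eq by (intro uniq) (auto simp: R_def intro!: exI[of _ "t - r"])
      then show False using no e(1) by blast
    qed
    then show False using nonosc jumps_unbounded_left[of S t w] by blast
  qed
  obtain \<omega> where \<omega>: "\<And>t. t \<ge> 0 \<Longrightarrow> coord t \<omega> = v t"
    using path_of_locally_constant[of v] v_right v_left by blast
  have "coord t \<omega> = w t" if "t \<in> S" for t
    using that S \<omega>[of t] uniq[of t "w t"] right[OF that] by (auto simp: R_def)
  then show ?thesis by (rule that)
qed

section \<open>Jump bounds and continuity at zero of the cylinder expectation\<close>

context real_markov_process
begin

lemma cylinder_funs_of_bool:
  assumes "finite U" "U \<subseteq> {0..}" "supported_on U Q"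
  shows "(\<lambda>\<omega>. of_bool (Q \<omega>) :: real) \<in> cylinder_funs"
  using assms by (intro cylinder_funsI[of _ U] bounded_reals_of_bool) (auto simp: supported_on_def)

lemma supported_on_jumps:
  "supported_on (set ts) (\<lambda>\<omega>. jumps (\<lambda>t. coord t \<omega>) ts)"
  unfolding supported_on_def by (blast intro: jumps_cong)

lemma jumps_le_length: "jumps w ts \<le> length ts"
  by (induction w ts rule: jumps.induct) auto

lemma cylinder_funs_jumps:
  assumes "set ts \<subseteq> {0..}"
  shows "(\<lambda>\<omega> :: 'x cadlag_path. real (jumps (\<lambda>t. coord t \<omega>) ts)) \<in> cylinder_funs"
proof (rule cylinder_funsI[of _ "set ts"])
  show "(\<lambda>\<omega> :: 'x cadlag_path. real (jumps (\<lambda>t. coord t \<omega>) ts)) \<in> bounded_reals"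
    by (rule bounded_realsI[of _ "real (length ts)"]) (simp add: jumps_le_length)
  show "supported_on (set ts) (\<lambda>\<omega> :: 'x cadlag_path. real (jumps (\<lambda>t. coord t \<omega>) ts))"
    using supported_on_jumps[of ts] unfolding supported_on_def by metis
qed (use assms in auto)

text \<open>The bounds for neighbouring times telescope, so the result depends only on the length of
  the interval and not on the number of times.\<close>

lemma cylinder_exp_jumps:
  assumes "sorted_wrt (<) ts" "set ts \<subseteq> {a..b}" "0 \<le> a" "a \<le> b"
  shows "cylinder_exp (\<lambda>\<omega>. real (jumps (\<lambda>t. coord t \<omega>) ts)) \<le> rate * (b - a)"
  using assms
proof (induction ts arbitrary: a rule: induct_list012)
  case (3 s t ts)
  have "cylinder_exp (\<lambda>\<omega>. real (jumps (\<lambda>t. coord t \<omega>) (s # t # ts))) \<le>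
    cylinder_exp (\<lambda>\<omega>. of_bool (coord s \<omega> \<noteq> coord t \<omega>)) + cylinder_exp (\<lambda>\<omega>. real (jumps (\<lambda>t. coord t \<omega>) (t # ts)))"
    using real_upper_expectation_add[OF real_upper_expectation_cylinder_exp cylinder_exp_jump(1) cylinder_funs_jumps, of s t "t # ts"] 3
    by force
  also have "\<dots> \<le> rate * (t - s) + rate * (b - t)"
  proof (intro add_mono cylinder_exp_jump "3.IH"(2))
    show "set (t # ts) \<subseteq> {t..b}" using 3(3,4) by (force simp: less_imp_le)
  qed (use 3 in auto)
  also have "\<dots> = rate * (b - s)" by (simp add: algebra_simps)
  also have "\<dots> \<le> rate * (b - a)" using 3 rate by simp
  finally show ?case .
qed (use rate real_upper_expectation_const[OF real_upper_expectation_cylinder_exp, of 0] in auto)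

text \<open>Markov's inequality; more than \<open>n\<close> jumps means at least
  \<open>n + 1\<close>, which gives the denominator.\<close>

lemma cylinder_exp_jumps_gt:
  assumes "sorted_wrt (<) ts" "set ts \<subseteq> {a..b}" "0 \<le> a" "a \<le> b"
  shows "cylinder_exp (\<lambda>\<omega>. of_bool (jumps (\<lambda>t. coord t \<omega>) ts > n)) \<le> rate * (b - a) / (real n + 1)"
proof -
  let ?J = "\<lambda>\<omega> :: 'x cadlag_path. jumps (\<lambda>t. coord t \<omega>) ts"
  have J: "(\<lambda>\<omega>. real (?J \<omega>)) \<in> cylinder_funs" using assms by (intro cylinder_funs_jumps) auto
  have "supported_on (set ts) (\<lambda>\<omega>. ?J \<omega> > n)"
    using supported_on_jumps[of ts] unfolding supported_on_def by metis
  then have "(\<lambda>\<omega>. of_bool (?J \<omega> > n) :: real) \<in> cylinder_funs"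
    using assms by (intro cylinder_funs_of_bool[of "set ts"]) auto
  then have "cylinder_exp (\<lambda>\<omega>. of_bool (?J \<omega> > n)) \<le> cylinder_exp (\<lambda>\<omega>. (1 / (real n + 1)) * real (?J \<omega>))"
    by (intro real_upper_expectation_mono[OF real_upper_expectation_cylinder_exp] function_space_scale[OF function_space_cylinder_funs] J)
       (auto simp: field_simps)
  also have "\<dots> = (1 / (real n + 1)) * cylinder_exp (\<lambda>\<omega>. real (?J \<omega>))"
    by (intro real_upper_expectation_scale[OF real_upper_expectation_cylinder_exp] J) auto
  also have "\<dots> \<le> (1 / (real n + 1)) * (rate * (b - a))"
    by (intro mult_left_mono cylinder_exp_jumps assms) auto
  finally show ?thesis by simp
qed

text \<open>If the expectations stayed away from zero, there would be paths along which the functions stay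
  away from zero and which obey tightness and jump bounds on growing finite sets of times. A limit
  of these paths along a dense set of times is again the trace of a cadlag path.\<close>

lemma cylinder_exp_vanish:
  assumes f: "\<And>n. f n \<in> cylinder_funs" and dec: "decseq f" and lim: "\<And>\<omega>. (\<lambda>n. f n \<omega>) \<longlonglongrightarrow> 0"
  shows "(\<lambda>n. cylinder_exp (f n)) \<longlonglongrightarrow> 0"
proof (rule ccontr)
  assume not: "\<not> ?thesis"
  note upper = real_upper_expectation_cylinder_exp
  have nonneg: "0 \<le> f n \<omega>" for n \<omega>
  proof (rule decseq_ge[OF _ lim])
    show "decseq (\<lambda>n. f n \<omega>)" using decseq_SucD[OF dec] by (intro decseq_SucI) (simp add: le_fun_def)
  qed
  have E_dec: "cylinder_exp (f n) \<le> cylinder_exp (f m)" if "m \<le> n" for m n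
    using decseqD[OF dec that] by (intro real_upper_expectation_mono[OF upper] f) (simp add: le_fun_def)
  have E_nonneg: "0 \<le> cylinder_exp (f n)" for n
    using real_upper_expectation_mono[OF upper cylinder_funs_const f, of 0 n] nonneg
      real_upper_expectation_const[OF upper] by simp
  obtain e where e: "e > 0" "\<And>n. e \<le> cylinder_exp (f n)"
  proof -
    have "\<exists>e>0. \<forall>n. e \<le> cylinder_exp (f n)"
    proof (rule ccontr)
      assume *: "\<not> ?thesis"
      have "\<exists>no. \<forall>n\<ge>no. norm (cylinder_exp (f n) - 0) < r" if r: "r > 0" for r
      proof -
        obtain no where "cylinder_exp (f no) < r" using * r by (meson not_le)
        then show ?thesis using E_dec E_nonneg by (intro exI[of _ no]) (force intro: le_less_trans)
      qed
      then show False using not LIMSEQ_iff by blast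
    qed
    then show ?thesis using that by blast
  qed
  obtain B0 where "B0 \<ge> 0" "\<And>\<omega>. \<bar>f 0 \<omega>\<bar> \<le> B0" using cylinder_funs_bounded[OF f] by (rule bounded_realsE) blast
  then obtain B where B: "B > 0" "\<And>\<omega>. f 0 \<omega> \<le> B"
    by (metis abs_le_D1 add_nonneg_pos less_add_one less_eq_real_def order_trans zero_less_one)
  have "\<exists>U. finite U \<and> U \<subseteq> {0..} \<and> supported_on U (f n)" for n using f[of n] by (auto simp: cylinder_funs_def)
  then obtain U where U: "\<And>n. finite (U n)" "\<And>n. U n \<subseteq> {0..}" "\<And>n. supported_on (U n) (f n)" by metis
  \<comment> \<open>All times on which some \<open>f n\<close> depends, with the nonnegative
    rationals added to make the set dense.\<close>
  define S where "S = (\<Union>n. U n) \<union> (\<rat> \<inter> {0..})"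
  have "countable (\<rat> \<inter> {0 :: real..})" by (rule countable_subset[OF _ countable_rat]) auto
  moreover have "countable (\<Union>n. U n)" using U(1) by (auto intro: countable_finite)
  ultimately have "countable S" by (simp add: S_def)
  moreover have "0 \<in> S" by (simp add: S_def)
  ultimately obtain s :: "nat \<Rightarrow> real" where s: "range s = S" by (metis empty_iff range_from_nat_into)
  have S: "S \<subseteq> {0..}" using U(2) by (auto simp: S_def)
  have s_nonneg: "0 \<le> s k" for k using s S by auto
  have dense: "\<exists>r\<in>S. a < r \<and> r < b" if "0 \<le> a" "a < b" for a b
    using Rats_dense_in_real[OF that(2)] that by (force simp: S_def)
  \<comment> \<open>The error budget of index \<open>k\<close>. Three bad events per index cost
    \<open>3 * p k\<close>, in total at most \<open>e / (4 * B)\<close>; multiplied by the bound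
    \<open>B\<close> on the functions this is \<open>e / 4\<close>.\<close>
  define p where "p k = e / (4 * B) / 3 * (1/2) ^ Suc k" for k :: nat
  have p: "p k > 0" for k using e B by (simp add: p_def)
  have p_sum: "(\<Sum>k\<le>m. 3 * p k) \<le> e / (4 * B)" for m
  proof -
    have "(\<Sum>k\<le>m. (1/2) ^ Suc k) = 1 - (1/2 :: real) ^ Suc m" by (induction m) simp_all
    then have "(\<Sum>k\<le>m. (1/2) ^ Suc k) \<le> (1::real)" by simp
    then have "e / (4 * B) * (\<Sum>k\<le>m. (1/2) ^ Suc k) \<le> e / (4 * B)"
      using e B by (intro mult_left_le) auto
    then show ?thesis by (simp add: p_def sum_distrib_left)
  qed
  have "\<exists>K. finite K \<and> cylinder_exp (\<lambda>\<omega>. of_bool (coord (s k) \<omega> \<notin> K)) < p k" for k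
    using cylinder_exp_tight[OF s_nonneg p] by metis
  then obtain K where K: "\<And>k. finite (K k)" "\<And>k. cylinder_exp (\<lambda>\<omega>. of_bool (coord (s k) \<omega> \<notin> K k)) < p k" by metis
  have "\<exists>M. rate * real k / (real M + 1) \<le> p k" for k
  proof -
    obtain M where "rate * real k / p k \<le> real M" using real_arch_simple by blast
    then show ?thesis using p[of k] by (intro exI[of _ M]) (simp add: field_simps)
  qed
  then obtain M where M: "\<And>k. rate * real k / (real (M k) + 1) \<le> p k" by metis
  \<comment> \<open>The expected number of jumps during a time \<open>d k\<close> is at most
    \<open>p k\<close>, so seeing any jump between \<open>s k\<close> and \<open>s k + d k\<close>
    fits into the budget.\<close>
  define d where "d k = p k / rate" for k
  have d: "d k > 0" for k using p rate by (simp add: d_def)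
  define G where "G m I = sorted_list_of_set (s ` {..m} \<inter> I)" for m and I :: "real set"
  have G: "sorted_wrt (<) (G m I)" "set (G m I) = s ` {..m} \<inter> I" for m I
    unfolding G_def using strict_sorted_list_of_set by auto
  define J where "J m I \<omega> = jumps (\<lambda>t. coord t \<omega>) (G m I)" for m I and \<omega> :: "'x cadlag_path"
  \<comment> \<open>The three events are failures of tightness, of a bound on the jumps up to time
    \<open>k\<close>, and of constancy just after \<open>s k\<close>. Jumps are counted only along
    the first times \<open>s 0, ..., s m\<close>, so that each event is a cylinder event.\<close>
  define bad where "bad m k \<omega> \<longleftrightarrow> coord (s k) \<omega> \<notin> K k \<or> J m {0..real k} \<omega> > M k \<or> J m {s k..s k + d k} \<omega> > 0"
    for m k \<omega>
  have J_sup: "supported_on (s ` {..m}) (J m I)" for m I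
    unfolding J_def[abs_def] using supported_on_jumps[of "G m I"] G(2) by (auto intro: supported_on_mono)
  have c1: "(\<lambda>\<omega> :: 'x cadlag_path. of_bool (coord (s k) \<omega> \<notin> K k) :: real) \<in> cylinder_funs" for k
    using s_nonneg by (intro cylinder_funs_of_bool[of "{s k}"]) (auto simp: supported_on_def)
  have c2: "(\<lambda>\<omega>. of_bool (J m I \<omega> > n) :: real) \<in> cylinder_funs" for m I n
    using s_nonneg J_sup[of m I] by (intro cylinder_funs_of_bool[of "s ` {..m}"]) (auto simp: supported_on_def, metis+)
  have c3: "(\<lambda>\<omega>. of_bool (bad m k \<omega>) :: real) \<in> cylinder_funs" for m k
  proof (rule cylinder_funs_of_bool[of "s ` {..max m k}"])
    show "supported_on (s ` {..max m k}) (bad m k)"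
      unfolding supported_on_def
    proof (intro allI impI)
      fix \<omega> \<omega>' :: "'x cadlag_path" assume *: "\<forall>t\<in>s ` {..max m k}. coord t \<omega> = coord t \<omega>'"
      then have "J m I \<omega> = J m I \<omega>'" for I using J_sup[of m I] unfolding supported_on_def by auto
      moreover have "coord (s k) \<omega> = coord (s k) \<omega>'" using * by auto
      ultimately show "bad m k \<omega> = bad m k \<omega>'" by (simp add: bad_def)
    qed
  qed (use s_nonneg in auto)
  have bad_le: "cylinder_exp (\<lambda>\<omega>. of_bool (bad m k \<omega>)) \<le> 3 * p k" for m k
  proof -
    let ?a = "\<lambda>\<omega> :: 'x cadlag_path. of_bool (coord (s k) \<omega> \<notin> K k) :: real"
    let ?b = "\<lambda>\<omega>. of_bool (J m {0..real k} \<omega> > M k) :: real"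
    let ?c = "\<lambda>\<omega>. of_bool (J m {s k..s k + d k} \<omega> > 0) :: real"
    have bc: "(\<lambda>\<omega>. ?b \<omega> + ?c \<omega>) \<in> cylinder_funs" by (intro function_space_add[OF function_space_cylinder_funs] c2)
    have "cylinder_exp (\<lambda>\<omega>. of_bool (bad m k \<omega>)) \<le> cylinder_exp (\<lambda>\<omega>. ?a \<omega> + (?b \<omega> + ?c \<omega>))"
      by (intro real_upper_expectation_mono[OF upper] function_space_add[OF function_space_cylinder_funs] c1 c2 c3)
         (simp add: bad_def)
    also have "\<dots> \<le> cylinder_exp ?a + cylinder_exp (\<lambda>\<omega>. ?b \<omega> + ?c \<omega>)"
      by (rule real_upper_expectation_add[OF upper c1 bc])
    also have "\<dots> \<le> cylinder_exp ?a + (cylinder_exp ?b + cylinder_exp ?c)"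
      using real_upper_expectation_add[OF upper c2 c2] by (intro add_left_mono)
    also have "cylinder_exp ?a \<le> p k" using K(2)[of k] by simp
    also have "cylinder_exp ?b \<le> p k"
      using cylinder_exp_jumps_gt[of "G m {0..real k}" 0 "real k" "M k"] G M[of k] by (simp add: J_def)
    also have "cylinder_exp ?c \<le> p k"
      using cylinder_exp_jumps_gt[of "G m {s k..s k + d k}" "s k" "s k + d k" 0] G d[of k] s_nonneg[of k] rate
      by (simp add: J_def d_def)
    finally show ?thesis by simp
  qed
  \<comment> \<open>Otherwise \<open>f n <= e / 4 + B * (number of bad events)\<close> everywhere,
    and the expectation of \<open>f n\<close> would be at most \<open>e / 2\<close>.\<close>
  have "\<exists>\<omega>. f n \<omega> > e / 4 \<and> (\<forall>k\<le>n. \<not> bad n k \<omega>)" for n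
  proof (rule ccontr)
    assume none: "\<not> ?thesis"
    let ?bad = "\<lambda>\<omega>. \<Sum>k\<le>n. of_bool (bad n k \<omega>) :: real"
    note space = function_space_cylinder_funs
    have bad_sum: "?bad \<in> cylinder_funs" by (intro function_space_sum[OF space] c3)
    have "f n \<omega> \<le> e / 4 + B * ?bad \<omega>" for \<omega>
    proof (cases "\<exists>k\<le>n. bad n k \<omega>")
      case True
      then obtain k where "k \<le> n" "bad n k \<omega>" by blast
      then have "1 \<le> ?bad \<omega>"
        using member_le_sum[of k "{..n}" "\<lambda>k. of_bool (bad n k \<omega>) :: real"] by simp
      then have "B \<le> B * ?bad \<omega>" using B by simp
      moreover have "f n \<omega> \<le> f 0 \<omega>" using decseqD[OF dec, of 0 n] by (simp add: le_fun_def)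
      ultimately show ?thesis using B(2)[of \<omega>] e by simp
    next
      case False
      then have "f n \<omega> \<le> e / 4" using none by (meson not_le)
      moreover have "0 \<le> B * ?bad \<omega>" using B by (intro mult_nonneg_nonneg sum_nonneg) auto
      ultimately show ?thesis by simp
    qed
    then have "cylinder_exp (f n) \<le> cylinder_exp (\<lambda>\<omega>. e / 4 + B * ?bad \<omega>)"
      by (intro real_upper_expectation_mono[OF upper] f function_space_add[OF space] function_space_const[OF space]
          function_space_scale[OF space] bad_sum)
    also have "\<dots> \<le> cylinder_exp (\<lambda>_. e / 4) + cylinder_exp (\<lambda>\<omega>. B * ?bad \<omega>)"
      by (intro real_upper_expectation_add[OF upper] function_space_const[OF space] function_space_scale[OF space] bad_sum)
    also have "\<dots> = e / 4 + B * cylinder_exp ?bad"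
      by (simp only: real_upper_expectation_const[OF upper]
          real_upper_expectation_scale[OF upper bad_sum less_imp_le[OF B(1)]])
    also have "cylinder_exp ?bad \<le> (\<Sum>k\<le>n. cylinder_exp (\<lambda>\<omega>. of_bool (bad n k \<omega>)))"
      by (intro real_upper_expectation_sum[OF upper] c3)
    also have "\<dots> \<le> (\<Sum>k\<le>n. 3 * p k)" by (intro sum_mono bad_le)
    also have "\<dots> \<le> e / (4 * B)" by (rule p_sum)
    finally have "cylinder_exp (f n) \<le> e / 2" using B by simp
    then show False using e(1) e(2)[of n] by simp
  qed
  then obtain \<omega> where \<omega>: "\<And>n. f n (\<omega> n) > e / 4" "\<And>n k. k \<le> n \<Longrightarrow> \<not> bad n k (\<omega> n)" by metis
  have good: "coord (s k) (\<omega> n) \<in> K k" "J n {0..real k} (\<omega> n) \<le> M k" "J n {s k..s k + d k} (\<omega> n) = 0" if "k \<le> n" for k n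
    using \<omega>(2)[OF that] by (auto simp: bad_def)
  obtain y where y: "\<And>j. infinite {m. \<forall>i<j. coord (s i) (\<omega> m) = y i}"
    using infinitely_often_agreeing[of K "\<lambda>m i. coord (s i) (\<omega> m)"] K(1) good(1) by blast
  \<comment> \<open>The enumeration \<open>s\<close> may repeat times, so one index is fixed for
    each time; the next claim shows that the selected paths indeed pass through these
    states.\<close>
  define w where "w t = y (SOME i. s i = t)" for t
  \<comment> \<open>Every finite part of the limit is traced by some selected path of arbitrarily
    high index, whose observed times already include that part. This transfers the bounds to the
    limit.\<close>
  have agree: "\<exists>m\<ge>n. F \<subseteq> s ` {..m} \<and> (\<forall>t\<in>F. coord t (\<omega> m) = w t)" if F: "finite F" "F \<subseteq> S" for F n
  proof -
    define ix where "ix t = (SOME i. s i = t)" for t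
    have ix: "s (ix t) = t" if "t \<in> F" for t
      unfolding ix_def by (rule someI_ex) (use that F s in blast)
    obtain j where j: "\<And>t. t \<in> F \<Longrightarrow> ix t < j"
      using finite_nat_set_iff_bounded[of "ix ` F"] F(1) by auto
    obtain m where m: "m \<ge> max n j" "\<forall>i<j. coord (s i) (\<omega> m) = y i"
      using y[of j] unfolding infinite_nat_iff_unbounded_le by blast
    have "coord t (\<omega> m) = w t" if "t \<in> F" for t
      using m(2) j[OF that] ix[OF that] unfolding w_def ix_def by metis
    moreover have "t \<in> s ` {..m}" if "t \<in> F" for t
      using ix[OF that] j[OF that] m(1) by (intro image_eqI[of _ _ "ix t"]) auto
    ultimately show ?thesis using m(1) by auto
  qed
  have w_jumps: "\<exists>m\<ge>n. jumps w (sorted_list_of_set F) \<le> J m I (\<omega> m)" if F: "finite F" "F \<subseteq> S \<inter> I" for F I n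
  proof -
    obtain m where m: "m \<ge> n" "F \<subseteq> s ` {..m}" "\<And>t. t \<in> F \<Longrightarrow> coord t (\<omega> m) = w t"
      using agree[of F n] F by auto
    have "jumps w (sorted_list_of_set F) = jumps (\<lambda>t. coord t (\<omega> m)) (sorted_list_of_set F)"
      using m(3) F(1) by (intro jumps_cong) simp
    also have "\<dots> \<le> J m I (\<omega> m)"
      unfolding J_def G_def using m(2) F by (intro jumps_mono) auto
    finally show ?thesis using m(1) by blast
  qed
  obtain \<omega>' where \<omega>': "\<And>t. t \<in> S \<Longrightarrow> coord t \<omega>' = w t"
  proof (rule path_through_dense[of S w M])
    show "jumps w (sorted_list_of_set F) \<le> M n" if F: "finite F" "F \<subseteq> S \<inter> {0..real n}" for n F
    proof -
      obtain m where "m \<ge> n" "jumps w (sorted_list_of_set F) \<le> J m {0..real n} (\<omega> m)"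
        using w_jumps[OF F] by blast
      with good(2)[of n m] show ?thesis by simp
    qed
    fix t assume "t \<in> S"
    then obtain k where k: "t = s k" using s by auto
    have "w r = w t" if r: "r \<in> S" "t < r" "r < t + d k" for r
    proof -
      have "{t, r} \<subseteq> S \<inter> {s k..s k + d k}" using r k \<open>t \<in> S\<close> d[of k] by auto
      then obtain m where "m \<ge> k" "jumps w (sorted_list_of_set {t, r}) \<le> J m {s k..s k + d k} (\<omega> m)"
        using w_jumps[of "{t, r}"] by blast
      then have "jumps w (sorted_list_of_set {t, r}) = 0" using good(3)[of k m] by simp
      moreover have "sorted_list_of_set {t, r} = [t, r]" using r by simp
      ultimately show ?thesis by (simp split: if_splits)
    qed
    then show "\<exists>d>0. \<forall>r\<in>S. t < r \<and> r < t + d \<longrightarrow> w r = w t" using d by blast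
  qed (use S dense in auto)
  \<comment> \<open>The index \<open>n\<close> is fixed while the tracing path has an index
    \<open>m >= n\<close>; as the sequence decreases, \<open>f n\<close> is at least
    \<open>f m\<close> on that path.\<close>
  have "f n \<omega>' > e / 4" for n
  proof -
    have "U n \<subseteq> S" by (auto simp: S_def)
    then obtain m where m: "m \<ge> n" "\<And>t. t \<in> U n \<Longrightarrow> coord t (\<omega> m) = w t"
      using agree[of "U n" n] U(1) by auto
    then have "f n \<omega>' = f n (\<omega> m)"
      using U(3)[of n] \<omega>' \<open>U n \<subseteq> S\<close> unfolding supported_on_def by (metis subsetD)
    also have "f n (\<omega> m) \<ge> f m (\<omega> m)" using decseqD[OF dec m(1)] by (simp add: le_fun_def)
    finally show ?thesis using \<omega>(1)[of m] by simp
  qed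
  moreover have "\<forall>\<^sub>F n in sequentially. f n \<omega>' < e / 4"
    using lim[of \<omega>'] e(1) by (intro order_tendstoD) auto
  ultimately show False by (metis (no_types, lifting) eventually_happens less_asym trivial_limit_sequentially)
qed

end

section \<open>The supremum of the integrals\<close>

text \<open>If both integrals are infinite, the value is \<open>\<infinity>\<close>, because \<open>\<infinity> - \<infinity> = \<infinity>\<close> in \<open>ereal\<close>. So a value
  below \<open>\<infinity>\<close> means that the positive part is integrable.\<close>

definition extended_integral :: "'a measure \<Rightarrow> ('a \<Rightarrow> ereal) \<Rightarrow> ereal" where
  "extended_integral M f =
     enn2ereal (\<integral>\<^sup>+x. e2ennreal (f x) \<partial>M) - enn2ereal (\<integral>\<^sup>+x. e2ennreal (- f x) \<partial>M)"

lemma extended_integral_mono: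
  assumes "f \<le> g"
  shows "extended_integral M f \<le> extended_integral M g"
  unfolding extended_integral_def
  using assms by (intro ereal_minus_mono) (auto simp: less_eq_ennreal.rep_eq[symmetric] le_fun_def intro!: nn_integral_mono e2ennreal_mono)

lemma e2ennreal_cmult:
  assumes "a > 0"
  shows "e2ennreal (ereal a * x) = ennreal a * e2ennreal x"
  using assms by (cases x) (auto simp: ennreal_mult' e2ennreal_neg ennreal_mult_top)

lemma extended_integral_scale:
  assumes f: "f \<in> borel_measurable M" and a: "a > 0"
  shows "extended_integral M (\<lambda>x. ereal a * f x) = ereal a * extended_integral M f"
proof -
  have diff: "ereal a * u - ereal a * v = ereal a * (u - v)" for u v
    using a by (cases u; cases v) (auto simp: right_diff_distrib)
  have [simp]: "enn2ereal (ennreal a * X) = ereal a * enn2ereal X" for X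
    using a by (simp add: times_ennreal.rep_eq)
  have neg: "- (ereal a * f x) = ereal a * (- f x)" for x by simp
  show ?thesis
    unfolding extended_integral_def neg e2ennreal_cmult[OF a] using f
    by (simp add: nn_integral_cmult diff)
qed

lemma ennreal_eq_max_0: "ennreal x = ennreal (max 0 x)"
  by (cases "x \<ge> 0") (auto simp: max_def ennreal_neg)

text \<open>The identity between positive and negative parts of a sum, arranged without subtraction
  so that it can be integrated in \<open>ennreal\<close> even when some parts are infinite.\<close>

lemma e2ennreal_add:
  assumes "meaningful_sum x y"
  shows "e2ennreal (x + y) + (e2ennreal (- x) + e2ennreal (- y)) =
    e2ennreal (- (x + y)) + (e2ennreal x + e2ennreal y)"
proof -
  have "ennreal (r + s) + (ennreal (- r) + ennreal (- s)) = ennreal (- (r + s)) + (ennreal r + ennreal s)" for r s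
  proof -
    have "max 0 (r + s) + (max 0 (- r) + max 0 (- s)) = max 0 (- (r + s)) + (max 0 r + max 0 s)" by auto
    then show ?thesis
      by (subst (1 2 3 4 5 6) ennreal_eq_max_0) (simp add: ennreal_plus[symmetric] del: ennreal_plus)
  qed
  then show ?thesis
    using assms by (cases x; cases y) (auto simp: meaningful_sum_def e2ennreal_neg)
qed

lemma e2ennreal_add_le:
  "e2ennreal (x + y) \<le> e2ennreal x + e2ennreal y"
proof -
  have "ennreal (r + s) \<le> ennreal r + ennreal s" for r s
  proof -
    have "ennreal (max 0 (r + s)) \<le> ennreal (max 0 r + max 0 s)" by (rule ennreal_leI) auto
    then show ?thesis by (subst (1 2 3) ennreal_eq_max_0) simp
  qed
  then show ?thesis by (cases x; cases y) (auto simp: e2ennreal_neg)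
qed

text \<open>Values below infinity make both positive parts integrable, so they can be cancelled in
  the integrated identity. If a negative part has infinite integral, the identity forces the same
  for the sum, and the left side is minus infinity.\<close>

lemma extended_integral_add:
  assumes f: "f \<in> borel_measurable M" and g: "g \<in> borel_measurable M"
    and meaningful: "\<And>x. meaningful_sum (f x) (g x)"
    and fin: "extended_integral M f < \<infinity>" "extended_integral M g < \<infinity>"
  shows "extended_integral M (\<lambda>x. f x + g x) \<le> extended_integral M f + extended_integral M g"
proof -
  define I where "I h = (\<integral>\<^sup>+x. e2ennreal (h x) \<partial>M)" for h
  have [measurable]: "f \<in> borel_measurable M" "g \<in> borel_measurable M" by fact+
  let ?s = "\<lambda>x. f x + g x"
  have eq: "I ?s + (I (\<lambda>x. - f x) + I (\<lambda>x. - g x)) = I (\<lambda>x. - ?s x) + (I f + I g)"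
  proof -
    have "I ?s + (I (\<lambda>x. - f x) + I (\<lambda>x. - g x)) =
        (\<integral>\<^sup>+x. e2ennreal (?s x) + (e2ennreal (- f x) + e2ennreal (- g x)) \<partial>M)"
      by (simp add: I_def nn_integral_add)
    also have "\<dots> = (\<integral>\<^sup>+x. e2ennreal (- ?s x) + (e2ennreal (f x) + e2ennreal (g x)) \<partial>M)"
      by (simp add: e2ennreal_add[OF meaningful])
    also have "\<dots> = I (\<lambda>x. - ?s x) + (I f + I g)" by (simp add: I_def nn_integral_add)
    finally show ?thesis .
  qed
  have le: "I ?s \<le> I f + I g"
    unfolding I_def by (subst nn_integral_add[symmetric]) (auto intro!: nn_integral_mono e2ennreal_add_le)
  have "I f \<noteq> top" "I g \<noteq> top"
    using fin unfolding extended_integral_def I_def[symmetric] by auto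
  then obtain a b where ab: "I f = ennreal a" "a \<ge> 0" "I g = ennreal b" "b \<ge> 0" by (metis ennreal_cases)
  then have "I ?s \<noteq> top" using le by (metis ennreal_add_eq_top ennreal_neq_top top.extremum_uniqueI)
  then obtain c where c: "I ?s = ennreal c" "c \<ge> 0" by (metis ennreal_cases)
  have "enn2ereal (I ?s) - enn2ereal (I (\<lambda>x. - ?s x)) \<le>
    (enn2ereal (I f) - enn2ereal (I (\<lambda>x. - f x))) + (enn2ereal (I g) - enn2ereal (I (\<lambda>x. - g x)))"
  proof (cases "I (\<lambda>x. - f x) = top \<or> I (\<lambda>x. - g x) = top")
    case True
    then have "I ?s + (I (\<lambda>x. - f x) + I (\<lambda>x. - g x)) = top" by auto
    then have "I (\<lambda>x. - ?s x) + (I f + I g) = top" using eq by simp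
    then have "I (\<lambda>x. - ?s x) = top" using ab by (simp add: ennreal_add_eq_top)
    then show ?thesis using c by simp
  next
    case False
    then obtain a' b' where ab': "I (\<lambda>x. - f x) = ennreal a'" "a' \<ge> 0" "I (\<lambda>x. - g x) = ennreal b'" "b' \<ge> 0"
      by (metis ennreal_cases)
    then have "I (\<lambda>x. - ?s x) \<noteq> top" using eq c
      by (metis ennreal_add_eq_top ennreal_neq_top)
    then obtain c' where c': "I (\<lambda>x. - ?s x) = ennreal c'" "c' \<ge> 0" by (metis ennreal_cases)
    have "ennreal (c + (a' + b')) = ennreal (c' + (a + b))"
      using eq unfolding ab ab' c c' using ab ab' c c' by simp
    then have "c + (a' + b') = c' + (a + b)"
      using ab ab' c c' by (subst (asm) ennreal_inj) auto
    then show ?thesis using ab ab' c c' by simp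
  qed
  then show ?thesis by (simp add: extended_integral_def I_def)
qed

text \<open>For a function bounded below and total mass 1, a shift reduces the extended integral to
  one nonnegative integral. Monotone convergence and the comparison with the Bochner integral then
  apply directly.\<close>

lemma extended_integral_translate:
  assumes f: "f \<in> borel_measurable M" and M: "emeasure M (space M) = 1"
    and c: "0 \<le> c" "\<And>x. 0 \<le> f x + ereal c"
  shows "extended_integral M f = enn2ereal (\<integral>\<^sup>+x. e2ennreal (f x + ereal c) \<partial>M) - ereal c"
proof -
  define I where "I h = (\<integral>\<^sup>+x. e2ennreal (h x) \<partial>M)" for h
  have [measurable]: "f \<in> borel_measurable M" by fact
  have pt: "e2ennreal (f x + ereal c) + e2ennreal (- f x) = e2ennreal (f x) + ennreal c" for x
    using e2ennreal_add[of "f x" "ereal c"] c(1) c(2)[of x]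
    by (cases "f x") (auto simp: meaningful_sum_def e2ennreal_neg ennreal_neg)
  have "I (\<lambda>x. f x + ereal c) + I (\<lambda>x. - f x) = I f + (\<integral>\<^sup>+x. ennreal c \<partial>M)"
    unfolding I_def by (subst (1 2) nn_integral_add[symmetric]) (auto simp: pt)
  then have eq: "I (\<lambda>x. f x + ereal c) + I (\<lambda>x. - f x) = I f + ennreal c" using M by simp
  have "e2ennreal (- f x) \<le> ennreal c" for x
    using c(2)[of x] by (cases "f x") (auto intro!: ennreal_leI simp: e2ennreal_neg)
  then have "I (\<lambda>x. - f x) \<le> (\<integral>\<^sup>+x. ennreal c \<partial>M)" unfolding I_def by (intro nn_integral_mono)
  then have "I (\<lambda>x. - f x) \<noteq> top" using M by (auto simp: top_unique)
  then obtain b where b: "I (\<lambda>x. - f x) = ennreal b" "b \<ge> 0" by (metis ennreal_cases)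
  have "enn2ereal (I f) - enn2ereal (I (\<lambda>x. - f x)) = enn2ereal (I (\<lambda>x. f x + ereal c)) - ereal c"
  proof (cases "I f = top")
    case True
    then have "I (\<lambda>x. f x + ereal c) = top" using eq b by (auto simp: ennreal_add_eq_top)
    then show ?thesis using True b by simp
  next
    case False
    then obtain a where a: "I f = ennreal a" "a \<ge> 0" by (metis ennreal_cases)
    then have "I (\<lambda>x. f x + ereal c) \<noteq> top" using eq by (metis ennreal_add_eq_top ennreal_neq_top)
    then obtain d where d: "I (\<lambda>x. f x + ereal c) = ennreal d" "d \<ge> 0" by (metis ennreal_cases)
    have "ennreal (d + b) = ennreal (a + c)" using eq a b c d by simp
    then have "d + b = a + c" using a b c d by (subst (asm) ennreal_inj) auto
    then show ?thesis using a b d by simp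
  qed
  then show ?thesis by (simp add: extended_integral_def I_def)
qed

lemma extended_integral_real:
  assumes f: "f \<in> borel_measurable M" and M: "emeasure M (space M) = 1" and bd: "\<And>x. \<bar>f x\<bar> \<le> c"
  shows "integrable M f" "extended_integral M (\<lambda>x. ereal (f x)) = ereal (integral\<^sup>L M f)"
proof -
  interpret finite_measure M by (rule finite_measureI) (simp add: M)
  show int: "integrable M f" by (rule integrable_const_bound[of _ c]) (use f bd in auto)
  have c: "0 \<le> c" using bd[of undefined] by linarith
  have pos: "0 \<le> f x + c" for x using bd[of x] by linarith
  have "(\<integral>\<^sup>+x. ennreal (f x + c) \<partial>M) = ennreal (\<integral>x. f x + c \<partial>M)"
    by (rule nn_integral_eq_integral) (use int pos in auto)
  also have "(\<integral>x. f x + c \<partial>M) = integral\<^sup>L M f + c"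
    using int M by (simp add: measure_def)
  finally have eq: "(\<integral>\<^sup>+x. ennreal (f x + c) \<partial>M) = ennreal (integral\<^sup>L M f + c)" .
  have "0 \<le> (\<integral>x. f x + c \<partial>M)" using pos by (intro Bochner_Integration.integral_nonneg) auto
  then have "0 \<le> integral\<^sup>L M f + c" using int M by (simp add: measure_def)
  with eq show "extended_integral M (\<lambda>x. ereal (f x)) = ereal (integral\<^sup>L M f)"
    using extended_integral_translate[of "\<lambda>x. ereal (f x)" M c] f M c pos by simp
qed

lemma extended_integral_monotone_convergence:
  assumes f: "\<And>n. f n \<in> borel_measurable M" and M: "emeasure M (space M) = 1"
    and inc: "increases_to f g" and g: "g \<in> borel_measurable M" and c: "\<And>x. ereal (- c) \<le> f 0 x" "0 \<le> c"
  shows "(\<lambda>n. extended_integral M (f n)) \<longlonglongrightarrow> extended_integral M g"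
proof -
  have incseq: "incseq f" and lim: "\<And>x. (\<lambda>n. f n x) \<longlonglongrightarrow> g x" using inc by (auto simp: increases_to_def)
  have mono: "f n x \<le> f m x" if "n \<le> m" for n m x using incseqD[OF incseq that] by (simp add: le_fun_def)
  have pos: "0 \<le> f n x + ereal c" for n x
    using order_trans[OF c(1) mono[of 0 n x]] by (cases "f n x") auto
  have posg: "0 \<le> g x + ereal c" for x
  proof -
    have "ereal (- c) \<le> g x" by (rule LIMSEQ_le_const[OF lim]) (use order_trans[OF c(1) mono[of 0 _ x]] in auto)
    then show ?thesis by (cases "g x") auto
  qed
  have "(\<lambda>n. \<integral>\<^sup>+x. e2ennreal (f n x + ereal c) \<partial>M) \<longlonglongrightarrow> (\<integral>\<^sup>+x. e2ennreal (g x + ereal c) \<partial>M)"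
  proof (rule nn_integral_LIMSEQ)
    show "incseq (\<lambda>n x. e2ennreal (f n x + ereal c))"
      by (intro incseq_SucI le_funI e2ennreal_mono add_right_mono mono) simp
    show "(\<lambda>x. e2ennreal (f n x + ereal c)) \<in> borel_measurable M" for n using f by measurable
    show "(\<lambda>n. e2ennreal (f n x + ereal c)) \<longlonglongrightarrow> e2ennreal (g x + ereal c)" for x
      by (intro tendsto_e2ennrealI tendsto_add_ereal_general1 lim tendsto_const) auto
  qed
  then have "(\<lambda>n. enn2ereal (\<integral>\<^sup>+x. e2ennreal (f n x + ereal c) \<partial>M) + (- ereal c)) \<longlonglongrightarrow>
    enn2ereal (\<integral>\<^sup>+x. e2ennreal (g x + ereal c) \<partial>M) + (- ereal c)"
    by (intro tendsto_add_ereal_general1 tendsto_const) auto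
  then show ?thesis
    unfolding extended_integral_translate[OF f M c(2) pos] extended_integral_translate[OF g M c(2) posg]
      minus_ereal_def .
qed

section \<open>Cylinder sets and the sigma-algebra they generate\<close>

definition cylinder_sets :: "'x cadlag_path set set" where
  "cylinder_sets = {A. (\<lambda>\<omega>. of_bool (\<omega> \<in> A) :: real) \<in> cylinder_funs}"

lemma cylinder_sets_fun: "A \<in> cylinder_sets \<Longrightarrow> (\<lambda>\<omega>. of_bool (\<omega> \<in> A) :: real) \<in> cylinder_funs"
  by (simp add: cylinder_sets_def)

lemma cylinder_sets_combine:
  assumes f: "f \<in> cylinder_funs" and g: "g \<in> cylinder_funs"
  shows "{\<omega>. Q (f \<omega>) (g \<omega>)} \<in> cylinder_sets"
  using cylinder_funs_combine[OF f g, of "\<lambda>x y. of_bool (Q x y)", OF bounded_reals_of_bool]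
  by (simp add: cylinder_sets_def)

lemma cylinder_sets_vimage: "f \<in> cylinder_funs \<Longrightarrow> f -` B \<in> cylinder_sets"
  using cylinder_sets_combine[of f f "\<lambda>x y. x \<in> B"] by (simp add: vimage_def)

lemma ring_of_sets_cylinder_sets: "ring_of_sets UNIV cylinder_sets"
  unfolding ring_of_sets_iff
proof (intro conjI ballI)
  show "{} \<in> cylinder_sets" by (simp add: cylinder_sets_def cylinder_funs_const[of 0, simplified])
  fix A B :: "'a cadlag_path set" assume "A \<in> cylinder_sets" "B \<in> cylinder_sets"
  note AB = this[THEN cylinder_sets_fun]
  have "{\<omega>. of_bool (\<omega> \<in> A) = (1::real) \<or> of_bool (\<omega> \<in> B) = (1::real)} \<in> cylinder_sets"
    by (rule cylinder_sets_combine[OF AB])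
  then show "A \<union> B \<in> cylinder_sets" by (simp add: Un_def)
  have "{\<omega>. of_bool (\<omega> \<in> A) = (1::real) \<and> of_bool (\<omega> \<in> B) = (0::real)} \<in> cylinder_sets"
    by (rule cylinder_sets_combine[OF AB])
  then show "A - B \<in> cylinder_sets" by (simp add: set_diff_eq)
qed auto

lemma fin_dim_funs_cylinder:
  fixes f :: "'x cadlag_path \<Rightarrow> real"
  assumes "f \<in> cylinder_funs"
  shows "(\<lambda>\<omega>. ereal (f \<omega>)) \<in> fin_dim_funs"
proof -
  obtain U where U: "f \<in> bounded_reals" "finite U" "U \<subseteq> {0..}" "supported_on U f"
    using assms by (rule cylinder_funsE)
  \<comment> \<open>The definition of \<open>fin_dim_funs\<close> demands a non-empty set of
    times.\<close>
  let ?U = "insert 0 U"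
  have sup: "supported_on ?U f" using U(4) by (rule supported_on_mono) auto
  obtain c where c: "\<And>v. \<bar>lift_to_functions ?U f v\<bar> \<le> c"
    using lift_to_functions_bounded[OF U(1)] by (metis bounded_realsE)
  have "lift_to_functions ?U f (path_proj ?U \<omega>) = f \<omega>" for \<omega>
    by (rule lift_to_functions_eq[OF sup]) (simp add: path_proj_def coord_def)
  then have "(\<lambda>\<omega>. ereal (f \<omega>)) = (\<lambda>v. ereal (lift_to_functions ?U f v)) \<circ> path_proj ?U" by auto
  moreover have "(\<lambda>v. ereal (lift_to_functions ?U f v)) \<in> bounded_funs (?U \<rightarrow>\<^sub>E UNIV)"
    using c by (auto simp: bounded_funs_def)
  ultimately show ?thesis unfolding fin_dim_funs_def using U
    by (intro CollectI exI[of _ "\<lambda>v. ereal (lift_to_functions ?U f v)"] exI[of _ ?U]) auto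
qed

lemma fin_dim_funsE:
  fixes g :: "'x cadlag_path \<Rightarrow> ereal"
  assumes "g \<in> fin_dim_funs"
  obtains f where "f \<in> cylinder_funs" "g = (\<lambda>\<omega>. ereal (f \<omega>))"
proof -
  obtain h U where g: "g = h \<circ> path_proj U" and U: "finite U" "U \<subseteq> {0..}"
    and h: "h \<in> bounded_funs (U \<rightarrow>\<^sub>E UNIV)"
    using assms by (auto simp: fin_dim_funs_def)
  have "path_proj U \<omega> \<in> U \<rightarrow>\<^sub>E UNIV" for \<omega> :: "'x cadlag_path" by (simp add: path_proj_def)
  then have "g \<in> bounded_funs UNIV" using h by (force simp: bounded_funs_def g)
  then obtain f where f: "f \<in> bounded_reals" "g = (\<lambda>\<omega>. ereal (f \<omega>))" by (rule bounded_funs_UNIV_E)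
  have "g \<omega> = g \<omega>'" if "\<forall>t\<in>U. coord t \<omega> = coord t \<omega>'" for \<omega> \<omega>'
  proof -
    have "path_proj U \<omega> = path_proj U \<omega>'" using that by (auto simp: path_proj_def coord_def)
    then show ?thesis by (simp add: g)
  qed
  then have "supported_on U f" by (simp add: supported_on_def f(2))
  then have "f \<in> cylinder_funs" using f(1) U by (intro cylinder_funsI)
  then show ?thesis using f(2) by (rule that)
qed

lemma space_path_algebra [simp]: "space path_algebra = UNIV"
  by (simp add: path_algebra_def space_measure_of_conv)

text \<open>The generators of \<open>path_algebra\<close> are exactly the cylinder sets: preimages
  under cylinder functions are cylinder sets, and a cylinder set is the preimage of 1 under its
  indicator. They form a ring, as Caratheodory's theorem requires.\<close>

lemma sets_path_algebra: "sets (path_algebra :: 'x cadlag_path measure) = sigma_sets UNIV cylinder_sets"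
proof -
  have "{f -` B | f B. f \<in> fin_dim_funs \<and> B \<in> sets borel} = (cylinder_sets :: 'x cadlag_path set set)"
  proof (intro equalityI subsetI)
    fix A :: "'x cadlag_path set" assume "A \<in> {f -` B | f B. f \<in> fin_dim_funs \<and> B \<in> sets borel}"
    then obtain g B where A: "A = g -` B" "g \<in> fin_dim_funs" by blast
    obtain f where "f \<in> cylinder_funs" "g = (\<lambda>\<omega>. ereal (f \<omega>))" using A(2) by (rule fin_dim_funsE)
    then have "A = f -` {r. ereal r \<in> B}" using A by auto
    then show "A \<in> cylinder_sets" using cylinder_sets_vimage \<open>f \<in> cylinder_funs\<close> by blast
  next
    fix A :: "'x cadlag_path set" assume A: "A \<in> cylinder_sets"
    have "A = (\<lambda>\<omega>. ereal (of_bool (\<omega> \<in> A))) -` {1}" by (auto simp: one_ereal_def)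
    moreover have "(\<lambda>\<omega>. ereal (of_bool (\<omega> \<in> A))) \<in> fin_dim_funs"
      by (rule fin_dim_funs_cylinder[OF cylinder_sets_fun[OF A]])
    ultimately show "A \<in> {f -` B | f B. f \<in> fin_dim_funs \<and> B \<in> sets borel}"
      by (intro CollectI exI[of _ "\<lambda>\<omega>. ereal (of_bool (\<omega> \<in> A))"] exI[of _ "{1}"] conjI) auto
  qed
  then show ?thesis by (simp add: path_algebra_def sets_measure_of_conv)
qed

lemma cylinder_funs_measurable:
  assumes "sets M = sets path_algebra" "f \<in> cylinder_funs"
  shows "f \<in> borel_measurable M"
proof (rule measurableI)
  have sp: "space M = UNIV" using sets_eq_imp_space_eq[OF assms(1)] by simp
  show "f -` B \<inter> space M \<in> sets M" for B
    using cylinder_sets_vimage[OF assms(2), of B] by (simp add: sp assms(1) sets_path_algebra sigma_sets.Basic)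
qed auto

lemma M_bdd_below_lower_bound:
  assumes "f \<in> M_bdd_below"
  obtains r where "\<And>\<omega>. ereal r \<le> f \<omega>"
proof -
  have "(INF \<omega>. f \<omega>) > -\<infinity>" using assms by (auto simp: M_bdd_below_def)
  then obtain r where r: "ereal r < (INF \<omega>. f \<omega>)" using ereal_dense2 by blast
  then have "ereal r \<le> f \<omega>" for \<omega> by (meson INF_lower UNIV_I less_imp_le less_le_trans)
  then show ?thesis by (rule that)
qed

lemma M_bdd_belowI:
  assumes "f \<in> borel_measurable path_algebra" "\<And>\<omega>. ereal r \<le> f \<omega>"
  shows "f \<in> M_bdd_below"
proof -
  have "ereal r \<le> (INF \<omega>. f \<omega>)" by (rule INF_greatest) (rule assms(2))
  then have "(INF \<omega>. f \<omega>) > -\<infinity>" by (rule less_le_trans[rotated]) simp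
  then show ?thesis using assms(1) by (simp add: M_bdd_below_def)
qed

lemma cylinder_funs_M_bdd_below:
  assumes "f \<in> cylinder_funs"
  shows "(\<lambda>\<omega>. ereal (f \<omega>)) \<in> M_bdd_below"
proof -
  obtain c where c: "\<And>\<omega>. \<bar>f \<omega>\<bar> \<le> c" using cylinder_funs_bounded[OF assms] by (metis bounded_realsE)
  have "ereal (- c) \<le> ereal (f \<omega>)" for \<omega> using c[of \<omega>] by auto
  moreover have "(\<lambda>\<omega>. ereal (f \<omega>)) \<in> borel_measurable path_algebra"
    using cylinder_funs_measurable[OF refl assms] by measurable
  ultimately show ?thesis by (rule M_bdd_belowI[rotated])
qed

text \<open>Divided by \<open>n\<close>, the sum is \<open>x\<close> rounded down to a multiple of
  \<open>1 / n\<close>. This represents an approximation of a function by indicators of its level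
  sets.\<close>

lemma sum_of_bool_floor:
  assumes "0 \<le> x" "x \<le> 1" "n > 0"
  shows "(\<Sum>k\<in>{1..n}. of_bool (real k / real n \<le> x)) = of_int \<lfloor>real n * x\<rfloor>"
proof -
  have "real n * x \<le> real n" using assms by (simp add: mult_left_le)
  then have fl: "\<lfloor>real n * x\<rfloor> \<le> int n" by linarith
  have fl0: "0 \<le> \<lfloor>real n * x\<rfloor>" using assms by simp
  have "real k / real n \<le> x \<longleftrightarrow> k \<le> nat \<lfloor>real n * x\<rfloor>" for k
  proof -
    have "real k / real n \<le> x \<longleftrightarrow> real k \<le> real n * x" using assms(3) by (simp add: field_simps)
    also have "\<dots> \<longleftrightarrow> int k \<le> \<lfloor>real n * x\<rfloor>" by (simp add: le_floor_iff)
    also have "\<dots> \<longleftrightarrow> k \<le> nat \<lfloor>real n * x\<rfloor>" using fl0 by linarith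
    finally show ?thesis .
  qed
  then have "{1..n} \<inter> {k. real k / real n \<le> x} = {1..n} \<inter> {..nat \<lfloor>real n * x\<rfloor>}" by blast
  also have "\<dots> = {1..nat \<lfloor>real n * x\<rfloor>}" using fl by auto
  finally have "(\<Sum>k\<in>{1..n}. of_bool (real k / real n \<le> x)) = real (nat \<lfloor>real n * x\<rfloor>)" by simp
  then show ?thesis using fl0 by simp
qed

text \<open>Level-set sums approximate a function with values in [0,1] uniformly, and a positive
  normalised functional is controlled by uniform distance. So agreement on indicators suffices; it
  identifies a functional with the integral of the measure built from its values on cylinder
  sets.\<close>

lemma linear_functionals_agree:
  fixes P Q :: "('x cadlag_path \<Rightarrow> real) \<Rightarrow> real"
  assumes P: "linear_functional cylinder_funs P" "\<And>f. f \<in> cylinder_funs \<Longrightarrow> (\<And>\<omega>. 0 \<le> f \<omega>) \<Longrightarrow> 0 \<le> P f"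
    and Q: "linear_functional cylinder_funs Q" "\<And>f. f \<in> cylinder_funs \<Longrightarrow> (\<And>\<omega>. 0 \<le> f \<omega>) \<Longrightarrow> 0 \<le> Q f"
    and eq: "\<And>A. A \<in> cylinder_sets \<Longrightarrow> P (\<lambda>\<omega>. of_bool (\<omega> \<in> A)) = Q (\<lambda>\<omega>. of_bool (\<omega> \<in> A))"
    and one: "P (\<lambda>_. 1) = 1" and f: "f \<in> cylinder_funs"
  shows "P f = Q f"
proof -
  note S = function_space_cylinder_funs
  have UNIV: "UNIV \<in> cylinder_sets" by (simp add: cylinder_sets_def cylinder_funs_const)
  have one': "Q (\<lambda>_. 1) = 1" using eq[OF UNIV] one by simp
  have approx: "R f \<le> R g + 1 / real n \<and> R g \<le> R f"
    if R: "linear_functional cylinder_funs R" "\<And>f. f \<in> cylinder_funs \<Longrightarrow> (\<And>\<omega>. 0 \<le> f \<omega>) \<Longrightarrow> 0 \<le> R f" "R (\<lambda>_. 1) = 1"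
      and f: "f \<in> cylinder_funs" and g: "g \<in> cylinder_funs"
      and fg: "\<And>\<omega>. g \<omega> \<le> f \<omega>" "\<And>\<omega>. f \<omega> \<le> g \<omega> + 1 / real n" for R f g n
  proof -
    have add: "R (\<lambda>x. u x + v x) = R u + R v" if "u \<in> cylinder_funs" "v \<in> cylinder_funs" for u v
      using R(1) that by (intro linear_functional_add linear_functional_scale)
    have scale: "R (\<lambda>x. a * u x) = a * R u" if "u \<in> cylinder_funs" for u a
      using R(1) that by (intro linear_functional_add linear_functional_scale)
    have diff: "R (\<lambda>x. u x - v x) = R u - R v" if "u \<in> cylinder_funs" "v \<in> cylinder_funs" for u v
      using add[OF that(1) function_space_scale[OF S that(2), of "-1"]] scale[OF that(2), of "-1"] by simp
    have "0 \<le> R (\<lambda>x. f x - g x)" using fg by (intro R function_space_diff[OF S] f g) simp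
    moreover have c: "R (\<lambda>_. 1 / real n) = 1 / real n"
      using scale[OF cylinder_funs_const[of 1], of "1 / real n"] R(3) by simp
    have "0 \<le> R (\<lambda>x. (g x + 1 / real n) - f x)"
      using fg by (intro R function_space_diff[OF S] function_space_add[OF S] cylinder_funs_const f g) simp
    then have "0 \<le> R g + 1 / real n - R f"
      using diff[OF function_space_add[OF S g cylinder_funs_const] f] add[OF g cylinder_funs_const] c by simp
    ultimately show ?thesis using diff[OF f g] by simp
  qed
  have unit: "P g = Q g" if g: "g \<in> cylinder_funs" and g01: "\<And>\<omega>. 0 \<le> g \<omega>" "\<And>\<omega>. g \<omega> \<le> 1" for g
  proof -
    have "\<bar>P g - Q g\<bar> \<le> 1 / real (Suc n)" for n
    proof -
      let ?n = "real (Suc n)"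
      let ?A = "\<lambda>k. {\<omega>. real k / ?n \<le> g \<omega>}"
      \<comment> \<open>\<open>g\<close> rounded down to multiples of \<open>1 / (n + 1)\<close>,
        hence within that distance of \<open>g\<close>.\<close>
      define h where "h \<omega> = (\<Sum>k\<in>{1..Suc n}. (1 / ?n) * of_bool (\<omega> \<in> ?A k))" for \<omega>
      have A: "?A k \<in> cylinder_sets" for k by (rule cylinder_sets_combine[OF g g])
      have hk: "(\<lambda>\<omega>. (1 / ?n) * of_bool (\<omega> \<in> ?A k)) \<in> cylinder_funs" for k
        by (intro function_space_scale[OF S] cylinder_sets_fun A)
      have h: "h \<in> cylinder_funs" unfolding h_def[abs_def] by (intro function_space_sum[OF S] hk)
      have h_eq: "h \<omega> = (1 / ?n) * of_int \<lfloor>?n * g \<omega>\<rfloor>" for \<omega>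
        unfolding h_def sum_distrib_left[symmetric] using sum_of_bool_floor[of "g \<omega>" "Suc n", OF g01] by simp
      have "of_int \<lfloor>?n * g \<omega>\<rfloor> \<le> ?n * g \<omega>" "?n * g \<omega> \<le> of_int \<lfloor>?n * g \<omega>\<rfloor> + 1" for \<omega> by linarith+
      then have hg: "h \<omega> \<le> g \<omega>" "g \<omega> \<le> h \<omega> + 1 / ?n" for \<omega>
        unfolding h_eq by (simp_all add: field_simps)
      have "R h = (\<Sum>k\<in>{1..Suc n}. (1 / ?n) * R (\<lambda>\<omega>. of_bool (\<omega> \<in> ?A k)))" if R: "linear_functional cylinder_funs R" for R
      proof -
        have "R h = (\<Sum>k\<in>{1..Suc n}. R (\<lambda>\<omega>. (1 / ?n) * of_bool (\<omega> \<in> ?A k)))"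
          unfolding h_def[abs_def] by (intro linear_functional_sum[OF S R] hk)
        also have "\<dots> = (\<Sum>k\<in>{1..Suc n}. (1 / ?n) * R (\<lambda>\<omega>. of_bool (\<omega> \<in> ?A k)))"
        proof (rule sum.cong[OF refl])
          fix k
          show "R (\<lambda>\<omega>. (1 / ?n) * of_bool (\<omega> \<in> ?A k)) = (1 / ?n) * R (\<lambda>\<omega>. of_bool (\<omega> \<in> ?A k))"
            by (rule linear_functional_scale[OF R cylinder_sets_fun[OF A]])
        qed
        finally show ?thesis .
      qed
      from this[OF P(1)] this[OF Q(1)] have "P h = Q h" by (simp only: eq[OF A])
      moreover have "P g \<le> P h + 1 / ?n \<and> P h \<le> P g" by (rule approx[OF P(1) _ one g h hg]) (rule P(2))
      moreover have "Q g \<le> Q h + 1 / ?n \<and> Q h \<le> Q g" by (rule approx[OF Q(1) _ one' g h hg]) (rule Q(2))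
      ultimately show ?thesis by linarith
    qed
    then have le: "\<bar>P g - Q g\<bar> \<le> inverse (real (Suc n))" for n by (simp add: inverse_eq_divide)
    have "\<bar>P g - Q g\<bar> \<le> 0" by (rule LIMSEQ_le_const[OF LIMSEQ_inverse_real_of_nat]) (use le in blast)
    then show ?thesis by simp
  qed
  obtain c where c: "0 \<le> c" "\<And>\<omega>. \<bar>f \<omega>\<bar> \<le> c" using cylinder_funs_bounded[OF f] by (metis bounded_realsE)
  \<comment> \<open>An affine image of \<open>f\<close> with values in [0,1]; \<open>c + 1\<close>
    in place of \<open>c\<close> keeps the denominator positive when \<open>c = 0\<close>.\<close>
  define g where "g \<omega> = (1 / (2 * (c + 1))) * (f \<omega> + (c + 1))" for \<omega>
  have g: "g \<in> cylinder_funs"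
    unfolding g_def[abs_def] by (intro function_space_scale[OF S] function_space_add[OF S] f cylinder_funs_const)
  have "\<bar>f \<omega>\<bar> \<le> c" for \<omega> by (rule c(2))
  then have bounds: "0 \<le> f \<omega> + (c + 1)" "f \<omega> + (c + 1) \<le> 2 * (c + 1)" for \<omega>
    using c(1) by (smt (verit))+
  have "P g = Q g"
    using bounds c(1) by (intro unit[OF g]) (auto simp: g_def)
  moreover have "R g = (1 / (2 * (c + 1))) * (R f + (c + 1) * R (\<lambda>_. 1))" if R: "linear_functional cylinder_funs R" for R
  proof -
    have "R g = (1 / (2 * (c + 1))) * R (\<lambda>\<omega>. f \<omega> + (c + 1))"
      unfolding g_def[abs_def]
      by (rule linear_functional_scale[OF R function_space_add[OF S f cylinder_funs_const]])
    also have "R (\<lambda>\<omega>. f \<omega> + (c + 1)) = R f + R (\<lambda>_. c + 1)"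
      by (rule linear_functional_add[OF R f cylinder_funs_const])
    also have "R (\<lambda>_. c + 1) = R (\<lambda>_. (c + 1) * 1)" by simp
    also have "\<dots> = (c + 1) * R (\<lambda>_. 1)"
      by (rule linear_functional_scale[OF R cylinder_funs_const])
    finally show ?thesis .
  qed
  from this[OF P(1)] this[OF Q(1)] calculation show ?thesis using c(1) one one' by simp
qed

section \<open>Probability measures dominated by a cylinder expectation\<close>

locale continuous_cylinder_expectation =
  fixes p :: "('x cadlag_path \<Rightarrow> real) \<Rightarrow> real"
  assumes p: "real_upper_expectation cylinder_funs p"
    and p_vanish: "(\<And>n. F n \<in> cylinder_funs) \<Longrightarrow> decseq F \<Longrightarrow> (\<And>\<omega>. (\<lambda>n. F n \<omega>) \<longlonglongrightarrow> 0) \<Longrightarrow>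
      (\<lambda>n. p (F n)) \<longlonglongrightarrow> 0"
begin

lemma p_sublinear: "positive_sublinear cylinder_funs p"
  using p by (simp add: real_upper_expectation_def)

definition dominated_measures :: "'x cadlag_path measure set" where
  "dominated_measures = {M. sets M = sets path_algebra \<and> emeasure M UNIV = 1 \<and>
     (\<forall>f\<in>cylinder_funs. integral\<^sup>L M f \<le> p f)}"

lemma dominated_measuresD:
  assumes "M \<in> dominated_measures"
  shows "sets M = sets path_algebra" "space M = UNIV" "emeasure M (space M) = 1"
    "f \<in> cylinder_funs \<Longrightarrow> integral\<^sup>L M f \<le> p f" "f \<in> cylinder_funs \<Longrightarrow> integrable M f"
proof -
  show s: "sets M = sets path_algebra" and le: "f \<in> cylinder_funs \<Longrightarrow> integral\<^sup>L M f \<le> p f"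
    using assms by (auto simp: dominated_measures_def)
  show sp: "space M = UNIV" using sets_eq_imp_space_eq[OF s] by simp
  show one: "emeasure M (space M) = 1" using assms by (simp add: sp dominated_measures_def)
  show "integrable M f" if f: "f \<in> cylinder_funs"
  proof -
    obtain c where "\<And>x. \<bar>f x\<bar> \<le> c" using cylinder_funs_bounded[OF f] by (metis bounded_realsE)
    then show ?thesis using extended_integral_real(1)[OF cylinder_funs_measurable[OF s f] one] by blast
  qed
qed

text \<open>Cylinder sets decreasing to the empty set have indicators decreasing to zero, and
  \<open>0 <= P <= p\<close> on them, so \<open>p_vanish\<close> gives the continuity at the empty
  set required by Caratheodory's theorem. Positivity comes from domination applied to
  \<open>- f\<close>.\<close>

lemma linear_functional_measure:
  assumes P: "linear_functional cylinder_funs P" and le: "\<And>f. f \<in> cylinder_funs \<Longrightarrow> P f \<le> p f"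
  obtains M where "M \<in> dominated_measures" "\<And>f. f \<in> cylinder_funs \<Longrightarrow> integral\<^sup>L M f = P f"
proof -
  note S = function_space_cylinder_funs
  have add: "P (\<lambda>x. u x + v x) = P u + P v" if "u \<in> cylinder_funs" "v \<in> cylinder_funs" for u v
    using P that by (intro linear_functional_add linear_functional_scale)
  have scale: "P (\<lambda>x. a * u x) = a * P u" if "u \<in> cylinder_funs" for u a
    using P that by (intro linear_functional_add linear_functional_scale)
  have neg: "P (\<lambda>x. - u x) = - P u" if "u \<in> cylinder_funs" for u
    using scale[OF that, of "-1"] by simp
  have pos: "0 \<le> P f" if f: "f \<in> cylinder_funs" "\<And>\<omega>. 0 \<le> f \<omega>" for f
  proof -
    have "- P f \<le> p (\<lambda>x. - f x)" using le[OF function_space_uminus[OF S f(1)]] neg[OF f(1)] by simp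
    also have "\<dots> \<le> 0"
      using f(2) by (intro positive_sublinear_nonpos[OF p_sublinear] function_space_uminus[OF S] f(1)) simp
    finally show ?thesis by simp
  qed
  \<comment> \<open>Domination at 1 gives one inequality, domination at -1 the other.\<close>
  have one: "P (\<lambda>_. 1) = 1"
    using le[OF cylinder_funs_const[of 1]] le[OF cylinder_funs_const[of "-1"]] neg[OF cylinder_funs_const[of 1]]
    by (simp add: real_upper_expectation_const[OF p])
  define m where "m A = ennreal (P (\<lambda>\<omega>. of_bool (\<omega> \<in> A)))" for A
  interpret ring_of_sets UNIV "cylinder_sets :: 'x cadlag_path set set" by (rule ring_of_sets_cylinder_sets)
  have UNIV: "UNIV \<in> cylinder_sets" by (simp add: cylinder_sets_def cylinder_funs_const)
  have ind: "0 \<le> P (\<lambda>\<omega>. of_bool (\<omega> \<in> A))" if "A \<in> cylinder_sets" for A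
    using that by (intro pos cylinder_sets_fun) auto
  have "\<exists>\<mu>. (\<forall>s\<in>cylinder_sets. \<mu> s = m s) \<and> measure_space UNIV (sigma_sets UNIV cylinder_sets) \<mu>"
  proof (rule caratheodory_empty_continuous)
    have "P (\<lambda>\<omega>. 0) = 0" using scale[OF cylinder_funs_const[of 0], of 0] by simp
    then show "positive cylinder_sets m" by (simp add: positive_def m_def)
    show "additive cylinder_sets m"
      unfolding additive_def
    proof (intro ballI impI)
      fix A B :: "'x cadlag_path set" assume AB: "A \<in> cylinder_sets" "B \<in> cylinder_sets" "A \<inter> B = {}"
      have "P (\<lambda>\<omega>. of_bool (\<omega> \<in> A \<union> B)) = P (\<lambda>\<omega>. of_bool (\<omega> \<in> A) + of_bool (\<omega> \<in> B))"
        using AB(3) by (intro arg_cong[of _ _ P] ext) auto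
      also have "\<dots> = P (\<lambda>\<omega>. of_bool (\<omega> \<in> A)) + P (\<lambda>\<omega>. of_bool (\<omega> \<in> B))"
        by (intro add cylinder_sets_fun AB)
      finally show "m (A \<union> B) = m A + m B" using ind AB by (simp add: m_def)
    qed
    show "(\<lambda>i. m (A i)) \<longlonglongrightarrow> 0"
      if A: "range A \<subseteq> cylinder_sets" "decseq A" "(\<Inter>i. A i) = {}" for A :: "nat \<Rightarrow> 'x cadlag_path set"
    proof -
      let ?F = "\<lambda>i \<omega>. of_bool (\<omega> \<in> A i) :: real"
      have cyl: "A i \<in> cylinder_sets" for i using A(1) by auto
      have sub: "A (Suc i) \<subseteq> A i" for i using decseq_SucD[OF A(2)] .
      have "(\<lambda>i. p (?F i)) \<longlonglongrightarrow> 0"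
      proof (rule p_vanish)
        show "?F i \<in> cylinder_funs" for i by (intro cylinder_sets_fun cyl)
        show "decseq ?F" using sub by (intro decseq_SucI le_funI) auto
        fix \<omega>
        obtain i where "\<omega> \<notin> A i" using A(3) by blast
        then have "\<omega> \<notin> A j" if "i \<le> j" for j using decseqD[OF A(2) that] by blast
        then show "(\<lambda>i. ?F i \<omega>) \<longlonglongrightarrow> 0"
          by (intro tendsto_eventually eventually_sequentiallyI[of i]) simp
      qed
      then have "(\<lambda>i. P (?F i)) \<longlonglongrightarrow> 0"
        by (rule tendsto_sandwich[OF _ _ tendsto_const, rotated 2])
           (use ind cyl le[OF cylinder_sets_fun[OF cyl]] in auto)
      then have "(\<lambda>i. ennreal (P (?F i))) \<longlonglongrightarrow> ennreal 0" by (rule tendsto_ennrealI)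
      then show ?thesis by (simp add: m_def)
    qed
  qed (simp add: m_def)
  then obtain \<mu> where \<mu>: "\<And>A. A \<in> cylinder_sets \<Longrightarrow> \<mu> A = m A"
    "measure_space UNIV (sigma_sets UNIV cylinder_sets) \<mu>" by blast
  define M where "M = measure_of UNIV cylinder_sets \<mu>"
  have sets: "sets M = sigma_sets UNIV cylinder_sets" by (simp add: M_def sets_measure_of_conv)
  have sp: "space M = UNIV" by (simp add: M_def space_measure_of_conv)
  have emeasure: "emeasure M A = m A" if A: "A \<in> cylinder_sets" for A
  proof -
    have "emeasure M A = \<mu> A"
      by (rule emeasure_measure_of[OF M_def]) (use \<mu>(2) A in \<open>auto simp: sets measure_space_def sigma_sets.Basic\<close>)
    then show ?thesis using \<mu>(1)[OF A] by simp
  qed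
  have mass: "emeasure M (space M) = 1" using emeasure[OF UNIV] one by (simp add: sp m_def)
  have sets': "sets M = sets path_algebra" by (simp add: sets sets_path_algebra)
  have int: "integrable M f" if f: "f \<in> cylinder_funs" for f
  proof -
    obtain c where "\<And>x. \<bar>f x\<bar> \<le> c" using cylinder_funs_bounded[OF f] by (metis bounded_realsE)
    then show ?thesis using extended_integral_real(1)[OF cylinder_funs_measurable[OF sets' f] mass] by blast
  qed
  have eq: "P f = integral\<^sup>L M f" if f: "f \<in> cylinder_funs" for f
  proof (rule linear_functionals_agree[OF P pos _ _ _ one f])
    show "linear_functional cylinder_funs (integral\<^sup>L M)"
      unfolding linear_functional_def using int by auto
    show "0 \<le> integral\<^sup>L M f" if "\<And>\<omega>. 0 \<le> f \<omega>" for f :: "'x cadlag_path \<Rightarrow> real"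
      using that by (intro Bochner_Integration.integral_nonneg) simp
    fix A :: "'x cadlag_path set" assume A: "A \<in> cylinder_sets"
    have "A \<in> sets M" using A by (simp add: sets sigma_sets.Basic)
    then have "integral\<^sup>L M (indicator A) = measure M A" by simp
    moreover have "indicator A = (\<lambda>\<omega>. of_bool (\<omega> \<in> A) :: real)" by (auto simp: indicator_def)
    ultimately show "P (\<lambda>\<omega>. of_bool (\<omega> \<in> A)) = integral\<^sup>L M (\<lambda>\<omega>. of_bool (\<omega> \<in> A))"
      using emeasure[OF A] ind[OF A] by (simp add: measure_def m_def)
  qed
  have "M \<in> dominated_measures"
    using mass le eq by (simp add: dominated_measures_def sets' sp)
  then show ?thesis using that eq by metis
qed

text \<open>With a constant sequence this yields a measure attaining \<open>p f\<close>; with a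
  decreasing one it yields a single measure to which dominated convergence can be applied.\<close>

lemma dominated_measure_ge:
  assumes f: "\<And>n. f n \<in> cylinder_funs" and dec: "\<And>m n x. m \<le> n \<Longrightarrow> f n x \<le> f m x" and c: "\<And>n::nat. c \<le> p (f n)"
  obtains M where "M \<in> dominated_measures" "\<And>n. c \<le> integral\<^sup>L M (f n)"
proof -
  obtain P where P: "linear_functional cylinder_funs P" "\<And>g. g \<in> cylinder_funs \<Longrightarrow> P g \<le> p g" "\<And>n. c \<le> P (f n)"
    by (rule dominated_linear_functional_ge[OF function_space_cylinder_funs p_sublinear, of f c]) (use assms in auto)
  obtain M where "M \<in> dominated_measures" "\<And>f. f \<in> cylinder_funs \<Longrightarrow> integral\<^sup>L M f = P f"
    by (rule linear_functional_measure[OF P(1)]) (use P(2) in auto)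
  then show ?thesis using that P(3) f by simp
qed

end

section \<open>The upper expectation on paths and its continuity properties\<close>

context continuous_cylinder_expectation
begin

definition path_expectation :: "('x cadlag_path \<Rightarrow> ereal) \<Rightarrow> ereal" where
  "path_expectation f = (SUP M\<in>dominated_measures. extended_integral M f)"

lemma path_expectation_upper: "M \<in> dominated_measures \<Longrightarrow> extended_integral M f \<le> path_expectation f"
  unfolding path_expectation_def by (rule SUP_upper)

lemma extended_integral_cylinder:
  assumes M: "M \<in> dominated_measures" and f: "f \<in> cylinder_funs"
  shows "extended_integral M (\<lambda>\<omega>. ereal (f \<omega>)) = ereal (integral\<^sup>L M f)"
proof -
  obtain c where "\<And>x. \<bar>f x\<bar> \<le> c" using cylinder_funs_bounded[OF f] by (metis bounded_realsE)
  then show ?thesis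
    by (rule extended_integral_real(2)[OF cylinder_funs_measurable[OF dominated_measuresD(1)[OF M] f]
          dominated_measuresD(3)[OF M]])
qed

text \<open>Domination gives the upper bound, and the supremum is attained by the measure for the
  constant sequence \<open>f\<close>.\<close>

lemma path_expectation_cylinder:
  assumes f: "f \<in> cylinder_funs"
  shows "path_expectation (\<lambda>\<omega>. ereal (f \<omega>)) = ereal (p f)"
proof (rule antisym)
  show "path_expectation (\<lambda>\<omega>. ereal (f \<omega>)) \<le> ereal (p f)"
    unfolding path_expectation_def
    by (rule SUP_least) (simp add: extended_integral_cylinder dominated_measuresD(4) f)
  obtain M where M: "M \<in> dominated_measures" "p f \<le> integral\<^sup>L M f"
    using dominated_measure_ge[of "\<lambda>_. f" "p f"] f by auto
  then show "ereal (p f) \<le> path_expectation (\<lambda>\<omega>. ereal (f \<omega>))"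
    using path_expectation_upper[OF M(1), of "\<lambda>\<omega>. ereal (f \<omega>)"] extended_integral_cylinder[OF M(1) f]
    by (metis ereal_less_eq(3) order_trans)
qed

lemma path_expectation_mono: "f \<le> g \<Longrightarrow> path_expectation f \<le> path_expectation g"
  unfolding path_expectation_def by (intro SUP_mono) (blast intro: extended_integral_mono)

lemma path_expectation_const: "path_expectation (\<lambda>_. ereal c) = ereal c"
  using path_expectation_cylinder[OF cylinder_funs_const] real_upper_expectation_const[OF p] by simp

lemma measurable_dominated:
  assumes "f \<in> borel_measurable path_algebra" "M \<in> dominated_measures"
  shows "f \<in> borel_measurable M"
  using assms(1) measurable_cong_sets[OF dominated_measuresD(1)[OF assms(2)] refl] by blast

lemma path_expectation_scale_le:
  assumes f: "f \<in> borel_measurable path_algebra" and a: "a > 0"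
  shows "path_expectation (\<lambda>\<omega>. ereal a * f \<omega>) \<le> ereal a * path_expectation f"
  unfolding path_expectation_def[of "\<lambda>\<omega>. ereal a * f \<omega>"]
proof (rule SUP_least)
  fix M assume M: "M \<in> dominated_measures"
  have "extended_integral M (\<lambda>\<omega>. ereal a * f \<omega>) = ereal a * extended_integral M f"
    by (rule extended_integral_scale[OF measurable_dominated[OF f M] a])
  also have "\<dots> \<le> ereal a * path_expectation f"
    using a by (intro ereal_mult_left_mono path_expectation_upper M) simp
  finally show "extended_integral M (\<lambda>\<omega>. ereal a * f \<omega>) \<le> ereal a * path_expectation f" .
qed

lemma path_expectation_scale:
  assumes f: "f \<in> borel_measurable path_algebra" and a: "a \<ge> 0"
  shows "path_expectation (\<lambda>\<omega>. ereal a * f \<omega>) = ereal a * path_expectation f"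
proof (cases "a = 0")
  case True
  then show ?thesis using path_expectation_const[of 0] by (simp add: zero_ereal_def[symmetric])
next
  case False
  then have a: "a > 0" using a by simp
  have inv: "ereal a * (ereal (1 / a) * x) = x" "ereal (1 / a) * (ereal a * x) = x" for x
    using a by (simp_all add: mult.assoc[symmetric])
  have "(\<lambda>\<omega>. ereal a * f \<omega>) \<in> borel_measurable path_algebra" using f by measurable
  from path_expectation_scale_le[OF this, of "1 / a"]
  have "path_expectation f \<le> ereal (1 / a) * path_expectation (\<lambda>\<omega>. ereal a * f \<omega>)" using a by (simp only: inv) simp
  then have "ereal a * path_expectation f \<le> ereal a * (ereal (1 / a) * path_expectation (\<lambda>\<omega>. ereal a * f \<omega>))"
    using a by (intro ereal_mult_left_mono) auto
  then show ?thesis using path_expectation_scale_le[OF f a] by (simp only: inv)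
qed

text \<open>If one of the two values is infinite, meaningfulness makes the right side infinite.
  Otherwise every dominated measure gives values below infinity, which is what additivity of the
  extended integral asks for.\<close>

lemma path_expectation_add:
  assumes f: "f \<in> borel_measurable path_algebra" and g: "g \<in> borel_measurable path_algebra"
    and m: "\<And>\<omega>. meaningful_sum (f \<omega>) (g \<omega>)" "meaningful_sum (path_expectation f) (path_expectation g)"
  shows "path_expectation (\<lambda>\<omega>. f \<omega> + g \<omega>) \<le> path_expectation f + path_expectation g"
proof (cases "path_expectation f = \<infinity> \<or> path_expectation g = \<infinity>")
  case True
  then have "path_expectation f + path_expectation g = \<infinity>" using m(2) by (auto simp: meaningful_sum_def)
  then show ?thesis by (simp only: ereal_less_eq(1))
next
  case False
  show ?thesis
    unfolding path_expectation_def[of "\<lambda>\<omega>. f \<omega> + g \<omega>"]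
  proof (rule SUP_least)
    fix M assume M: "M \<in> dominated_measures"
    have "extended_integral M (\<lambda>\<omega>. f \<omega> + g \<omega>) \<le> extended_integral M f + extended_integral M g"
      using False path_expectation_upper[OF M, of f] path_expectation_upper[OF M, of g]
      by (intro extended_integral_add measurable_dominated[OF _ M] f g m(1)) (auto simp: less_top[symmetric] top_ereal_def)
    also have "\<dots> \<le> path_expectation f + path_expectation g"
      by (intro add_mono path_expectation_upper M)
    finally show "extended_integral M (\<lambda>\<omega>. f \<omega> + g \<omega>) \<le> path_expectation f + path_expectation g" .
  qed
qed

lemma sublinear_expectation_path_expectation:
  assumes G: "G \<subseteq> borel_measurable path_algebra" "\<And>c. (\<lambda>_. ereal c) \<in> G"
  shows "sublinear_expectation G path_expectation"
  unfolding sublinear_expectation_def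
  using G by (auto intro!: path_expectation_mono path_expectation_const path_expectation_scale path_expectation_add)

text \<open>Monotone convergence under each measure, followed by an exchange of two suprema. A lower
  bound for \<open>F 0\<close> serves the whole sequence because it increases.\<close>

lemma upward_continuous_path_expectation: "upward_continuous_on M_bdd_below path_expectation"
  unfolding upward_continuous_on_def
proof (intro allI impI, elim conjE)
  fix F and f :: "'x cadlag_path \<Rightarrow> ereal"
  assume F: "\<forall>n. F n \<in> M_bdd_below" and f: "f \<in> M_bdd_below" and inc: "increases_to F f"
  have F': "F n \<in> borel_measurable path_algebra" for n using F by (auto simp: M_bdd_below_def)
  have f': "f \<in> borel_measurable path_algebra" using f by (auto simp: M_bdd_below_def)
  have inc': "incseq F" using inc by (simp add: increases_to_def)
  obtain r where r: "\<And>\<omega>. ereal r \<le> F 0 \<omega>" using F M_bdd_below_lower_bound by metis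
  define c where "c = max 0 (- r)"
  have c: "0 \<le> c" by (simp add: c_def)
  have c_le: "ereal (- c) \<le> F 0 \<omega>" for \<omega>
    by (rule order_trans[OF _ r]) (simp add: c_def)
  have int_inc: "incseq (\<lambda>n. extended_integral M (F n))" for M
    using inc' by (intro incseq_SucI extended_integral_mono) (rule incseq_SucD)
  have "path_expectation f = (SUP M\<in>dominated_measures. SUP n. extended_integral M (F n))"
    unfolding path_expectation_def
  proof (rule SUP_cong[OF refl])
    fix M assume M: "M \<in> dominated_measures"
    have "(\<lambda>n. extended_integral M (F n)) \<longlonglongrightarrow> extended_integral M f"
      by (rule extended_integral_monotone_convergence[OF measurable_dominated[OF F' M]
            dominated_measuresD(3)[OF M] inc measurable_dominated[OF f' M] c_le c])
    then show "extended_integral M f = (SUP n. extended_integral M (F n))"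
      using LIMSEQ_SUP[OF int_inc] LIMSEQ_unique by blast
  qed
  also have "\<dots> = (SUP n. path_expectation (F n))"
    unfolding path_expectation_def by (rule SUP_commute)
  finally have eq: "path_expectation f = (SUP n. path_expectation (F n))" .
  have "incseq (\<lambda>n. path_expectation (F n))"
    using inc' by (intro incseq_SucI path_expectation_mono) (rule incseq_SucD)
  then show "(\<lambda>n. path_expectation (F n)) \<longlonglongrightarrow> path_expectation f"
    unfolding eq by (rule LIMSEQ_SUP)
qed

text \<open>If the expectations of all \<open>h n\<close> stayed above, one dominated measure would
  witness this for every \<open>n\<close>, and dominated convergence would push the limit function
  above as well.\<close>

lemma path_expectation_decreasing_cylinder:
  assumes h: "\<And>n. h n \<in> cylinder_funs" and dec: "decseq h" and f: "f \<in> bounded_reals"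
    and lim: "\<And>\<omega>. (\<lambda>n. h n \<omega>) \<longlonglongrightarrow> f \<omega>" and a: "path_expectation (\<lambda>\<omega>. ereal (f \<omega>)) < a"
  shows "\<exists>n. path_expectation (\<lambda>\<omega>. ereal (h n \<omega>)) < a"
proof (rule ccontr)
  assume none: "\<nexists>n. path_expectation (\<lambda>\<omega>. ereal (h n \<omega>)) < a"
  \<comment> \<open>The level \<open>a\<close> may be infinite, whereas the choice of the measure
    takes a real constant.\<close>
  obtain c where c: "path_expectation (\<lambda>\<omega>. ereal (f \<omega>)) < ereal c" "ereal c < a"
    using a ereal_dense2 by blast
  have mono: "h n \<omega> \<le> h m \<omega>" if "m \<le> n" for m n \<omega>
    using decseqD[OF dec that] by (simp add: le_fun_def)
  have "c \<le> p (h n)" for n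
  proof -
    have "a \<le> path_expectation (\<lambda>\<omega>. ereal (h n \<omega>))" using none not_less by blast
    then have "ereal c \<le> ereal (p (h n))"
      unfolding path_expectation_cylinder[OF h] using c(2) by (meson less_imp_le order_trans)
    then show ?thesis by simp
  qed
  then obtain M where M: "M \<in> dominated_measures" "\<And>n. c \<le> integral\<^sup>L M (h n)"
    using dominated_measure_ge[of h c] h mono by auto
  obtain b where b: "\<And>x. \<bar>h 0 x\<bar> \<le> b" using cylinder_funs_bounded[OF h] by (metis bounded_realsE)
  obtain d where d: "\<And>x. \<bar>f x\<bar> \<le> d" using f by (metis bounded_realsE)
  have h_meas: "h n \<in> borel_measurable M" for n
    by (rule cylinder_funs_measurable[OF dominated_measuresD(1)[OF M(1)] h])
  have f_meas: "f \<in> borel_measurable M"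
    by (rule borel_measurable_LIMSEQ_metric[OF h_meas lim])
  have f_le: "f x \<le> h n x" for n x
    by (rule decseq_ge[OF _ lim]) (use decseq_SucD[OF dec] in \<open>auto intro!: decseq_SucI simp: le_fun_def\<close>)
  interpret finite_measure M by (rule finite_measureI) (simp add: dominated_measuresD(3)[OF M(1)])
  have "(\<lambda>n. integral\<^sup>L M (h n)) \<longlonglongrightarrow> integral\<^sup>L M f"
  proof (rule integral_dominated_convergence[where w = "\<lambda>_. max b d"])
    show "AE x in M. norm (h n x) \<le> max b d" for n
    proof (rule AE_I2)
      fix x
      show "norm (h n x) \<le> max b d"
        using mono[of 0 n x] f_le[of x n] b[of x] d[of x] by (auto simp: abs_le_iff max_def)
    qed
  qed (use h_meas f_meas lim in auto)
  then have "c \<le> integral\<^sup>L M f" by (rule LIMSEQ_le_const) (use M(2) in auto)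
  also have "ereal \<dots> = extended_integral M (\<lambda>\<omega>. ereal (f \<omega>))"
    by (rule extended_integral_real(2)[OF f_meas dominated_measuresD(3)[OF M(1)] d, symmetric])
  also have "\<dots> \<le> path_expectation (\<lambda>\<omega>. ereal (f \<omega>))" by (rule path_expectation_upper[OF M(1)])
  finally show False using c(1) by simp
qed

end

lemma downward_continuous_onD:
  "downward_continuous_on C \<Phi> \<Longrightarrow> (\<And>n. F n \<in> C) \<Longrightarrow> f \<in> C \<Longrightarrow> decreases_to F f \<Longrightarrow>
    (\<lambda>n. \<Phi> (F n)) \<longlonglongrightarrow> \<Phi> f"
  by (simp add: downward_continuous_on_def)

lemma upward_continuous_onD:
  "upward_continuous_on C \<Phi> \<Longrightarrow> (\<And>n. F n \<in> C) \<Longrightarrow> f \<in> C \<Longrightarrow> increases_to F f \<Longrightarrow>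
    (\<lambda>n. \<Phi> (F n)) \<longlonglongrightarrow> \<Phi> f"
  by (simp add: upward_continuous_on_def)

lemma cylinder_funs_Min_Max:
  fixes h :: "'i \<Rightarrow> 'x cadlag_path \<Rightarrow> real"
  assumes "finite I" "I \<noteq> {}" "\<And>i. i \<in> I \<Longrightarrow> h i \<in> cylinder_funs"
  shows "(\<lambda>\<omega>. Min ((\<lambda>i. h i \<omega>) ` I)) \<in> cylinder_funs" "(\<lambda>\<omega>. Max ((\<lambda>i. h i \<omega>) ` I)) \<in> cylinder_funs"
proof -
  have bd: "(\<lambda>\<omega>. min (u \<omega>) (v \<omega>)) \<in> bounded_reals" "(\<lambda>\<omega>. max (u \<omega>) (v \<omega>)) \<in> bounded_reals"
    if uv: "u \<in> cylinder_funs" "v \<in> cylinder_funs" for u v :: "'x cadlag_path \<Rightarrow> real"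
  proof -
    obtain b where b: "\<And>x. \<bar>u x\<bar> \<le> b" using cylinder_funs_bounded[OF uv(1)] by (metis bounded_realsE)
    obtain d where d: "\<And>x. \<bar>v x\<bar> \<le> d" using cylinder_funs_bounded[OF uv(2)] by (metis bounded_realsE)
    have "\<bar>min (u x) (v x)\<bar> \<le> max b d" "\<bar>max (u x) (v x)\<bar> \<le> max b d" for x using b[of x] d[of x] by linarith+
    then show "(\<lambda>\<omega>. min (u \<omega>) (v \<omega>)) \<in> bounded_reals" "(\<lambda>\<omega>. max (u \<omega>) (v \<omega>)) \<in> bounded_reals"
      by (auto intro!: bounded_realsI[of _ "max b d"])
  qed
  show "(\<lambda>\<omega>. Min ((\<lambda>i. h i \<omega>) ` I)) \<in> cylinder_funs"
    using assms
  proof (induction I rule: finite_ne_induct)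
    case (insert i I)
    have i: "h i \<in> cylinder_funs" and I: "(\<lambda>\<omega>. Min ((\<lambda>i. h i \<omega>) ` I)) \<in> cylinder_funs"
      using insert by auto
    have "(\<lambda>\<omega>. min (h i \<omega>) (Min ((\<lambda>i. h i \<omega>) ` I))) \<in> cylinder_funs"
      by (rule cylinder_funs_combine[where h = min, OF i I bd(1)[OF i I]])
    then show ?case using insert by simp
  qed simp
  show "(\<lambda>\<omega>. Max ((\<lambda>i. h i \<omega>) ` I)) \<in> cylinder_funs"
    using assms
  proof (induction I rule: finite_ne_induct)
    case (insert i I)
    have i: "h i \<in> cylinder_funs" and I: "(\<lambda>\<omega>. Max ((\<lambda>i. h i \<omega>) ` I)) \<in> cylinder_funs"
      using insert by auto
    have "(\<lambda>\<omega>. max (h i \<omega>) (Max ((\<lambda>i. h i \<omega>) ` I))) \<in> cylinder_funs"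
      by (rule cylinder_funs_combine[where h = max, OF i I bd(2)[OF i I]])
    then show ?case using insert by simp
  qed simp
qed

lemma fin_dim_delta_b_cylinder:
  assumes "f \<in> fin_dim_delta_b"
  obtains h where "\<And>n. h n \<in> cylinder_funs" "decreases_to (\<lambda>n \<omega>. ereal (h n \<omega>)) f"
proof -
  obtain F where F: "\<And>n. F n \<in> fin_dim_funs" "decreases_to F f" using assms by (auto simp: fin_dim_delta_b_def)
  have "\<exists>h. h \<in> cylinder_funs \<and> F n = (\<lambda>\<omega>. ereal (h \<omega>))" for n using F(1)[of n] by (rule fin_dim_funsE) blast
  then obtain h where h: "\<And>n. h n \<in> cylinder_funs" "\<And>n. F n = (\<lambda>\<omega>. ereal (h n \<omega>))" by metis
  then have "F = (\<lambda>n \<omega>. ereal (h n \<omega>))" by (simp add: fun_eq_iff)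
  then show ?thesis using that h(1) F(2) by blast
qed

context continuous_cylinder_expectation
begin

text \<open>A decreasing sequence of limits of cylinder functions is replaced by one decreasing
  sequence of cylinder functions with the same limit, to which the previous lemma applies.\<close>

lemma downward_continuous_path_expectation: "downward_continuous_on fin_dim_delta_b path_expectation"
  unfolding downward_continuous_on_def
proof (intro allI impI, elim conjE)
  fix F and f :: "'x cadlag_path \<Rightarrow> ereal"
  assume F: "\<forall>n. F n \<in> fin_dim_delta_b" and f: "f \<in> fin_dim_delta_b" and dec: "decreases_to F f"
  have "\<exists>h. (\<forall>k. h k \<in> cylinder_funs) \<and> decreases_to (\<lambda>k \<omega>. ereal (h k \<omega>)) (F n)" for n
    using F by (metis fin_dim_delta_b_cylinder)
  then obtain h where h: "\<And>n k. h n k \<in> cylinder_funs"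
    and h_dec: "\<And>n. decreases_to (\<lambda>k \<omega>. ereal (h n k \<omega>)) (F n)" by metis
  have h_lim: "(\<lambda>k. ereal (h n k \<omega>)) \<longlonglongrightarrow> F n \<omega>" for n \<omega> using h_dec[of n] by (simp add: decreases_to_def)
  have h_mono: "h n k \<omega> \<le> h n j \<omega>" if "j \<le> k" for n j k \<omega>
  proof -
    have "(\<lambda>\<omega>. ereal (h n k \<omega>)) \<le> (\<lambda>\<omega>. ereal (h n j \<omega>))"
      using h_dec[of n] that by (auto simp: decreases_to_def dest: decseqD)
    then show ?thesis by (simp add: le_fun_def)
  qed
  have h_ge: "F n \<omega> \<le> ereal (h n k \<omega>)" for n k \<omega>
    by (rule decseq_ge[OF _ h_lim]) (use h_mono in \<open>auto intro!: decseq_SucI\<close>)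
  have F_mono: "F n \<omega> \<le> F m \<omega>" if "m \<le> n" for m n \<omega>
    using dec that by (auto simp: decreases_to_def dest!: decseqD[of F m n] le_funD)
  have F_lim: "(\<lambda>n. F n \<omega>) \<longlonglongrightarrow> f \<omega>" for \<omega> using dec by (simp add: decreases_to_def)
  have F_ge: "f \<omega> \<le> F n \<omega>" for n \<omega>
    by (rule decseq_ge[OF _ F_lim]) (use F_mono in \<open>auto intro!: decseq_SucI\<close>)
  obtain fr where fr: "fr \<in> bounded_reals" "f = (\<lambda>\<omega>. ereal (fr \<omega>))"
    using f by (auto simp: fin_dim_delta_b_def elim: bounded_funs_UNIV_E)
  \<comment> \<open>A diagonal minimum: it stays above \<open>F m\<close> and below
    \<open>h n m\<close> for every \<open>n <= m\<close>, so it is squeezed to the common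
    limit.\<close>
  define g where "g m \<omega> = Min ((\<lambda>n. h n m \<omega>) ` {..m})" for m \<omega>
  have g: "g m \<in> cylinder_funs" for m unfolding g_def[abs_def] by (rule cylinder_funs_Min_Max(1)) (auto intro: h)
  have g_le: "g m \<omega> \<le> h n m \<omega>" if "n \<le> m" for n m \<omega>
    unfolding g_def using that by (intro Min_le) auto
  have g_ge: "F m \<omega> \<le> ereal (g m \<omega>)" for m \<omega>
  proof -
    have "g m \<omega> \<in> (\<lambda>n. h n m \<omega>) ` {..m}" unfolding g_def by (rule Min_in) auto
    then obtain n where "n \<le> m" "g m \<omega> = h n m \<omega>" by auto
    then show ?thesis using order_trans[OF F_mono h_ge] by metis
  qed
  have g_dec: "decseq g"
  proof (intro decseq_SucI le_funI)
    fix m \<omega>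
    have "g m \<omega> \<in> (\<lambda>n. h n m \<omega>) ` {..m}" unfolding g_def by (rule Min_in) auto
    then obtain n where n: "n \<le> m" "g m \<omega> = h n m \<omega>" by auto
    have "g (Suc m) \<omega> \<le> h n (Suc m) \<omega>" using n(1) by (intro g_le) simp
    also have "\<dots> \<le> g m \<omega>" unfolding n(2) by (rule h_mono) simp
    finally show "g (Suc m) \<omega> \<le> g m \<omega>" .
  qed
  have g_lim: "(\<lambda>m. g m \<omega>) \<longlonglongrightarrow> fr \<omega>" for \<omega>
  proof -
    have "(\<lambda>m. ereal (g m \<omega>)) \<longlonglongrightarrow> f \<omega>"
    proof (rule order_tendstoI)
      fix a assume "a < f \<omega>"
      then have "a < ereal (g m \<omega>)" for m using F_ge g_ge by (meson less_le_trans)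
      then show "\<forall>\<^sub>F m in sequentially. a < ereal (g m \<omega>)" by simp
    next
      fix a assume "f \<omega> < a"
      then have "\<forall>\<^sub>F n in sequentially. F n \<omega> < a" by (rule order_tendstoD(2)[OF F_lim])
      then obtain n where "F n \<omega> < a" by (auto dest: eventually_happens)
      then have "\<forall>\<^sub>F k in sequentially. ereal (h n k \<omega>) < a" by (rule order_tendstoD(2)[OF h_lim])
      then show "\<forall>\<^sub>F m in sequentially. ereal (g m \<omega>) < a"
        using eventually_ge_at_top[of n]
      proof eventually_elim
        case (elim m)
        then show ?case using g_le[of n m \<omega>] by (metis ereal_less_eq(3) le_less_trans)
      qed
    qed
    then show ?thesis by (simp add: fr(2))
  qed
  show "(\<lambda>n. path_expectation (F n)) \<longlonglongrightarrow> path_expectation f"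
  proof (rule order_tendstoI)
    fix a assume "a < path_expectation f"
    moreover have "path_expectation f \<le> path_expectation (F n)" for n
      using F_ge by (intro path_expectation_mono) (simp add: le_fun_def)
    ultimately show "\<forall>\<^sub>F n in sequentially. a < path_expectation (F n)"
      by (intro always_eventually allI) (rule less_le_trans)
  next
    fix a assume "path_expectation f < a"
    then obtain m where m: "path_expectation (\<lambda>\<omega>. ereal (g m \<omega>)) < a"
      using path_expectation_decreasing_cylinder[OF g g_dec fr(1) g_lim] fr(2) by blast
    have "path_expectation (F n) < a" if "m \<le> n" for n
    proof -
      have "path_expectation (F n) \<le> path_expectation (\<lambda>\<omega>. ereal (g m \<omega>))"
        using order_trans[OF F_mono[OF that] g_ge] by (intro path_expectation_mono) (simp add: le_fun_def)
      then show ?thesis using m by (rule le_less_trans)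
    qed
    then show "\<forall>\<^sub>F n in sequentially. path_expectation (F n) < a"
      by (rule eventually_sequentiallyI)
  qed
qed

end

section \<open>Capacitability\<close>

text \<open>Functional form of a Suslin scheme. Finite words are encoded as prefixes:
  \<open>H m\<close> takes a whole branch but sees only its first \<open>m\<close> entries. In
  \<open>suslin\<close>, supremum and infimum replace union over branches and intersection along a
  branch.\<close>

definition suslin_scheme :: "(nat \<Rightarrow> (nat \<Rightarrow> nat) \<Rightarrow> 'x cadlag_path \<Rightarrow> real) \<Rightarrow> bool" where
  "suslin_scheme H \<longleftrightarrow>
     (\<forall>m \<alpha>. H m \<alpha> \<in> cylinder_funs) \<and> (\<forall>m \<alpha> \<omega>. 0 \<le> H m \<alpha> \<omega> \<and> H m \<alpha> \<omega> \<le> 1) \<and>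
     (\<forall>m \<alpha> \<beta>. (\<forall>i<m. \<alpha> i = \<beta> i) \<longrightarrow> H m \<alpha> = H m \<beta>)"

definition suslin :: "('x cadlag_path \<Rightarrow> ereal) \<Rightarrow> bool" where
  "suslin f \<longleftrightarrow> (\<exists>H. suslin_scheme H \<and> (\<forall>\<omega>. f \<omega> = (SUP \<alpha>. INF m. ereal (H m \<alpha> \<omega>))))"

lemma suslin_schemeD:
  assumes "suslin_scheme H"
  shows "H m \<alpha> \<in> cylinder_funs" "0 \<le> H m \<alpha> \<omega>" "H m \<alpha> \<omega> \<le> 1"
    "(\<And>i. i < m \<Longrightarrow> \<alpha> i = \<beta> i) \<Longrightarrow> H m \<alpha> = H m \<beta>"
  using assms unfolding suslin_scheme_def by blast+

lemma suslin_schemeI: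
  assumes "\<And>m \<alpha>. H m \<alpha> \<in> cylinder_funs" "\<And>m \<alpha> \<omega>. 0 \<le> H m \<alpha> \<omega>" "\<And>m \<alpha> \<omega>. H m \<alpha> \<omega> \<le> 1"
    "\<And>m \<alpha> \<beta>. (\<And>i. i < m \<Longrightarrow> \<alpha> i = \<beta> i) \<Longrightarrow> H m \<alpha> = H m \<beta>"
  shows "suslin_scheme H"
  using assms unfolding suslin_scheme_def by blast

lemma suslin_cylinder:
  assumes "f \<in> cylinder_funs" "\<And>\<omega>. 0 \<le> f \<omega>" "\<And>\<omega>. f \<omega> \<le> 1"
  shows "suslin (\<lambda>\<omega>. ereal (f \<omega>))"
  unfolding suslin_def
  by (intro exI[of _ "\<lambda>_ _. f"] conjI suslin_schemeI) (use assms in auto)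

text \<open>The first entry of a branch selects the function, and the rest is a branch for it,
  shifted by one level. Level 0 may not read any entry and is therefore filled with the constant 1,
  an upper bound of all values.\<close>

lemma suslin_SUP:
  fixes f :: "nat \<Rightarrow> 'x cadlag_path \<Rightarrow> ereal"
  assumes "\<And>i. suslin (f i)"
  shows "suslin (\<lambda>\<omega>. SUP i. f i \<omega>)"
proof -
  obtain H where H: "\<And>i. suslin_scheme (H i)" "\<And>i \<omega>. f i \<omega> = (SUP \<alpha>. INF m. ereal (H i m \<alpha> \<omega>))"
    using assms unfolding suslin_def by metis
  define G where "G m \<alpha> = (case m of 0 \<Rightarrow> (\<lambda>_. 1) | Suc k \<Rightarrow> H (\<alpha> 0) k (\<lambda>j. \<alpha> (Suc j)))" for m \<alpha>
  have "suslin_scheme G"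
  proof (rule suslin_schemeI)
    fix m and \<alpha> \<beta> :: "nat \<Rightarrow> nat" assume eq: "\<And>i. i < m \<Longrightarrow> \<alpha> i = \<beta> i"
    show "G m \<alpha> = G m \<beta>"
    proof (cases m)
      case (Suc k)
      then have "H (\<alpha> 0) k (\<lambda>j. \<alpha> (Suc j)) = H (\<alpha> 0) k (\<lambda>j. \<beta> (Suc j))"
        using eq by (intro suslin_schemeD(4)[OF H(1)]) simp
      then show ?thesis using Suc eq[of 0] by (simp add: G_def)
    qed (simp add: G_def)
  qed (auto simp: G_def cylinder_funs_const suslin_schemeD(1,2,3)[OF H(1)] split: nat.split)
  moreover have "(SUP i. f i \<omega>) = (SUP \<alpha>. INF m. ereal (G m \<alpha> \<omega>))" for \<omega>
  proof (rule antisym)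
    show "(SUP i. f i \<omega>) \<le> (SUP \<alpha>. INF m. ereal (G m \<alpha> \<omega>))"
      unfolding H(2)
    proof (intro SUP_least)
      fix i \<alpha>
      have "(INF m. ereal (H i m \<alpha> \<omega>)) \<le> (INF m. ereal (G m (case_nat i \<alpha>) \<omega>))"
      proof (rule INF_greatest)
        fix m
        show "(INF m. ereal (H i m \<alpha> \<omega>)) \<le> ereal (G m (case_nat i \<alpha>) \<omega>)"
        proof (cases m)
          case 0
          have "(INF m. ereal (H i m \<alpha> \<omega>)) \<le> ereal (H i 0 \<alpha> \<omega>)" by (rule INF_lower) simp
          also have "\<dots> \<le> 1" using suslin_schemeD(3)[OF H(1)] by simp
          finally show ?thesis by (simp add: 0 G_def one_ereal_def)
        next
          case (Suc k)
          then show ?thesis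
            using INF_lower[of k UNIV "\<lambda>m. ereal (H i m \<alpha> \<omega>)"] by (simp add: G_def)
        qed
      qed
      also have "\<dots> \<le> (SUP \<alpha>. INF m. ereal (G m \<alpha> \<omega>))" by (rule SUP_upper) simp
      finally show "(INF m. ereal (H i m \<alpha> \<omega>)) \<le> (SUP \<alpha>. INF m. ereal (G m \<alpha> \<omega>))" .
    qed
    show "(SUP \<alpha>. INF m. ereal (G m \<alpha> \<omega>)) \<le> (SUP i. f i \<omega>)"
    proof (rule SUP_least)
      fix \<alpha>
      have "(INF m. ereal (G m \<alpha> \<omega>)) \<le> (INF k. ereal (H (\<alpha> 0) k (\<lambda>j. \<alpha> (Suc j)) \<omega>))"
      proof (rule INF_greatest)
        fix k
        have "(INF m. ereal (G m \<alpha> \<omega>)) \<le> ereal (G (Suc k) \<alpha> \<omega>)" by (rule INF_lower) simp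
        then show "(INF m. ereal (G m \<alpha> \<omega>)) \<le> ereal (H (\<alpha> 0) k (\<lambda>j. \<alpha> (Suc j)) \<omega>)" by (simp add: G_def)
      qed
      also have "\<dots> \<le> f (\<alpha> 0) \<omega>" unfolding H(2) by (rule SUP_upper2[of "\<lambda>j. \<alpha> (Suc j)"]) auto
      also have "\<dots> \<le> (SUP i. f i \<omega>)" by (rule SUP_upper) simp
      finally show "(INF m. ereal (G m \<alpha> \<omega>)) \<le> (SUP i. f i \<omega>)" .
    qed
  qed
  ultimately show ?thesis unfolding suslin_def by blast
qed

text \<open>Ensures that the level coded by \<open>(i, k)\<close> reads only entries with a smaller
  code, as the prefix condition demands.\<close>

lemma prod_encode_strict_mono: "j < k \<Longrightarrow> prod_encode (i, j) < prod_encode (i, k)"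
proof (induction k)
  case (Suc k)
  have "prod_encode (i, k) < prod_encode (i, Suc k)" by (simp add: prod_encode_def)
  then show ?case using Suc by (cases "j = k") auto
qed simp

text \<open>One branch encodes a branch for every \<open>i\<close> by pairing, and the level coded
  by \<open>(i, k)\<close> evaluates level \<open>k\<close> of scheme \<open>i\<close>. Choosing the
  branches independently is the complete distributivity of infima over suprema.\<close>

lemma suslin_INF:
  fixes f :: "nat \<Rightarrow> 'x cadlag_path \<Rightarrow> ereal"
  assumes "\<And>i. suslin (f i)"
  shows "suslin (\<lambda>\<omega>. INF i. f i \<omega>)"
proof -
  obtain H where H: "\<And>i. suslin_scheme (H i)" "\<And>i \<omega>. f i \<omega> = (SUP \<alpha>. INF m. ereal (H i m \<alpha> \<omega>))"
    using assms unfolding suslin_def by metis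
  define G where "G m \<alpha> = (case prod_decode m of (i, k) \<Rightarrow> H i k (\<lambda>j. \<alpha> (prod_encode (i, j))))" for m \<alpha>
  have "suslin_scheme G"
  proof (rule suslin_schemeI)
    fix m and \<alpha> \<beta> :: "nat \<Rightarrow> nat" assume eq: "\<And>i. i < m \<Longrightarrow> \<alpha> i = \<beta> i"
    obtain i k where m: "m = prod_encode (i, k)" by (metis prod_decode_inverse surj_pair)
    have "H i k (\<lambda>j. \<alpha> (prod_encode (i, j))) = H i k (\<lambda>j. \<beta> (prod_encode (i, j)))"
      using eq prod_encode_strict_mono by (intro suslin_schemeD(4)[OF H(1)]) (simp add: m)
    then show "G m \<alpha> = G m \<beta>" by (simp add: G_def m)
  qed (auto simp: G_def suslin_schemeD(1,2,3)[OF H(1)] split: prod.split)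
  moreover have "(INF i. f i \<omega>) = (SUP \<alpha>. INF m. ereal (G m \<alpha> \<omega>))" for \<omega>
  proof -
    have G_INF: "(INF m. ereal (G m \<alpha> \<omega>)) = (INF i. INF k. ereal (H i k (\<lambda>j. \<alpha> (prod_encode (i, j))) \<omega>))" for \<alpha>
    proof (rule antisym)
      show "(INF m. ereal (G m \<alpha> \<omega>)) \<le> (INF i. INF k. ereal (H i k (\<lambda>j. \<alpha> (prod_encode (i, j))) \<omega>))"
      proof (intro INF_greatest)
        fix i k
        have "(INF m. ereal (G m \<alpha> \<omega>)) \<le> ereal (G (prod_encode (i, k)) \<alpha> \<omega>)" by (rule INF_lower) simp
        then show "(INF m. ereal (G m \<alpha> \<omega>)) \<le> ereal (H i k (\<lambda>j. \<alpha> (prod_encode (i, j))) \<omega>)"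
          by (simp add: G_def)
      qed
      show "(INF i. INF k. ereal (H i k (\<lambda>j. \<alpha> (prod_encode (i, j))) \<omega>)) \<le> (INF m. ereal (G m \<alpha> \<omega>))"
      proof (rule INF_greatest)
        fix m
        obtain i k where m: "m = prod_encode (i, k)" by (metis prod_decode_inverse surj_pair)
        have "(INF i. INF k. ereal (H i k (\<lambda>j. \<alpha> (prod_encode (i, j))) \<omega>)) \<le>
            (INF k. ereal (H i k (\<lambda>j. \<alpha> (prod_encode (i, j))) \<omega>))"
          by (rule INF_lower) simp
        also have "\<dots> \<le> ereal (H i k (\<lambda>j. \<alpha> (prod_encode (i, j))) \<omega>)" by (rule INF_lower) simp
        finally show "(INF i. INF k. ereal (H i k (\<lambda>j. \<alpha> (prod_encode (i, j))) \<omega>)) \<le> ereal (G m \<alpha> \<omega>)"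
          by (simp add: G_def m)
      qed
    qed
    have "(INF i. f i \<omega>) = (SUP A. INF i. INF k. ereal (H i k (A i) \<omega>))"
      unfolding H(2) by (rule INF_SUP)
    also have "\<dots> = (SUP \<alpha>. INF m. ereal (G m \<alpha> \<omega>))"
      unfolding G_INF
    proof (rule antisym)
      show "(SUP A. INF i. INF k. ereal (H i k (A i) \<omega>)) \<le>
        (SUP \<alpha>. INF i. INF k. ereal (H i k (\<lambda>j. \<alpha> (prod_encode (i, j))) \<omega>))"
      proof (rule SUP_least)
        fix A :: "nat \<Rightarrow> nat \<Rightarrow> nat"
        show "(INF i. INF k. ereal (H i k (A i) \<omega>)) \<le>
          (SUP \<alpha>. INF i. INF k. ereal (H i k (\<lambda>j. \<alpha> (prod_encode (i, j))) \<omega>))"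
          by (rule SUP_upper2[of "\<lambda>m. case prod_decode m of (i, j) \<Rightarrow> A i j"]) auto
      qed
      show "(SUP \<alpha>. INF i. INF k. ereal (H i k (\<lambda>j. \<alpha> (prod_encode (i, j))) \<omega>)) \<le>
        (SUP A. INF i. INF k. ereal (H i k (A i) \<omega>))"
        by (rule SUP_least) (rule SUP_upper, simp)
    qed
    finally show ?thesis .
  qed
  ultimately show ?thesis unfolding suslin_def by blast
qed

lemma suslin_min:
  assumes "suslin f" "0 \<le> q" "q \<le> 1"
  shows "suslin (\<lambda>\<omega>. min (ereal q) (f \<omega>))"
proof -
  obtain H where H: "suslin_scheme H" "\<And>\<omega>. f \<omega> = (SUP \<alpha>. INF m. ereal (H m \<alpha> \<omega>))"
    using assms(1) unfolding suslin_def by blast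
  define G where "G m \<alpha> \<omega> = min q (H m \<alpha> \<omega>)" for m \<alpha> \<omega>
  have "suslin_scheme G"
  proof (rule suslin_schemeI)
    fix m and \<alpha> \<beta> :: "nat \<Rightarrow> nat" assume "\<And>i. i < m \<Longrightarrow> \<alpha> i = \<beta> i"
    then show "G m \<alpha> = G m \<beta>" using suslin_schemeD(4)[OF H(1), of m \<alpha> \<beta>] by (simp add: G_def[abs_def])
  next
    fix m \<alpha>
    show "G m \<alpha> \<in> cylinder_funs"
      unfolding G_def[abs_def] using assms(2,3) suslin_schemeD(2,3)[OF H(1)]
      by (intro cylinder_funs_combine[where h = "\<lambda>x y. min q x" and g = "H m \<alpha>"] suslin_schemeD(1)[OF H(1)] bounded_realsI[of _ 1])
         (auto simp: abs_le_iff min_def intro: order_trans[of _ 0])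
  qed (use assms(2,3) suslin_schemeD(2,3)[OF H(1)] in \<open>auto simp: G_def min_le_iff_disj\<close>)
  moreover have "min (ereal q) (f \<omega>) = (SUP \<alpha>. INF m. ereal (G m \<alpha> \<omega>))" for \<omega>
  proof -
    have G_inf: "ereal (G m \<alpha> \<omega>) = inf (ereal q) (ereal (H m \<alpha> \<omega>))" for m \<alpha>
      by (simp add: G_def inf_min min_def)
    have "(INF m. inf (ereal q) (ereal (H m \<alpha> \<omega>))) = inf (ereal q) (INF m. ereal (H m \<alpha> \<omega>))" for \<alpha>
      by (rule INF_inf_const1) simp
    then have "(SUP \<alpha>. INF m. ereal (G m \<alpha> \<omega>)) = (SUP \<alpha>. inf (ereal q) (INF m. ereal (H m \<alpha> \<omega>)))"
      by (simp only: G_inf)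
    also have "\<dots> = inf (ereal q) (f \<omega>)" unfolding H(2) by (rule inf_SUP[symmetric])
    finally show ?thesis by (simp only: inf_min)
  qed
  ultimately show ?thesis unfolding suslin_def by blast
qed

lemma suslin_measurable_set:
  assumes "A \<in> sets (path_algebra :: 'x cadlag_path measure)"
  shows "suslin (\<lambda>\<omega>. of_bool (\<omega> \<in> A)) \<and> suslin (\<lambda>\<omega>. of_bool (\<omega> \<notin> A))"
proof -
  have base: "suslin (\<lambda>\<omega> :: 'x cadlag_path. of_bool (\<omega> \<in> B))" if "B \<in> cylinder_sets" for B
  proof -
    have "ereal (of_bool b) = of_bool b" for b by (cases b) simp_all
    then show ?thesis using suslin_cylinder[OF cylinder_sets_fun[OF that]] by simp
  qed
  have eq: "of_bool (\<omega> \<in> (\<Union>i. B i)) = (SUP i. of_bool (\<omega> \<in> B i) :: ereal)"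
    "of_bool (\<omega> \<notin> (\<Union>i. B i)) = (INF i. of_bool (\<omega> \<notin> B i) :: ereal)" for B :: "nat \<Rightarrow> 'x cadlag_path set" and \<omega>
  proof -
    show "of_bool (\<omega> \<in> (\<Union>i. B i)) = (SUP i. of_bool (\<omega> \<in> B i) :: ereal)"
    proof (cases "\<omega> \<in> (\<Union>i. B i)")
      case True
      then obtain i where i: "\<omega> \<in> B i" by blast
      have "(SUP i. of_bool (\<omega> \<in> B i) :: ereal) = 1"
        by (rule antisym) (auto intro!: SUP_least SUP_upper2[of i] simp: i)
      then show ?thesis using True by simp
    qed simp
    show "of_bool (\<omega> \<notin> (\<Union>i. B i)) = (INF i. of_bool (\<omega> \<notin> B i) :: ereal)"
    proof (cases "\<omega> \<in> (\<Union>i. B i)")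
      case True
      then obtain i where i: "\<omega> \<in> B i" by blast
      have "(INF i. of_bool (\<omega> \<notin> B i) :: ereal) = 0"
        by (rule antisym) (auto intro!: INF_greatest INF_lower2[of i] simp: i)
      then show ?thesis using True by simp
    qed simp
  qed
  show ?thesis
    using assms unfolding sets_path_algebra
  proof (induction A rule: sigma_sets.induct)
    case (Basic A)
    have "UNIV - A \<in> cylinder_sets"
      using cylinder_sets_combine[OF cylinder_sets_fun[OF Basic] cylinder_sets_fun[OF Basic], of "\<lambda>x y. x = 0"]
      by (simp add: Compl_eq_Diff_UNIV[symmetric] Compl_eq)
    then show ?case using base[OF Basic] base[of "UNIV - A"] by simp
  next
    case Empty
    show ?case using suslin_cylinder[OF cylinder_funs_const[of 0]] suslin_cylinder[OF cylinder_funs_const[of 1]]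
      by (simp add: zero_ereal_def one_ereal_def)
  next
    case (Compl A)
    then show ?case by simp
  next
    case (Union B)
    then show ?case unfolding eq by (intro conjI suslin_SUP suslin_INF) auto
  qed
qed

text \<open>A layer representation: \<open>f\<close> is the supremum over rationals \<open>q\<close>
  in [0,1] of \<open>q\<close> times the indicator of \<open>f > q\<close>, where the product is
  written as a minimum.\<close>

lemma suslin_measurable:
  fixes f :: "'x cadlag_path \<Rightarrow> ereal"
  assumes f: "f \<in> borel_measurable path_algebra" and f01: "\<And>\<omega>. 0 \<le> f \<omega>" "\<And>\<omega>. f \<omega> \<le> 1"
  shows "suslin f"
proof -
  have "countable (\<rat> \<inter> {0..1 :: real})" by (rule countable_subset[OF _ countable_rat]) auto
  moreover have "0 \<in> \<rat> \<inter> {0..1 :: real}" by simp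
  then have "\<rat> \<inter> {0..1 :: real} \<noteq> {}" by blast
  ultimately obtain q :: "nat \<Rightarrow> real" where q: "range q = \<rat> \<inter> {0..1}" by (metis range_from_nat_into)
  have q01: "0 \<le> q n" "q n \<le> 1" for n using q by (auto dest!: equalityD1 simp: image_subset_iff)
  define g where "g n \<omega> = min (ereal (q n)) (of_bool (\<omega> \<in> {\<omega>. ereal (q n) < f \<omega>}))" for n \<omega>
  have "{\<omega>. ereal (q n) < f \<omega>} \<in> sets path_algebra" for n
    using borel_measurable_less[of "\<lambda>_. ereal (q n)" path_algebra f] f by simp
  then have "suslin (g n)" for n
    unfolding g_def[abs_def] using suslin_measurable_set q01 by (intro suslin_min) blast+
  then have "suslin (\<lambda>\<omega>. SUP n. g n \<omega>)" by (rule suslin_SUP)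
  moreover have "(SUP n. g n \<omega>) = f \<omega>" for \<omega>
  proof (rule antisym)
    show "(SUP n. g n \<omega>) \<le> f \<omega>"
      by (rule SUP_least) (use f01 q01 in \<open>auto simp: g_def min_le_iff_disj\<close>)
    show "f \<omega> \<le> (SUP n. g n \<omega>)"
    proof (rule dense_le)
      fix z assume z: "z < f \<omega>"
      show "z \<le> (SUP n. g n \<omega>)"
      proof (cases "z < 0")
        case True
        have "0 \<le> g 0 \<omega>" using q01 by (simp add: g_def)
        also have "\<dots> \<le> (SUP n. g n \<omega>)" by (rule SUP_upper) simp
        finally show ?thesis using True by (meson less_imp_le order_trans)
      next
        case False
        have "f \<omega> < \<infinity>" using f01(2)[of \<omega>] by (metis ereal_infty_less(1) ereal_infty_less_eq2(1) MInfty_neq_ereal PInfty_neq_ereal(1) one_ereal_def)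
        then obtain a b where ab: "z = ereal a" "f \<omega> = ereal b" using False z f01(1)[of \<omega>]
          by (cases z; cases "f \<omega>") auto
        then have "a < b" "0 \<le> a" "b \<le> 1" using z False f01(2)[of \<omega>] by auto
        obtain r where r: "r \<in> \<rat>" "a < r" "r < b" using Rats_dense_in_real[OF \<open>a < b\<close>] by blast
        then obtain n where n: "q n = r" using q \<open>0 \<le> a\<close> \<open>b \<le> 1\<close> by (metis (no_types, lifting) IntI atLeastAtMost_iff imageE less_imp_le order_trans)
        have "z \<le> g n \<omega>" using r n ab q01[of n] by (auto simp: g_def min_def)
        also have "\<dots> \<le> (SUP n. g n \<omega>)" by (rule SUP_upper) simp
        finally show ?thesis .
      qed
    qed
  qed
  ultimately show ?thesis by simp
qed

section \<open>Capacities on functions of paths\<close>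

locale path_capacity =
  fixes E :: "('x cadlag_path \<Rightarrow> ereal) \<Rightarrow> ereal"
  assumes mono: "f \<in> M_bdd_below \<Longrightarrow> g \<in> M_bdd_below \<Longrightarrow> f \<le> g \<Longrightarrow> E f \<le> E g"
    and up: "upward_continuous_on M_bdd_below E"
    and down: "downward_continuous_on fin_dim_delta_b E"
begin

text \<open>Extends \<open>E\<close> to all functions, since the restricted suprema in Choquet's
  argument may fail to be measurable. On measurable functions bounded below it agrees with
  \<open>E\<close>.\<close>

definition outer :: "('x cadlag_path \<Rightarrow> ereal) \<Rightarrow> ereal" where
  "outer f = (INF g\<in>{g \<in> M_bdd_below. f \<le> g}. E g)"

lemma outer_le: "g \<in> M_bdd_below \<Longrightarrow> f \<le> g \<Longrightarrow> outer f \<le> E g"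
  unfolding outer_def by (rule INF_lower) simp

lemma outer_measurable: "f \<in> M_bdd_below \<Longrightarrow> outer f = E f"
  unfolding outer_def by (rule antisym) (auto intro!: INF_greatest INF_lower mono)

text \<open>Measurable majorants of the \<open>f n\<close> need not increase. Their tail infima do,
  and they remain majorants because the \<open>f n\<close> increase; upward continuity then applies
  to them.\<close>

lemma outer_increasing:
  assumes inc: "incseq f" and nonneg: "\<And>n \<omega>. 0 \<le> f n \<omega>" and c: "c < outer (\<lambda>\<omega>. SUP n. f n \<omega>)"
  shows "\<exists>n. c < outer (f n)"
proof (rule ccontr)
  assume "\<not> ?thesis"
  then have le: "outer (f n) \<le> c" for n by (simp add: not_less)
  \<comment> \<open>A level strictly above \<open>c\<close> is needed to pass from an infimum that
    is at most \<open>c\<close> to an actual majorant.\<close>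
  obtain d where d: "c < d" "d < outer (\<lambda>\<omega>. SUP n. f n \<omega>)" using c dense by blast
  have "\<exists>g. g \<in> M_bdd_below \<and> f n \<le> g \<and> E g < d" for n
    using le_less_trans[OF le d(1)] unfolding outer_def INF_less_iff by blast
  then obtain g where g: "\<And>n. g n \<in> M_bdd_below" "\<And>n. f n \<le> g n" "\<And>n. E (g n) < d" by metis
  have g_meas [measurable]: "g n \<in> borel_measurable path_algebra" for n using g(1) by (auto simp: M_bdd_below_def)
  define h where "h n \<omega> = (INF k\<in>{n..}. g k \<omega>)" for n \<omega>
  have f_le: "f n \<omega> \<le> h n \<omega>" for n \<omega>
    unfolding h_def
  proof (rule INF_greatest)
    fix k assume "k \<in> {n..}"
    then have "f n \<omega> \<le> f k \<omega>" using incseqD[OF inc] by (auto simp: le_fun_def)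
    also have "\<dots> \<le> g k \<omega>" using g(2) by (simp add: le_fun_def)
    finally show "f n \<omega> \<le> g k \<omega>" .
  qed
  have h_nonneg: "0 \<le> h n \<omega>" for n \<omega> using order_trans[OF nonneg f_le] .
  have h_meas [measurable]: "h n \<in> borel_measurable path_algebra" for n
    unfolding h_def[abs_def] by measurable
  have h: "h n \<in> M_bdd_below" for n
    by (rule M_bdd_belowI[OF h_meas, of 0]) (simp add: h_nonneg zero_ereal_def[symmetric])
  have h_inc: "incseq h"
    unfolding h_def by (intro incseq_SucI le_funI INF_superset_mono) auto
  let ?s = "\<lambda>\<omega>. SUP n. h n \<omega>"
  have s: "?s \<in> M_bdd_below"
  proof (rule M_bdd_belowI[where r = 0])
    show "?s \<in> borel_measurable path_algebra" by measurable
    show "ereal 0 \<le> ?s \<omega>" for \<omega> by (rule SUP_upper2[of 0]) (simp_all add: h_nonneg zero_ereal_def[symmetric])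
  qed
  have "(\<lambda>n. h n \<omega>) \<longlonglongrightarrow> ?s \<omega>" for \<omega>
    using incseq_SucD[OF h_inc] by (intro LIMSEQ_SUP incseq_SucI) (simp add: le_fun_def)
  then have "(\<lambda>n. E (h n)) \<longlonglongrightarrow> E ?s"
    using up h s h_inc unfolding upward_continuous_on_def increases_to_def by blast
  moreover have "E (h n) \<le> d" for n
  proof -
    have "h n \<le> g n" unfolding le_fun_def h_def by (auto intro: INF_lower)
    then show ?thesis using mono[OF h g(1)] g(3)[of n] by (meson less_imp_le order_trans)
  qed
  ultimately have "E ?s \<le> d" by (intro LIMSEQ_le_const2) auto
  moreover have "(\<lambda>\<omega>. SUP n. f n \<omega>) \<le> ?s" unfolding le_fun_def using f_le by (auto intro: SUP_mono)
  ultimately show False using d(2) outer_le[OF s] by (meson not_less order_trans)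
qed

text \<open>Choquet's capacitability argument: bounding the branching of the Suslin scheme coordinate by
  coordinate turns the supremum into finite maxima, at the cost of an arbitrarily small loss in
  the outer capacity.\<close>

lemma suslin_capacitable:
  assumes "suslin f" and c: "c < outer f"
  obtains g where "g \<in> fin_dim_delta_b" "g \<le> f" "c \<le> E g"
proof -
  obtain H where H: "suslin_scheme H" and f: "\<And>\<omega>. f \<omega> = (SUP \<alpha>. INF m. ereal (H m \<alpha> \<omega>))"
    using assms(1) unfolding suslin_def by blast
  define A where "A k n = {\<alpha>. \<forall>i<k. \<alpha> i \<le> n i}" for k and n :: "nat \<Rightarrow> nat"
  define F where "F k n \<omega> = (SUP \<alpha>\<in>A k n. INF m. ereal (H m \<alpha> \<omega>))" for k n \<omega>
  \<comment> \<open>Step \<open>k\<close> bounds entry \<open>k\<close> of the branches and keeps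
    the earlier bounds. Letting the new bound grow exhausts the previous supremum, so some finite
    bound retains a value above \<open>c\<close>.\<close>
  have "\<exists>s. \<forall>k. c < outer (F k (s k)) \<and> (\<exists>j. s (Suc k) = (s k)(k := j))"
  proof (rule dependent_nat_choice)
    have "F 0 n = f" for n by (simp add: F_def[abs_def] A_def f fun_eq_iff)
    then show "\<exists>n. c < outer (F 0 n)" using c by simp
    fix n k assume *: "c < outer (F k n)"
    have inc: "A (Suc k) (n(k := i)) \<subseteq> A (Suc k) (n(k := j))" if "i \<le> j" for i j
      using that by (fastforce simp: A_def less_Suc_eq)
    have cover: "A k n = (\<Union>j. A (Suc k) (n(k := j)))"
      by (fastforce simp: A_def less_Suc_eq)
    have nonneg: "0 \<le> F (Suc k) m \<omega>" for m \<omega>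
      unfolding F_def by (rule SUP_upper2[of "\<lambda>_. 0"]) (auto simp: A_def intro!: INF_greatest suslin_schemeD(2)[OF H])
    have F_SUP: "F k n = (\<lambda>\<omega>. SUP j. F (Suc k) (n(k := j)) \<omega>)"
      unfolding F_def[abs_def] cover by (simp add: SUP_UNION)
    have "\<exists>j. c < outer (F (Suc k) (n(k := j)))"
    proof (rule outer_increasing)
      show "incseq (\<lambda>j. F (Suc k) (n(k := j)))"
        unfolding F_def by (intro incseq_SucI le_funI SUP_subset_mono inc) auto
      show "0 \<le> F (Suc k) (n(k := j)) \<omega>" for j \<omega> by (rule nonneg)
      show "c < outer (\<lambda>\<omega>. SUP j. F (Suc k) (n(k := j)) \<omega>)" using * unfolding F_SUP .
    qed
    then show "\<exists>n'. c < outer (F (Suc k) n') \<and> (\<exists>j. n' = n(k := j))" by blast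
  qed
  then obtain s where s: "\<And>k. c < outer (F k (s k))" "\<And>k. \<exists>j. s (Suc k) = (s k)(k := j)" by blast
  \<comment> \<open>The bound on entry \<open>i\<close> is chosen when passing to
    \<open>s (Suc i)\<close> and never changed afterwards, so the diagonal collects all
    bounds.\<close>
  define n where "n i = s (Suc i) i" for i
  have s_n: "s k i = n i" if "i < k" for i k
    using that
  proof (induction k)
    case (Suc k)
    obtain j where j: "s (Suc k) = (s k)(k := j)" using s(2) by blast
    show ?case
    proof (cases "i = k")
      case True
      then show ?thesis by (simp add: n_def)
    next
      case False
      then have "s (Suc k) i = s k i" using j by simp
      then show ?thesis using Suc False by simp
    qed
  qed simp
  then have "A k (s k) = A k n" for k by (simp add: A_def)
  then have F_n: "c < outer (F k n)" for k using s(1)[of k] by (simp add: F_def[abs_def])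
  \<comment> \<open>Finitely many representatives of the bounded branches: entries from
    \<open>k\<close> on are set to 0, which the levels up to \<open>k\<close> do not see.\<close>
  define B where "B k = {\<alpha>. (\<forall>i<k. \<alpha> i \<le> n i) \<and> (\<forall>i\<ge>k. \<alpha> i = 0)}" for k
  have fin: "finite (B k)" for k
  proof (rule finite_subset)
    show "B k \<subseteq> {\<alpha>. \<forall>i. (i \<in> {..<k} \<longrightarrow> \<alpha> i \<in> {..Max (n ` {..<k})}) \<and> (i \<notin> {..<k} \<longrightarrow> \<alpha> i = 0)}"
      by (auto simp: B_def intro: order_trans[OF _ Max_ge])
  qed (rule finite_set_of_finite_funs; simp)
  have ne: "B k \<noteq> {}" for k by (auto simp: B_def intro!: exI[of _ "\<lambda>_. 0"])
  define L where "L k \<alpha> \<omega> = Min ((\<lambda>m. H m \<alpha> \<omega>) ` {..k})" for k \<alpha> \<omega>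
  \<comment> \<open>A cylinder function above \<open>F k n\<close>, because every bounded branch has
    a representative in \<open>B k\<close> with the same first levels. Hence its value under
    \<open>E\<close> is at least \<open>c\<close>.\<close>
  define g where "g k \<omega> = Max ((\<lambda>\<alpha>. L k \<alpha> \<omega>) ` B k)" for k \<omega>
  have L_cyl: "L k \<alpha> \<in> cylinder_funs" for k \<alpha>
    unfolding L_def[abs_def] by (rule cylinder_funs_Min_Max(1)) (auto intro: suslin_schemeD(1)[OF H])
  have g_cyl: "g k \<in> cylinder_funs" for k
    unfolding g_def[abs_def] by (rule cylinder_funs_Min_Max(2)) (auto intro: L_cyl fin simp: ne)
  have L_le: "L k \<alpha> \<omega> \<le> H m \<alpha> \<omega>" if "m \<le> k" for k m \<alpha> \<omega>
    unfolding L_def using that by (intro Min_le) auto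
  have L01: "0 \<le> L k \<alpha> \<omega>" "L k \<alpha> \<omega> \<le> 1" for k \<alpha> \<omega>
  proof -
    show "0 \<le> L k \<alpha> \<omega>" unfolding L_def using suslin_schemeD(2)[OF H] by (subst Min_ge_iff) auto
    show "L k \<alpha> \<omega> \<le> 1" using L_le[of 0 k \<alpha> \<omega>] suslin_schemeD(3)[OF H, of 0 \<alpha> \<omega>] by simp
  qed
  have g_attained: "\<exists>\<alpha>\<in>B k. g k \<omega> = L k \<alpha> \<omega>" for k \<omega>
  proof -
    have "g k \<omega> \<in> (\<lambda>\<alpha>. L k \<alpha> \<omega>) ` B k" unfolding g_def using fin ne by (intro Max_in) auto
    then show ?thesis by blast
  qed
  have L_trunc: "\<exists>\<beta>\<in>B k. L k \<beta> = L k \<alpha>" if \<alpha>: "\<alpha> \<in> A k n" for k \<alpha>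
  proof
    let ?\<beta> = "\<lambda>i. if i < k then \<alpha> i else 0"
    show "?\<beta> \<in> B k" using \<alpha> by (auto simp: A_def B_def)
    have "H m ?\<beta> = H m \<alpha>" if "m \<le> k" for m using that by (intro suslin_schemeD(4)[OF H]) auto
    then show "L k ?\<beta> = L k \<alpha>" unfolding L_def[abs_def] by (auto intro!: arg_cong[of _ _ Min] image_cong ext)
  qed
  have L_le_g: "L k \<alpha> \<omega> \<le> g k \<omega>" if \<alpha>: "\<alpha> \<in> A k n" for k \<alpha> \<omega>
  proof -
    obtain \<beta> where \<beta>: "\<beta> \<in> B k" "L k \<beta> = L k \<alpha>" using L_trunc[OF \<alpha>] by blast
    have "L k \<beta> \<omega> \<le> g k \<omega>" unfolding g_def using \<beta>(1) fin by (intro Max_ge) auto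
    then show ?thesis using \<beta>(2) by simp
  qed
  have B_A: "B k \<subseteq> A j n" if "j \<le> k" for j k using that by (auto simp: A_def B_def)
  have g_dec: "decseq g"
  proof (intro decseq_SucI le_funI)
    fix k \<omega>
    obtain \<alpha> where \<alpha>: "\<alpha> \<in> B (Suc k)" "g (Suc k) \<omega> = L (Suc k) \<alpha> \<omega>" using g_attained by blast
    have "L (Suc k) \<alpha> \<omega> \<le> L k \<alpha> \<omega>" unfolding L_def by (intro Min_antimono) auto
    also have "\<dots> \<le> g k \<omega>" using B_A[of k "Suc k"] \<alpha>(1) by (intro L_le_g) auto
    finally show "g (Suc k) \<omega> \<le> g k \<omega>" using \<alpha>(2) by simp
  qed
  have g01: "0 \<le> g k \<omega>" "g k \<omega> \<le> 1" for k \<omega> using g_attained[of k \<omega>] L01 by auto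
  have E_g: "c \<le> E (\<lambda>\<omega>. ereal (g k \<omega>))" for k
  proof -
    have "F k n \<le> (\<lambda>\<omega>. ereal (g k \<omega>))"
      unfolding le_fun_def F_def
    proof (intro allI SUP_least)
      fix \<omega> \<alpha> assume \<alpha>: "\<alpha> \<in> A k n"
      have "L k \<alpha> \<omega> \<in> (\<lambda>m. H m \<alpha> \<omega>) ` {..k}" unfolding L_def by (rule Min_in) auto
      then obtain m where "L k \<alpha> \<omega> = H m \<alpha> \<omega>" by auto
      then have "(INF m. ereal (H m \<alpha> \<omega>)) \<le> ereal (L k \<alpha> \<omega>)" by (auto intro: INF_lower)
      also have "\<dots> \<le> ereal (g k \<omega>)" using L_le_g[OF \<alpha>] by simp
      finally show "(INF m. ereal (H m \<alpha> \<omega>)) \<le> ereal (g k \<omega>)" .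
    qed
    then show ?thesis
      using outer_le[OF cylinder_funs_M_bdd_below[OF g_cyl]] F_n[of k] by (meson less_imp_le order_trans)
  qed
  define G where "G \<omega> = (INF k. ereal (g k \<omega>))" for \<omega>
  have G_lim: "(\<lambda>k. ereal (g k \<omega>)) \<longlonglongrightarrow> G \<omega>" for \<omega>
    unfolding G_def using decseq_SucD[OF g_dec] by (intro LIMSEQ_INF decseq_SucI) (simp add: le_fun_def)
  have G01: "0 \<le> G \<omega>" "G \<omega> \<le> 1" for \<omega>
    unfolding G_def using g01 by (auto intro!: INF_greatest INF_lower2[of 0] simp: one_ereal_def)
  have dec_to: "decreases_to (\<lambda>k \<omega>. ereal (g k \<omega>)) G"
  proof -
    have "decseq (\<lambda>k \<omega>. ereal (g k \<omega>))"
      using decseq_SucD[OF g_dec] by (intro decseq_SucI le_funI) (simp add: le_fun_def)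
    then show ?thesis using G_lim by (simp add: decreases_to_def)
  qed
  have G_bd: "G \<in> bounded_funs UNIV"
    unfolding bounded_funs_def using G01 by (intro CollectI exI[of _ 1]) (auto simp: one_ereal_def[symmetric])
  have G: "G \<in> fin_dim_delta_b"
    unfolding fin_dim_delta_b_def
    by (intro CollectI conjI exI[of _ "\<lambda>k \<omega>. ereal (g k \<omega>)"] allI G_bd dec_to fin_dim_funs_cylinder g_cyl)
  have g_delta: "(\<lambda>\<omega>. ereal (g k \<omega>)) \<in> fin_dim_delta_b" for k
    unfolding fin_dim_delta_b_def
    using bounded_funs_ereal[OF cylinder_funs_bounded[OF g_cyl]] fin_dim_funs_cylinder[OF g_cyl]
    by (intro CollectI conjI exI[of _ "\<lambda>_ \<omega>. ereal (g k \<omega>)"]) (auto simp: decreases_to_def decseq_def)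
  have "(\<lambda>k. E (\<lambda>\<omega>. ereal (g k \<omega>))) \<longlonglongrightarrow> E G"
    by (rule downward_continuous_onD[OF down g_delta G dec_to])
  then have "c \<le> E G" by (rule LIMSEQ_le_const) (use E_g in blast)
  moreover have "G \<le> f"
    unfolding le_fun_def
  proof
    fix \<omega>
    have "\<exists>\<alpha>. \<alpha> \<in> B k \<and> g k \<omega> = L k \<alpha> \<omega>" for k using g_attained by blast
    then obtain \<alpha> where \<alpha>: "\<And>k. \<alpha> k \<in> B k" "\<And>k. g k \<omega> = L k (\<alpha> k) \<omega>" by metis
    \<comment> \<open>At \<open>i = m\<close> the entry is 0 by truncation, so the bound holds there
      too.\<close>
    have "\<alpha> m i \<in> {..n i}" if "i \<le> m" for i m using \<alpha>(1)[of m] that by (auto simp: B_def le_less)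
    then obtain y where y: "\<And>j. infinite {m. \<forall>i<j. \<alpha> m i = y i}"
      using infinitely_often_agreeing[of "\<lambda>i. {..n i}" \<alpha>] by auto
    have "G \<omega> \<le> ereal (H m y \<omega>)" for m
    proof -
      \<comment> \<open>The maximising branches have a limit branch \<open>y\<close>. Level
        \<open>m\<close> sees only a prefix of \<open>y\<close>, which is shared with the maximiser
        of some \<open>g k\<close> with \<open>k >= m\<close>.\<close>
      obtain k where k: "k \<ge> m" "\<forall>i<m. \<alpha> k i = y i"
        using y[of m] unfolding infinite_nat_iff_unbounded_le by blast
      have "G \<omega> \<le> ereal (g k \<omega>)" unfolding G_def by (rule INF_lower) simp
      also have "\<dots> \<le> ereal (H m (\<alpha> k) \<omega>)" using L_le[OF k(1)] \<alpha>(2) by simp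
      also have "H m (\<alpha> k) = H m y" using k(2) by (intro suslin_schemeD(4)[OF H]) simp
      finally show ?thesis .
    qed
    then have "G \<omega> \<le> (INF m. ereal (H m y \<omega>))" by (rule INF_greatest)
    also have "\<dots> \<le> f \<omega>" unfolding f by (rule SUP_upper) simp
    finally show "G \<omega> \<le> f \<omega>" .
  qed
  ultimately show ?thesis using that G by blast
qed

end

section \<open>Rescaling and approximation from below for functions bounded below\<close>

lemma decreases_to_affine:
  assumes "decreases_to F u" "0 \<le> a" "u \<in> bounded_funs UNIV"
  shows "decreases_to (\<lambda>n \<omega>. ereal b + ereal a * F n \<omega>) (\<lambda>\<omega>. ereal b + ereal a * u \<omega>)"
proof -
  have "decseq (\<lambda>n \<omega>. ereal b + ereal a * F n \<omega>)"
    using assms(1,2) decseq_SucD[of F] unfolding decreases_to_def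
    by (intro decseq_SucI le_funI add_left_mono ereal_mult_left_mono) (auto simp: le_fun_def)
  moreover have "(\<lambda>n. ereal b + ereal a * F n \<omega>) \<longlonglongrightarrow> ereal b + ereal a * u \<omega>" for \<omega>
    using assms(1) unfolding decreases_to_def
    by (intro tendsto_add_ereal_general2 tendsto_const tendsto_cmult_ereal) auto
  ultimately show ?thesis by (simp add: decreases_to_def)
qed

lemma increases_to_affine:
  assumes "increases_to F u" "0 \<le> a"
  shows "increases_to (\<lambda>n \<omega>. ereal b + ereal a * F n \<omega>) (\<lambda>\<omega>. ereal b + ereal a * u \<omega>)"
proof -
  have "incseq (\<lambda>n \<omega>. ereal b + ereal a * F n \<omega>)"
    using assms incseq_SucD[of F] unfolding increases_to_def
    by (intro incseq_SucI le_funI add_left_mono ereal_mult_left_mono) (auto simp: le_fun_def)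
  moreover have "(\<lambda>n. ereal b + ereal a * F n \<omega>) \<longlonglongrightarrow> ereal b + ereal a * u \<omega>" for \<omega>
    using assms(1) unfolding increases_to_def
    by (intro tendsto_add_ereal_general2 tendsto_const tendsto_cmult_ereal) auto
  ultimately show ?thesis by (simp add: increases_to_def)
qed

lemma M_bdd_below_affine:
  assumes "u \<in> M_bdd_below" "0 \<le> a"
  shows "(\<lambda>\<omega>. ereal b + ereal a * u \<omega>) \<in> M_bdd_below"
proof -
  obtain r where r: "\<And>\<omega>. ereal r \<le> u \<omega>" using assms(1) by (rule M_bdd_below_lower_bound) blast
  have [measurable]: "u \<in> borel_measurable path_algebra" using assms(1) by (simp add: M_bdd_below_def)
  have "ereal (b + a * r) \<le> ereal b + ereal a * u \<omega>" for \<omega>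
  proof -
    have "ereal a * ereal r \<le> ereal a * u \<omega>" using assms(2) r by (intro ereal_mult_left_mono) auto
    then have "ereal b + ereal a * ereal r \<le> ereal b + ereal a * u \<omega>" by (rule add_left_mono)
    then show ?thesis by simp
  qed
  then show ?thesis by (rule M_bdd_belowI[rotated]) measurable
qed

lemma fin_dim_delta_b_affine:
  assumes "u \<in> fin_dim_delta_b" "0 \<le> a"
  shows "(\<lambda>\<omega>. ereal b + ereal a * u \<omega>) \<in> fin_dim_delta_b"
proof -
  obtain h where h: "\<And>n. h n \<in> cylinder_funs" "decreases_to (\<lambda>n \<omega>. ereal (h n \<omega>)) u"
    using assms(1) by (rule fin_dim_delta_b_cylinder) blast
  have u: "u \<in> bounded_funs UNIV" using assms(1) by (simp add: fin_dim_delta_b_def)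
  have "(\<lambda>\<omega>. ereal (b + a * h n \<omega>)) \<in> fin_dim_funs" for n
    by (intro fin_dim_funs_cylinder function_space_add[OF function_space_cylinder_funs]
        function_space_scale[OF function_space_cylinder_funs] cylinder_funs_const h)
  then have "(\<lambda>\<omega>. ereal b + ereal a * ereal (h n \<omega>)) \<in> fin_dim_funs" for n by simp
  moreover have "(\<lambda>\<omega>. ereal b + ereal a * u \<omega>) \<in> bounded_funs UNIV"
  proof -
    obtain v where v: "v \<in> bounded_reals" "u = (\<lambda>\<omega>. ereal (v \<omega>))" using u by (rule bounded_funs_UNIV_E)
    have "(\<lambda>\<omega>. b + a * v \<omega>) \<in> bounded_reals"
      by (intro function_space_add[OF function_space_bounded_reals] function_space_const[OF function_space_bounded_reals]
          function_space_scale[OF function_space_bounded_reals] v)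
    then show ?thesis using bounded_funs_ereal by (fastforce simp: v(2))
  qed
  ultimately show ?thesis
    unfolding fin_dim_delta_b_def using decreases_to_affine[OF h(2) assms(2) u, of b]
    by (intro CollectI conjI exI[of _ "\<lambda>n \<omega>. ereal b + ereal a * ereal (h n \<omega>)"]) auto
qed

lemma fin_dim_delta_b_M_bdd_below:
  assumes "f \<in> fin_dim_delta_b"
  shows "f \<in> M_bdd_below"
proof -
  obtain h where h: "\<And>n. h n \<in> cylinder_funs" "decreases_to (\<lambda>n \<omega>. ereal (h n \<omega>)) f"
    using assms by (rule fin_dim_delta_b_cylinder) blast
  have meas: "(\<lambda>\<omega>. ereal (h n \<omega>)) \<in> borel_measurable path_algebra" for n
    using cylinder_funs_measurable[OF refl h(1)] by measurable
  have "f = (\<lambda>\<omega>. INF n. ereal (h n \<omega>))"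
  proof
    fix \<omega>
    have "decseq (\<lambda>n. ereal (h n \<omega>))"
      using decseq_SucD[OF conjunct1[OF h(2)[unfolded decreases_to_def]]]
      by (intro decseq_SucI) (simp add: le_fun_def)
    then have "(\<lambda>n. ereal (h n \<omega>)) \<longlonglongrightarrow> (INF n. ereal (h n \<omega>))" by (rule LIMSEQ_INF)
    then show "f \<omega> = (INF n. ereal (h n \<omega>))"
      using h(2) LIMSEQ_unique unfolding decreases_to_def by blast
  qed
  moreover have "(\<lambda>\<omega>. INF n. ereal (h n \<omega>)) \<in> borel_measurable path_algebra"
    using meas by measurable
  ultimately have "f \<in> borel_measurable path_algebra" by simp
  moreover obtain c where c: "\<And>\<omega>. \<bar>f \<omega>\<bar> \<le> ereal c"
    using assms by (auto simp: fin_dim_delta_b_def bounded_funs_def)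
  have "ereal (- c) \<le> f \<omega>" for \<omega>
    using c[of \<omega>] by (cases "f \<omega>") auto
  ultimately show ?thesis by (rule M_bdd_belowI)
qed

context path_capacity
begin

text \<open>Suslin functions take values in [0,1]. Composing the capacity with an affine map brings
  other bounded functions into this range, using only monotonicity and continuity of
  \<open>E\<close>.\<close>

lemma path_capacity_affine:
  assumes "0 \<le> a"
  shows "path_capacity (\<lambda>u. E (\<lambda>\<omega>. ereal b + ereal a * u \<omega>))"
proof
  fix f g :: "'x cadlag_path \<Rightarrow> ereal" assume fg: "f \<in> M_bdd_below" "g \<in> M_bdd_below" "f \<le> g"
  then show "E (\<lambda>\<omega>. ereal b + ereal a * f \<omega>) \<le> E (\<lambda>\<omega>. ereal b + ereal a * g \<omega>)"
    using assms by (intro mono M_bdd_below_affine le_funI add_left_mono ereal_mult_left_mono) (auto simp: le_fun_def)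
next
  show "upward_continuous_on M_bdd_below (\<lambda>u. E (\<lambda>\<omega>. ereal b + ereal a * u \<omega>))"
    unfolding upward_continuous_on_def
  proof (intro allI impI, elim conjE)
    fix F and f :: "'x cadlag_path \<Rightarrow> ereal"
    assume F: "\<forall>n. F n \<in> M_bdd_below" "f \<in> M_bdd_below" "increases_to F f"
    show "(\<lambda>n. E (\<lambda>\<omega>. ereal b + ereal a * F n \<omega>)) \<longlonglongrightarrow> E (\<lambda>\<omega>. ereal b + ereal a * f \<omega>)"
      using F(1) by (intro upward_continuous_onD[OF up] M_bdd_below_affine assms F increases_to_affine) auto
  qed
  show "downward_continuous_on fin_dim_delta_b (\<lambda>u. E (\<lambda>\<omega>. ereal b + ereal a * u \<omega>))"
    unfolding downward_continuous_on_def
  proof (intro allI impI, elim conjE)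
    fix F and f :: "'x cadlag_path \<Rightarrow> ereal"
    assume F: "\<forall>n. F n \<in> fin_dim_delta_b" "f \<in> fin_dim_delta_b" "decreases_to F f"
    then have "f \<in> bounded_funs UNIV" by (simp add: fin_dim_delta_b_def)
    then show "(\<lambda>n. E (\<lambda>\<omega>. ereal b + ereal a * F n \<omega>)) \<longlonglongrightarrow> E (\<lambda>\<omega>. ereal b + ereal a * f \<omega>)"
      using F(1)
      by (intro downward_continuous_onD[OF down] fin_dim_delta_b_affine assms F decreases_to_affine) auto
  qed
qed

lemma capacitable_bounded:
  assumes f: "f \<in> borel_measurable path_algebra" and bd: "\<And>\<omega>. ereal r \<le> f \<omega>" "\<And>\<omega>. f \<omega> \<le> ereal s"
    and c: "c < E f"
  obtains g where "g \<in> fin_dim_delta_b" "g \<le> f" "c \<le> E g"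
proof -
  \<comment> \<open>At least 1, so that division is possible even when \<open>r = s\<close>.\<close>
  define a where "a = max 1 (s - r)"
  have a: "a > 0" "s - r \<le> a" by (auto simp: a_def)
  define u where "u \<omega> = ereal (1 / a) * (f \<omega> + ereal (- r))" for \<omega>
  have f_real: "\<exists>t. f \<omega> = ereal t" for \<omega> using bd(1)[of \<omega>] bd(2)[of \<omega>] by (cases "f \<omega>") auto
  have u01: "0 \<le> u \<omega>" "u \<omega> \<le> 1" for \<omega>
  proof -
    obtain t where t: "f \<omega> = ereal t" using f_real by blast
    then have "r \<le> t" "t \<le> s" using bd(1)[of \<omega>] bd(2)[of \<omega>] by auto
    then show "0 \<le> u \<omega>" "u \<omega> \<le> 1" using a by (auto simp: u_def t field_simps one_ereal_def)
  qed
  have f_u: "ereal r + ereal a * u \<omega> = f \<omega>" for \<omega>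
  proof -
    obtain t where t: "f \<omega> = ereal t" using f_real by blast
    show ?thesis using a by (simp add: u_def t)
  qed
  have u: "u \<in> borel_measurable path_algebra" unfolding u_def[abs_def] using f by measurable
  interpret C: path_capacity "\<lambda>u. E (\<lambda>\<omega>. ereal r + ereal a * u \<omega>)"
    by (rule path_capacity_affine) (use a in simp)
  have "u \<in> M_bdd_below" by (rule M_bdd_belowI[OF u, of 0]) (simp add: u01 zero_ereal_def[symmetric])
  then have "c < C.outer u"
    using c by (simp only: C.outer_measurable f_u)
  then obtain g where g: "g \<in> fin_dim_delta_b" "g \<le> u" "c \<le> E (\<lambda>\<omega>. ereal r + ereal a * g \<omega>)"
    by (rule C.suslin_capacitable[OF suslin_measurable[OF u u01]])
  have "ereal r + ereal a * g \<omega> \<le> f \<omega>" for \<omega>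
  proof -
    have "ereal r + ereal a * g \<omega> \<le> ereal r + ereal a * u \<omega>"
      using g(2) a by (intro add_left_mono ereal_mult_left_mono) (auto simp: le_fun_def)
    then show ?thesis by (simp only: f_u)
  qed
  then show ?thesis
    using that[OF fin_dim_delta_b_affine[OF g(1), of a r]] g(3) a by (simp add: le_fun_def)
qed

text \<open>Truncation from above reduces to bounded functions; upward continuity guarantees that
  some truncation already exceeds \<open>c\<close>.\<close>

lemma capacitable:
  assumes f: "f \<in> M_bdd_below" and c: "c < E f"
  obtains g where "g \<in> fin_dim_delta_b" "g \<le> f" "c \<le> E g"
proof -
  obtain r where r: "\<And>\<omega>. ereal r \<le> f \<omega>" using f by (rule M_bdd_below_lower_bound) blast
  have [measurable]: "f \<in> borel_measurable path_algebra" using f by (simp add: M_bdd_below_def)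
  \<comment> \<open>The cut is at \<open>r + n\<close>, never below the lower bound \<open>r\<close>
    of \<open>f\<close>, so that \<open>r\<close> bounds the truncations as well.\<close>
  define F where "F n \<omega> = min (f \<omega>) (ereal (r + real n))" for n \<omega>
  have F_meas: "F n \<in> borel_measurable path_algebra" for n unfolding F_def[abs_def] by measurable
  have F_low: "ereal r \<le> F n \<omega>" for n \<omega> using r by (simp add: F_def)
  have F: "F n \<in> M_bdd_below" for n by (rule M_bdd_belowI[OF F_meas F_low])
  have "(\<lambda>n. F n \<omega>) \<longlonglongrightarrow> f \<omega>" for \<omega>
  proof (cases "f \<omega>")
    case (real t)
    obtain N where N: "t - r \<le> real N" using real_arch_simple by blast
    have "F n \<omega> = f \<omega>" if "n \<ge> N" for n using N that real by (auto simp: F_def min_def)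
    then show ?thesis by (intro tendsto_eventually eventually_sequentiallyI)
  next
    case PInf
    have "(\<lambda>n. ereal (r + real n)) \<longlonglongrightarrow> \<infinity>"
      unfolding tendsto_PInfty_eq_at_top
      by (rule filterlim_tendsto_add_at_top[OF tendsto_const filterlim_real_sequentially])
    then show ?thesis using PInf by (simp add: F_def)
  next
    case MInf
    then show ?thesis using r[of \<omega>] by simp
  qed
  moreover have "incseq F" by (intro incseq_SucI le_funI) (auto simp: F_def min_le_iff_disj)
  ultimately have "increases_to F f" by (simp add: increases_to_def)
  then have "(\<lambda>n. E (F n)) \<longlonglongrightarrow> E f" by (rule upward_continuous_onD[OF up F f])
  then have "\<forall>\<^sub>F n in sequentially. c < E (F n)" by (rule order_tendstoD(1)) (rule c)
  then obtain n where n: "c < E (F n)" by (auto dest: eventually_happens)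
  obtain g where g: "g \<in> fin_dim_delta_b" "g \<le> F n" "c \<le> E g"
    by (rule capacitable_bounded[OF F_meas F_low _ n, of "r + real n"]) (auto simp: F_def)
  moreover have "F n \<le> f" by (simp add: le_fun_def F_def)
  ultimately show ?thesis using that order_trans by blast
qed

end

text \<open>Downward continuity extends the agreement to decreasing limits of cylinder functions. A
  limit \<open>g <= f\<close> that nearly attains one capacity at \<open>f\<close> has the same
  value under the other, so each capacity is bounded by the other.\<close>

lemma path_capacity_eqI:
  fixes E E' :: "('x cadlag_path \<Rightarrow> ereal) \<Rightarrow> ereal"
  assumes E: "path_capacity E" and E': "path_capacity E'"
    and eq: "\<And>f. f \<in> cylinder_funs \<Longrightarrow> E (\<lambda>\<omega>. ereal (f \<omega>)) = E' (\<lambda>\<omega>. ereal (f \<omega>))"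
    and f: "f \<in> M_bdd_below"
  shows "E f = E' f"
proof -
  have delta: "E g = E' g" if g: "g \<in> fin_dim_delta_b" for g
  proof -
    obtain h where h: "\<And>n. h n \<in> cylinder_funs" "decreases_to (\<lambda>n \<omega>. ereal (h n \<omega>)) g"
      using g by (rule fin_dim_delta_b_cylinder) blast
    have hd: "(\<lambda>\<omega>. ereal (h n \<omega>)) \<in> fin_dim_delta_b" for n
      unfolding fin_dim_delta_b_def
      using bounded_funs_ereal[OF cylinder_funs_bounded[OF h(1)]] fin_dim_funs_cylinder[OF h(1)]
      by (intro CollectI conjI exI[of _ "\<lambda>_ \<omega>. ereal (h n \<omega>)"]) (auto simp: decreases_to_def decseq_def)
    have "(\<lambda>n. E (\<lambda>\<omega>. ereal (h n \<omega>))) \<longlonglongrightarrow> E g" "(\<lambda>n. E' (\<lambda>\<omega>. ereal (h n \<omega>))) \<longlonglongrightarrow> E' g"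
      by (rule downward_continuous_onD[OF path_capacity.down[OF E] hd g h(2)],
          rule downward_continuous_onD[OF path_capacity.down[OF E'] hd g h(2)])
    then show ?thesis unfolding eq[OF h(1)] by (rule LIMSEQ_unique)
  qed
  have le: "E1 f \<le> E2 f" if E1: "path_capacity E1" and E2: "path_capacity E2"
    and d: "\<And>g. g \<in> fin_dim_delta_b \<Longrightarrow> E1 g = E2 g" for E1 E2 :: "('x cadlag_path \<Rightarrow> ereal) \<Rightarrow> ereal"
  proof (rule dense_le)
    fix c assume "c < E1 f"
    then obtain g where g: "g \<in> fin_dim_delta_b" "g \<le> f" "c \<le> E1 g"
      by (rule path_capacity.capacitable[OF E1 f])
    have "E2 g \<le> E2 f" by (rule path_capacity.mono[OF E2 fin_dim_delta_b_M_bdd_below[OF g(1)] f g(2)])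
    then show "c \<le> E2 f" using g(3) d[OF g(1)] by simp
  qed
  show ?thesis using le[OF E E'] le[OF E' E] delta by (intro antisym) auto
qed

section \<open>Existence and uniqueness\<close>

context real_markov_process
begin

text \<open>The transition property removes the last time, so the induction runs from the end of the
  list down to a single time, where the initial expectation takes over.\<close>

lemma expectation_determined_list:
  fixes E :: "('x cadlag_path \<Rightarrow> ereal) \<Rightarrow> ereal"
  assumes init: "\<And>h. h \<in> bounded_reals \<Longrightarrow> E (\<lambda>\<omega>. ereal (h (coord 0 \<omega>))) = ereal (e0 h)"
    and trans: "\<And>ts t h c. ts \<noteq> [] \<Longrightarrow> set (ts @ [t]) \<subseteq> {0..} \<Longrightarrow> sorted_wrt (<) (ts @ [t]) \<Longrightarrow>
      (\<And>xs. \<bar>h xs\<bar> \<le> c) \<Longrightarrow>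
      E (\<lambda>\<omega>. ereal (h (map (\<lambda>s. coord s \<omega>) (ts @ [t])))) =
      E (\<lambda>\<omega>. ereal (T (t - last ts) (\<lambda>y. h (map (\<lambda>s. coord s \<omega>) ts @ [y])) (coord (last ts) \<omega>)))"
    and ts: "ts \<noteq> []" "set ts \<subseteq> {0..}" "sorted_wrt (<) ts" and h: "\<And>xs. \<bar>h xs\<bar> \<le> c"
  shows "E (\<lambda>\<omega>. ereal (h (map (\<lambda>s. coord s \<omega>) ts))) = ereal (cylinder_exp (\<lambda>\<omega>. h (map (\<lambda>s. coord s \<omega>) ts)))"
  using ts h
proof (induction ts arbitrary: h rule: rev_induct)
  case (snoc t ts)
  show ?case
  proof (cases "ts = []")
    case True
    have t: "t \<ge> 0" using snoc.prems by simp
    have h1: "(\<lambda>x. h [x]) \<in> bounded_reals" by (rule bounded_realsI[of _ c]) (rule snoc.prems)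
    have E: "E (\<lambda>\<omega>. ereal (h [coord t \<omega>])) = ereal (e0 (T t (\<lambda>x. h [x])))"
    proof (cases "t = 0")
      case True
      then show ?thesis using init[OF h1] T_zero[OF h1] by simp
    next
      case False
      \<comment> \<open>A single positive time has no predecessor to start a transition from; time 0
        is put in front, and \<open>tl\<close> hides its state from \<open>h\<close>.\<close>
      have "E (\<lambda>\<omega>. ereal (h [coord t \<omega>])) = E (\<lambda>\<omega>. ereal (h (tl (map (\<lambda>s. coord s \<omega>) ([0] @ [t])))))" by simp
      also have "\<dots> = E (\<lambda>\<omega>. ereal (T (t - last [0]) (\<lambda>y. h (tl (map (\<lambda>s. coord s \<omega>) [0] @ [y]))) (coord (last [0]) \<omega>)))"
        by (rule trans[where c = c and h = "\<lambda>xs. h (tl xs)"]) (use t False snoc.prems(4) in auto)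
      also have "\<dots> = E (\<lambda>\<omega>. ereal (T t (\<lambda>x. h [x]) (coord 0 \<omega>)))" by simp
      also have "\<dots> = ereal (e0 (T t (\<lambda>x. h [x])))"
        by (rule init) (rule real_upper_expectation_family_bounded[OF T[OF t] h1])
      finally show ?thesis .
    qed
    then show ?thesis using cylinder_exp_single(2)[OF t h1] True by simp
  next
    case False
    define g where "g xs = T (t - last ts) (\<lambda>y. h (xs @ [y])) (last xs)" for xs
    have last: "0 \<le> t - last ts"
      using snoc.prems(3) last_in_set[OF False] by (auto simp: sorted_wrt_append less_imp_le)
    have g: "\<bar>g xs\<bar> \<le> c" for xs
      unfolding g_def by (intro real_upper_expectation_bound[OF T[OF last]] bounded_realsI[of _ c] snoc.prems)
    have g_eq: "T (t - last ts) (\<lambda>y. h (map (\<lambda>s. coord s \<omega>) ts @ [y])) (coord (last ts) \<omega>) = g (map (\<lambda>s. coord s \<omega>) ts)" for \<omega>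
      using False by (simp add: g_def last_map)
    have "E (\<lambda>\<omega>. ereal (h (map (\<lambda>s. coord s \<omega>) (ts @ [t])))) = E (\<lambda>\<omega>. ereal (g (map (\<lambda>s. coord s \<omega>) ts)))"
      using trans[where h = h and c = c, OF False snoc.prems(2,3,4)] unfolding g_eq .
    also have "\<dots> = ereal (cylinder_exp (\<lambda>\<omega>. g (map (\<lambda>s. coord s \<omega>) ts)))"
      using snoc.prems False g by (intro snoc.IH) (auto simp: sorted_wrt_append)
    also have "cylinder_exp (\<lambda>\<omega>. g (map (\<lambda>s. coord s \<omega>) ts)) = cylinder_exp (\<lambda>\<omega>. h (map (\<lambda>s. coord s \<omega>) (ts @ [t])))"
      using cylinder_exp_transition[where h = h and c = c, OF False snoc.prems(3,2,4)] unfolding g_eq by simp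
    finally show ?thesis .
  qed
qed simp

lemma expectation_determined:
  fixes E :: "('x cadlag_path \<Rightarrow> ereal) \<Rightarrow> ereal"
  assumes init: "\<And>h. h \<in> bounded_reals \<Longrightarrow> E (\<lambda>\<omega>. ereal (h (coord 0 \<omega>))) = ereal (e0 h)"
    and trans: "\<And>ts t h c. ts \<noteq> [] \<Longrightarrow> set (ts @ [t]) \<subseteq> {0..} \<Longrightarrow> sorted_wrt (<) (ts @ [t]) \<Longrightarrow>
      (\<And>xs. \<bar>h xs\<bar> \<le> c) \<Longrightarrow>
      E (\<lambda>\<omega>. ereal (h (map (\<lambda>s. coord s \<omega>) (ts @ [t])))) =
      E (\<lambda>\<omega>. ereal (T (t - last ts) (\<lambda>y. h (map (\<lambda>s. coord s \<omega>) ts @ [y])) (coord (last ts) \<omega>)))"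
    and f: "f \<in> cylinder_funs"
  shows "E (\<lambda>\<omega>. ereal (f \<omega>)) = ereal (cylinder_exp f)"
proof -
  obtain U where U: "f \<in> bounded_reals" "finite U" "U \<subseteq> {0..}" "supported_on U f"
    using f by (rule cylinder_funsE)
  obtain c where c: "\<And>\<omega>. \<bar>f \<omega>\<bar> \<le> c" using U(1) by (metis bounded_realsE)
  \<comment> \<open>Adding time 0 makes the list non-empty even for constants.\<close>
  define ts where "ts = sorted_list_of_set (insert 0 U)"
  have ts: "set ts = insert 0 U" "sorted_wrt (<) ts"
  proof -
    have fin: "finite (insert 0 U)" using U(2) by simp
    show "set ts = insert 0 U" unfolding ts_def by (rule set_sorted_list_of_set[OF fin])
    show "sorted_wrt (<) ts" unfolding ts_def by (rule strict_sorted_list_of_set)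
  qed
  \<comment> \<open>The value at any list is a value of \<open>f\<close>, so \<open>h\<close> is
    bounded by \<open>c\<close> on all lists, as the transition hypothesis requires.\<close>
  define h where "h xs = f (SOME \<omega>. map (\<lambda>s. coord s \<omega>) ts = xs)" for xs
  have f_h: "f \<omega> = h (map (\<lambda>s. coord s \<omega>) ts)" for \<omega>
  proof -
    let ?\<omega> = "SOME \<omega>'. map (\<lambda>s. coord s \<omega>') ts = map (\<lambda>s. coord s \<omega>) ts"
    have "map (\<lambda>s. coord s ?\<omega>) ts = map (\<lambda>s. coord s \<omega>) ts"
      by (rule someI[of "\<lambda>\<omega>'. map (\<lambda>s. coord s \<omega>') ts = map (\<lambda>s. coord s \<omega>) ts" \<omega>]) simp
    then have "\<forall>s\<in>U. coord s ?\<omega> = coord s \<omega>" using ts(1) by (simp add: map_eq_conv)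
    then have "f ?\<omega> = f \<omega>" using U(4) unfolding supported_on_def by blast
    then show ?thesis by (simp add: h_def)
  qed
  have "ts \<noteq> []" "set ts \<subseteq> {0..}" using ts U(3) by auto
  then have "E (\<lambda>\<omega>. ereal (h (map (\<lambda>s. coord s \<omega>) ts))) = ereal (cylinder_exp (\<lambda>\<omega>. h (map (\<lambda>s. coord s \<omega>) ts)))"
    by (intro expectation_determined_list[where c = c] init trans ts(2)) (auto simp: h_def c)
  then show ?thesis by (simp only: f_h[symmetric])
qed

end

text \<open>Translates the hypotheses into real-valued form. The point with content is the rate: a
  finite upper limit at zero has to become one linear bound for all times and states.\<close>

lemma real_version_markov_process:
  fixes E0 :: "('x::countable \<Rightarrow> ereal) \<Rightarrow> ereal"
  assumes E0: "upper_expectation (bounded_funs UNIV) E0" "downward_continuous_on (bounded_funs UNIV) E0"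
    and T: "sublinear_markov_semigroup T" and rate: "uniformly_bounded_rate T"
  obtains r where "real_markov_process (real_version E0) (\<lambda>t f x. real_version (\<lambda>g. T t g x) f) r"
proof -
  let ?T = "\<lambda>t f x. real_version (\<lambda>g. T t g x) f"
  have E0s: "sublinear_expectation (bounded_funs UNIV) E0" using E0(1) by (simp add: upper_expectation_def)
  have Ts: "sublinear_expectation (bounded_funs UNIV) (\<lambda>g. T t g x)" if "t \<ge> 0" for t x
    using T that by (auto simp: sublinear_markov_semigroup_def upper_transition_semigroup_def
        upper_transition_operator_def upper_expectation_def)
  have e0: "real_upper_expectation bounded_reals (real_version E0)"
    by (rule real_upper_expectation_real_version[OF E0s bounded_funs_ereal function_space_bounded_reals subset_refl])
  have Tr: "real_upper_expectation bounded_reals (\<lambda>f. ?T t f x)" if "t \<ge> 0" for t x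
    using real_upper_expectation_real_version[OF Ts[OF that] bounded_funs_ereal function_space_bounded_reals subset_refl] by simp
  have E0_eq: "E0 (\<lambda>x. ereal (f x)) = ereal (real_version E0 f)" if "f \<in> bounded_reals" for f
    by (rule ereal_real_version[OF E0s that bounded_funs_ereal[OF that]])
  have T_eq: "T t (\<lambda>x. ereal (f x)) = (\<lambda>x. ereal (?T t f x))" if "f \<in> bounded_reals" "t \<ge> 0" for f t
    using ereal_real_version[OF Ts[OF that(2)] that(1) bounded_funs_ereal[OF that(1)]] by auto
  have T_bd: "?T t f \<in> bounded_reals" if "f \<in> bounded_reals" "t \<ge> 0" for f t
    by (rule real_upper_expectation_family_bounded[OF Tr[OF that(2)] that(1)])
  have T0: "?T 0 f = f" if f: "f \<in> bounded_reals" for f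
  proof -
    have "T 0 (\<lambda>x. ereal (f x)) = (\<lambda>x. ereal (f x))"
      using T bounded_funs_ereal[OF f] by (simp add: sublinear_markov_semigroup_def upper_transition_semigroup_def)
    then show ?thesis using T_eq[OF f, of 0] by (simp add: fun_eq_iff)
  qed
  have vanish: "(\<lambda>n. real_version \<Phi> (F n)) \<longlonglongrightarrow> 0"
    if \<Phi>: "sublinear_expectation (bounded_funs UNIV) \<Phi>" "downward_continuous_on (bounded_funs UNIV) \<Phi>"
      and F: "\<And>n. F n \<in> bounded_reals" "decseq F" "\<And>x. (\<lambda>n. F n x) \<longlonglongrightarrow> 0"
    for \<Phi> and F :: "nat \<Rightarrow> 'x \<Rightarrow> real"
  proof -
    have "decseq (\<lambda>n x. ereal (F n x))"
      using decseq_SucD[OF F(2)] by (intro decseq_SucI le_funI) (simp add: le_fun_def)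
    moreover have "(\<lambda>n. ereal (F n x)) \<longlonglongrightarrow> ereal 0" for x using F(3) by (intro tendsto_intros)
    ultimately have "decreases_to (\<lambda>n x. ereal (F n x)) (\<lambda>_. ereal 0)" by (simp only: decreases_to_def simp_thms)
    then have "(\<lambda>n. \<Phi> (\<lambda>x. ereal (F n x))) \<longlonglongrightarrow> \<Phi> (\<lambda>_. ereal 0)"
      by (rule downward_continuous_onD[OF \<Phi>(2) bounded_funs_ereal[OF F(1)] sublinear_expectation_mem[OF \<Phi>(1)]])
    then have "(\<lambda>n. ereal (real_version \<Phi> (F n))) \<longlonglongrightarrow> ereal 0"
      by (simp only: ereal_real_version[OF \<Phi>(1) F(1) bounded_funs_ereal[OF F(1)]] sublinear_expectation_const[OF \<Phi>(1)])
    then show ?thesis by (simp only: lim_ereal)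
  qed
  have jump_bd: "(\<lambda>y. of_bool (x \<noteq> y) :: real) \<in> bounded_reals" for x :: 'x by (rule bounded_reals_of_bool)
  have jump: "T t (\<lambda>y. 1 - indicator {x} y) x = ereal (?T t (\<lambda>y. of_bool (x \<noteq> y)) x)" if "t \<ge> 0" for t x
  proof -
    have "(\<lambda>y. 1 - indicator {x} y) = (\<lambda>y. ereal (of_bool (x \<noteq> y)))"
      by (auto simp: indicator_def one_ereal_def zero_ereal_def fun_eq_iff)
    then show ?thesis using T_eq[OF jump_bd that, of x] by simp
  qed
  have "\<exists>C d. d > 0 \<and> (\<forall>t. 0 < t \<and> t < d \<longrightarrow> (\<forall>x. ?T t (\<lambda>y. of_bool (x \<noteq> y)) x \<le> C * t))"
  proof -
    let ?s = "\<lambda>t. SUP x. T t (\<lambda>y. 1 - indicator {x} y) x"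
    obtain C where "Limsup (at_right 0) (\<lambda>t. ereal (1 / t) * ?s t) < ereal C"
      using rate ereal_dense2 unfolding uniformly_bounded_rate_def by blast
    then have "\<forall>\<^sub>F t in at_right 0. ereal (1 / t) * ?s t < ereal C" by (rule Limsup_lessD)
    then obtain d where d: "d > 0" "\<And>t. 0 < t \<Longrightarrow> t < d \<Longrightarrow> ereal (1 / t) * ?s t < ereal C"
      unfolding eventually_at_right_field by auto
    have "?T t (\<lambda>y. of_bool (x \<noteq> y)) x \<le> C * t" if t: "0 < t" "t < d" for t x
    proof -
      have "ereal (?T t (\<lambda>y. of_bool (x \<noteq> y)) x) \<le> ?s t"
        using t by (subst jump[symmetric]) (auto intro: SUP_upper)
      then have "ereal (1 / t) * ereal (?T t (\<lambda>y. of_bool (x \<noteq> y)) x) \<le> ereal (1 / t) * ?s t"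
        using t by (intro ereal_mult_left_mono) auto
      then have "ereal (1 / t) * ereal (?T t (\<lambda>y. of_bool (x \<noteq> y)) x) < ereal C"
        using d(2)[OF t] by (rule le_less_trans)
      then show ?thesis using t by (simp add: field_simps)
    qed
    then show ?thesis using d(1) by blast
  qed
  then obtain C d where d: "d > 0"
    and C: "\<And>t x. 0 < t \<Longrightarrow> t < d \<Longrightarrow> ?T t (\<lambda>y. of_bool (x \<noteq> y)) x \<le> C * t" by blast
  \<comment> \<open>\<open>C\<close> handles times below \<open>d\<close>; from \<open>d\<close> on,
    the trivial bound 1 is at most \<open>t / d\<close>; the final 1 makes the rate
    positive.\<close>
  define r where "r = max (max C (1 / d)) 1"
  have "real_markov_process (real_version E0) ?T r"
  proof (unfold_locales, rule e0)
    show "real_upper_expectation bounded_reals (\<lambda>f. ?T t f x)" if "0 \<le> t" for t x using Tr[OF that] .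
    show "?T (s + t) f = ?T s (?T t f)" if st: "0 \<le> s" "0 \<le> t" and f: "f \<in> bounded_reals" for s t f
    proof (cases "s = 0 \<or> t = 0")
      case True
      then show ?thesis using T0[OF f] T0[OF T_bd[OF f st(2)]] by auto
    next
      case False
      then have "T (s + t) (\<lambda>x. ereal (f x)) = T s (T t (\<lambda>x. ereal (f x)))"
        using T st bounded_funs_ereal[OF f] by (simp add: sublinear_markov_semigroup_def upper_transition_semigroup_def)
      then show ?thesis
        using T_eq[OF f, of "s + t"] T_eq[OF f st(2)] T_eq[OF T_bd[OF f st(2)] st(1)] st by (simp add: fun_eq_iff)
    qed
    show "?T 0 f = f" if "f \<in> bounded_reals" for f by (rule T0[OF that])
    show "(\<lambda>n. real_version E0 (F n)) \<longlonglongrightarrow> 0"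
      if "\<And>n. F n \<in> bounded_reals" "decseq F" "\<And>x. (\<lambda>n. F n x) \<longlonglongrightarrow> 0" for F
      using vanish[OF E0s E0(2) that] .
    show "(\<lambda>n. ?T t (F n) x) \<longlonglongrightarrow> 0"
      if t: "0 \<le> t" and F: "\<And>n. F n \<in> bounded_reals" "decseq F" "\<And>x. (\<lambda>n. F n x) \<longlonglongrightarrow> 0" for t F x
    proof (cases "t = 0")
      case True
      have "?T 0 (F n) x = F n x" for n using fun_cong[OF T0[OF F(1)]] .
      then show ?thesis using F(3)[of x] True by simp
    next
      case False
      then have "downward_continuous_on (bounded_funs UNIV) (\<lambda>g. T t g x)"
        using T t by (simp add: sublinear_markov_semigroup_def downward_continuous_operator_def)
      from vanish[OF Ts[OF t] this F] show ?thesis .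
    qed
    show "?T t (\<lambda>y. of_bool (x \<noteq> y)) x \<le> r * t" if t: "0 \<le> t" for t x
    proof -
      consider "t = 0" | "0 < t" "t < d" | "d \<le> t" using t by linarith
      then show ?thesis
      proof cases
        case 1
        then show ?thesis using fun_cong[OF T0[OF jump_bd[of x]], of x] by simp
      next
        case 2
        then have "?T t (\<lambda>y. of_bool (x \<noteq> y)) x \<le> C * t" by (rule C)
        also have "\<dots> \<le> r * t" using 2 by (intro mult_right_mono) (auto simp: r_def)
        finally show ?thesis .
      next
        case 3
        have "\<bar>?T t (\<lambda>y. of_bool (x \<noteq> y)) x\<bar> \<le> 1"
          by (rule real_upper_expectation_bound[OF Tr[OF t] jump_bd]) simp
        also have "1 \<le> (1 / d) * t" using 3 d by (simp add: field_simps)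
        also have "\<dots> \<le> r * t" using t by (intro mult_right_mono) (auto simp: r_def)
        finally show ?thesis by simp
      qed
    qed
    show "r > 0" by (simp add: r_def)
  qed
  then show ?thesis by (rule that)
qed

theorem theorem12:
  fixes E0 :: "('x::countable \<Rightarrow> ereal) \<Rightarrow> ereal"
    and T :: "real \<Rightarrow> ('x \<Rightarrow> ereal) \<Rightarrow> 'x \<Rightarrow> ereal"
  assumes "upper_expectation (bounded_funs UNIV) E0"
    and "downward_continuous_on (bounded_funs UNIV) E0"
    and "sublinear_markov_semigroup T"
    and "uniformly_bounded_rate T"
  shows "\<exists>E :: ('x cadlag_path \<Rightarrow> ereal) \<Rightarrow> ereal.
     (sublinear_expectation M_all E \<and>
      has_initial_expectation E0 E \<and>
      has_transitions T E \<and>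
      downward_continuous_on fin_dim_delta_b E \<and>
      upward_continuous_on M_bdd_below E) \<and>
     sublinear_expectation M_bdd_below E \<and>
     (\<forall>E' :: ('x cadlag_path \<Rightarrow> ereal) \<Rightarrow> ereal.
        sublinear_expectation M_bdd_below E' \<and>
        has_initial_expectation E0 E' \<and>
        has_transitions T E' \<and>
        downward_continuous_on fin_dim_delta_b E' \<and>
        upward_continuous_on M_bdd_below E' \<longrightarrow>
        (\<forall>f\<in>M_bdd_below. E' f = E f))"
proof -
  obtain r where "real_markov_process (real_version E0) (\<lambda>t f x. real_version (\<lambda>g. T t g x) f) r"
    using real_version_markov_process[OF assms] by blast
  then interpret P: real_markov_process "real_version E0" "\<lambda>t f x. real_version (\<lambda>g. T t g x) f" r .
  interpret C: continuous_cylinder_expectation P.cylinder_exp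
    by unfold_locales (rule P.real_upper_expectation_cylinder_exp, rule P.cylinder_exp_vanish)
  define E where "E = C.path_expectation"
  have E0_eq: "E0 (\<lambda>x. ereal (f x)) = ereal (real_version E0 f)" if "f \<in> bounded_reals" for f
    using assms(1) by (intro ereal_real_version[OF _ that bounded_funs_ereal[OF that]]) (simp add: upper_expectation_def)
  have T_eq: "T t (\<lambda>x. ereal (f x)) y = ereal (real_version (\<lambda>g. T t g y) f)" if "f \<in> bounded_reals" "t \<ge> 0" for f t y
    using assms(3) that(2)
    by (intro ereal_real_version[OF _ that(1) bounded_funs_ereal[OF that(1)]])
       (auto simp: sublinear_markov_semigroup_def upper_transition_semigroup_def
        upper_transition_operator_def upper_expectation_def)
  have E_cyl: "E (\<lambda>\<omega>. ereal (f \<omega>)) = ereal (P.cylinder_exp f)" if "f \<in> cylinder_funs" for f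
    unfolding E_def by (rule C.path_expectation_cylinder[OF that])
  have const: "(\<lambda>_. ereal c) \<in> (M_bdd_below :: ('x cadlag_path \<Rightarrow> ereal) set)" for c
    by (rule cylinder_funs_M_bdd_below[OF cylinder_funs_const])
  have sub: "sublinear_expectation M_bdd_below E" "sublinear_expectation M_all E"
    unfolding E_def using const
    by (auto intro!: C.sublinear_expectation_path_expectation simp: M_all_def M_bdd_below_def M_bdd_above_def)
  have init: "has_initial_expectation E0 E"
    unfolding has_initial_expectation_def
  proof
    fix f :: "'x \<Rightarrow> ereal" assume "f \<in> bounded_funs UNIV"
    then obtain h where h: "h \<in> bounded_reals" "f = (\<lambda>x. ereal (h x))" by (rule bounded_funs_UNIV_E)
    show "E (\<lambda>\<omega>. f (coord 0 \<omega>)) = E0 f"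
      unfolding h(2) E0_eq[OF h(1)]
      using E_cyl[OF P.cylinder_exp_single(1)[OF _ h(1)], of 0] P.cylinder_exp_initial[OF h(1)] by simp
  qed
  have trans: "has_transitions T E"
    unfolding has_transitions_def Let_def
  proof (intro allI impI, elim conjE)
    fix ts :: "real list" and t and f :: "'x list \<Rightarrow> ereal"
    assume ts: "ts \<noteq> []" "set (ts @ [t]) \<subseteq> {0..}" "sorted_wrt (<) (ts @ [t])"
      and f: "f \<in> bounded_funs {xs. length xs = length ts + 1}"
    obtain c where c: "\<And>xs. length xs = length ts + 1 \<Longrightarrow> \<bar>f xs\<bar> \<le> ereal c"
      using f by (auto simp: bounded_funs_def)
    \<comment> \<open>\<open>f\<close> is known to be finite and bounded only on lists of the right
      length, so the facts about \<open>h\<close> carry this length condition.\<close>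
    define h where "h xs = real_of_ereal (f xs)" for xs
    have f_h: "f xs = ereal (h xs)" "\<bar>h xs\<bar> \<le> c" if "length xs = length ts + 1" for xs
      using c[OF that] by (cases "f xs"; simp add: h_def)+
    have last: "0 \<le> t - last ts"
      using ts(3) last_in_set[OF ts(1)] by (auto simp: sorted_wrt_append less_imp_le)
    let ?g = "\<lambda>xs. real_version (\<lambda>u. T (t - last ts) u (last xs)) (\<lambda>y. h (xs @ [y]))"
    have hb: "(\<lambda>y. h (xs @ [y])) \<in> bounded_reals" if "length xs = length ts" for xs
      using f_h(2) that by (intro bounded_realsI[of _ c]) simp
    have g: "\<bar>?g xs\<bar> \<le> c" if "length xs = length ts" for xs
      using f_h(2) that by (intro real_upper_expectation_bound[OF P.T[OF last]] hb) auto
    have "E (\<lambda>\<omega>. f (map (\<lambda>s. coord s \<omega>) (ts @ [t]))) = E (\<lambda>\<omega>. ereal (h (map (\<lambda>s. coord s \<omega>) (ts @ [t]))))"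
      using f_h(1) by simp
    also have "\<dots> = ereal (P.cylinder_exp (\<lambda>\<omega>. h (map (\<lambda>s. coord s \<omega>) (ts @ [t]))))"
      using ts f_h(2) by (intro E_cyl P.cylinder_exp_list(1)[where c = c]) auto
    also have "P.cylinder_exp (\<lambda>\<omega>. h (map (\<lambda>s. coord s \<omega>) (ts @ [t]))) =
        P.cylinder_exp (\<lambda>\<omega>. ?g (map (\<lambda>s. coord s \<omega>) ts))"
      using P.cylinder_exp_transition[OF ts(1,3,2), of h c] f_h(2) ts(1) by (simp add: last_map)
    also have "ereal \<dots> = E (\<lambda>\<omega>. ereal (?g (map (\<lambda>s. coord s \<omega>) ts)))"
      using ts g by (intro E_cyl[symmetric] P.cylinder_exp_list(1)[where c = c]) (auto simp: sorted_wrt_append)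
    also have "\<dots> = E (\<lambda>\<omega>. T (t - last ts) (\<lambda>y. f (map (\<lambda>s. coord s \<omega>) ts @ [y])) (last (map (\<lambda>s. coord s \<omega>) ts)))"
      using f_h(1) by (simp add: T_eq[OF hb last])
    finally show "E (\<lambda>\<omega>. f (map (\<lambda>s. coord s \<omega>) (ts @ [t]))) =
      E (\<lambda>\<omega>. T (t - last ts) (\<lambda>y. f (map (\<lambda>s. coord s \<omega>) ts @ [y])) (last (map (\<lambda>s. coord s \<omega>) ts)))" .
  qed
  have down: "downward_continuous_on fin_dim_delta_b E"
    unfolding E_def by (rule C.downward_continuous_path_expectation)
  have up: "upward_continuous_on M_bdd_below E"
    unfolding E_def by (rule C.upward_continuous_path_expectation)
  \<comment> \<open>Uniqueness uses of a competitor only monotonicity and the two continuity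
    properties, besides its values on cylinder functions.\<close>
  have capacity: "path_capacity E'"
    if "sublinear_expectation M_bdd_below E'" "downward_continuous_on fin_dim_delta_b E'"
      "upward_continuous_on M_bdd_below E'" for E' :: "('x cadlag_path \<Rightarrow> ereal) \<Rightarrow> ereal"
    using that sublinear_expectation_mono[OF that(1)] by unfold_locales
  have "E' f = E f"
    if E': "sublinear_expectation M_bdd_below E'" "has_initial_expectation E0 E'" "has_transitions T E'"
      "downward_continuous_on fin_dim_delta_b E'" "upward_continuous_on M_bdd_below E'" and f: "f \<in> M_bdd_below"
    for E' :: "('x cadlag_path \<Rightarrow> ereal) \<Rightarrow> ereal" and f
  proof (rule path_capacity_eqI[OF capacity[OF E'(1,4,5)] capacity[OF sub(1) down up] _ f])
    fix u :: "'x cadlag_path \<Rightarrow> real" assume u: "u \<in> cylinder_funs"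
    have "E' (\<lambda>\<omega>. ereal (u \<omega>)) = ereal (P.cylinder_exp u)"
    proof (rule P.expectation_determined[OF _ _ u])
      show "E' (\<lambda>\<omega>. ereal (h (coord 0 \<omega>))) = ereal (real_version E0 h)" if "h \<in> bounded_reals" for h
        using E'(2)[unfolded has_initial_expectation_def, rule_format, OF bounded_funs_ereal[OF that]]
          E0_eq[OF that] by simp
      fix ts :: "real list" and t c and h :: "'x list \<Rightarrow> real"
      assume ts: "ts \<noteq> []" "set (ts @ [t]) \<subseteq> {0..}" "sorted_wrt (<) (ts @ [t])" and h: "\<And>xs. \<bar>h xs\<bar> \<le> c"
      have last: "0 \<le> t - last ts"
        using ts(3) last_in_set[OF ts(1)] by (auto simp: sorted_wrt_append less_imp_le)
      have hb: "(\<lambda>y. h (xs @ [y])) \<in> bounded_reals" for xs by (rule bounded_realsI[of _ c]) (rule h)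
      have "(\<lambda>xs. ereal (h xs)) \<in> bounded_funs {xs. length xs = length ts + 1}"
        using h by (auto simp: bounded_funs_def)
      then have "E' (\<lambda>\<omega>. ereal (h (map (\<lambda>s. coord s \<omega>) (ts @ [t])))) =
        E' (\<lambda>\<omega>. T (t - last ts) (\<lambda>y. ereal (h (map (\<lambda>s. coord s \<omega>) ts @ [y]))) (last (map (\<lambda>s. coord s \<omega>) ts)))"
        using E'(3)[unfolded has_transitions_def Let_def, rule_format, of ts t "\<lambda>xs. ereal (h xs)"] ts by blast
      also have "\<dots> = E' (\<lambda>\<omega>. ereal (real_version (\<lambda>g. T (t - last ts) g (coord (last ts) \<omega>))
          (\<lambda>y. h (map (\<lambda>s. coord s \<omega>) ts @ [y]))))"
        using ts(1) by (simp add: T_eq[OF hb last] last_map)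
      finally show "E' (\<lambda>\<omega>. ereal (h (map (\<lambda>s. coord s \<omega>) (ts @ [t])))) =
        E' (\<lambda>\<omega>. ereal (real_version (\<lambda>g. T (t - last ts) g (coord (last ts) \<omega>))
          (\<lambda>y. h (map (\<lambda>s. coord s \<omega>) ts @ [y]))))" .
    qed
    then show "E' (\<lambda>\<omega>. ereal (u \<omega>)) = E (\<lambda>\<omega>. ereal (u \<omega>))" using E_cyl[OF u] by simp
  qed
  then show ?thesis using sub init trans down up by (intro exI[of _ E]) blast
qed

end
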